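(* Let $M$, $L$, $\bar r$, $T$ and $\mathcal{B}_T$ be as described in the context. Assume that $D(\bar c)\in\mathcal{B}_T$, where $\bar c$ includes all distinguished elements of $M$, satisfies the following two properties: (1) for every extension $D'(\bar c')\in\mathcal{B}_T$ of $D(\bar c)$, the theory $D'(\bar c')\cup T\cup Th(M,\bar c')$ is computably enumerable; (2) for every $(M,\mathbf{\bar r})\in[D(\bar c)]$, the substructure of $\mathsf{Gp}$ generated by $\bar c\cap\mathsf{Gp}$ in $(M,\mathbf{\bar r})$ has undecidable theory $\Xi_{\bar c\cap\mathsf{Gp},\mathbf{\bar r}}$. Then $D(\bar c)$ does not have an extension as required by the weak amalgamation property for $\mathcal{B}_T$; that is, there is no $D'\in\mathcal{B}_T$ with $D(\bar c)\subseteq D'$ such that for all $D_1,D_2\in\mathcal{B}_T$ with $D'\subseteq D_1$ and $D'\subseteq D_2$ there are $D_3\in\mathcal{B}_T$ and an automorphism $\alpha\in\mathrm{Aut}(M)$ fixing $\mathsf{Dom}(D)$ (pointwise) with $D_1\subseteq D_3$ and $\alpha(D_2)\subseteq D_3$.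
   Context: Setting. $M$ is a countable $\omega$-categorical structure (i.e. $Th(M)$ is $\omega$-categorical) in a language $L$ with a distinguished sort $\mathsf{Gp}$. $\bar r=(r_1,\dots,r_\iota)$ is a finite sequence of additional relation/function symbols (constants allowed), and $T\supseteq Th(M)$ is a theory in $L\cup\bar r$ axiomatizable by sentences of the form $(\forall\bar x)\bigl(\bigvee_i(\phi_i(\bar x)\wedge\psi_i(\bar x))\bigr)$, where each $\phi_i$ is a quantifier-free formula of $L\cup\bar r$ and each $\psi_i$ is a first-order formula of $L$. $\mathcal{X}_{M,T}$ is the space of all expansions $(M,\mathbf{\bar r})$ of $M$ to models of $T$. Diagrams. For a finite $A\subset M$ (written as a tuple $\bar a$ of pairwise distinct elements), a diagram $D(\bar a)$ of $\bar r$ on $A$ associates to every function symbol $r_i$ of arity $\ell$ a partial function $A^\ell\to A$, and for every relation symbol $r_i$ and every tuple $\bar a'$ from $A$ of the corresponding length it contains exactly one of $r_i(\bar a')$, $\neg r_i(\bar a')$. We write $\mathsf{Dom}(D)=\bar a$. An expansion satisfies $D(\bar a)$ if its interpretation of $\bar r$ agrees with these partial functions and relations. $\mathcal{B}_T$ is the set of all theories $D(\bar a)\cup T\cup Th(M,\bar a)$ which are satisfied in some expansion $(M,\mathbf{\bar r})\models T$; such a theory is identified with the diagram $D(\bar a)$. $[D]$ is the set of all $(M,\mathbf{\bar r})\in\mathcal{X}_{M,T}$ satisfying $D(\bar a)$. For $D,D'\in\mathcal{B}_T$, $D\subseteq D'$ ($D'$ is an extension of $D$) means that $\mathsf{Dom}(D)\subseteq\mathsf{Dom}(D')$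 and $D'$ implies $D$ under $T$ (in particular the partial functions of $D'$ extend those of $D$). For $\alpha\in\mathrm{Aut}(M)$, $\alpha(D)$ is the diagram obtained from $D(\bar a)$ by substituting $\alpha(\bar a)$ for $\bar a$. Substructures and $\Xi$. For an expansion $(M,\mathbf{\bar r})$, $\mathsf{Gp}$ is viewed as a structure with respect to those relations/functions of $L\cup\bar r$ that do not depend on elements of other sorts; a subset of $\mathsf{Gp}$ closed under the operations of $\mathsf{Gp}$ is a substructure. $\bar c\cap\mathsf{Gp}$ denotes the subtuple of $\bar c$ of entries belonging to $\mathsf{Gp}$. For a tuple $\bar e$ of sort $\mathsf{Gp}$, $\Xi_{\bar e,\mathbf{\bar r}}$ is the set of all conditions valid in $(M,\mathbf{\bar r})$ of the form $r_i(t_1(\bar e_1),\dots,t_k(\bar e_k))$ or its negation, and $t_1(\bar e')=t_2(\bar e'')$ or $t_1(\bar e')\neq t_2(\bar e'')$, where $\bar e_1,\dots,\bar e_k,\bar e',\bar e''$ are subtuples of $\bar e$ and the $t_j$ are terms of $L\cup\bar r$. *)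

theory Defs
  imports Main "HOL-Library.Nat_Bijection" "HOL-Library.Countable_Set" "HOL-Library.Infinite_Typeclass"
begin

section \<open>Computability\<close>

datatype recf =
    Zero
  | Succ
  | Proj nat
  | Comp recf "recf list"
  | PrimRec recf recf
  | Mu recf

text \<open>The graph of the partial function computed by a description.  In primitive recursion and
  minimisation the recursion variable, respectively the searched variable, is the first argument.\<close>

inductive computes :: "recf \<Rightarrow> nat list \<Rightarrow> nat \<Rightarrow> bool" where
  "computes Zero xs 0"
| "computes Succ (x # xs) (Suc x)"
| "i < length xs \<Longrightarrow> computes (Proj i) xs (xs ! i)"
| "list_all2 (\<lambda>g y. computes g xs y) gs ys \<Longrightarrow> computes f ys z \<Longrightarrow> computes (Comp f gs) xs z"
| "computes f xs y \<Longrightarrow> computes (PrimRec f g) (0 # xs) y"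
| "computes (PrimRec f g) (n # xs) y \<Longrightarrow> computes g (n # y # xs) z
    \<Longrightarrow> computes (PrimRec f g) (Suc n # xs) z"
| "computes f (n # xs) 0 \<Longrightarrow> (\<And>m. m < n \<Longrightarrow> \<exists>y. computes f (m # xs) (Suc y))
    \<Longrightarrow> computes (Mu f) xs n"

definition partial_computable :: "(nat \<rightharpoonup> nat) \<Rightarrow> bool" where
  "partial_computable f \<longleftrightarrow> (\<exists>r. \<forall>x y. f x = Some y \<longleftrightarrow> computes r [x] y)"

definition computable :: "(nat \<Rightarrow> nat) \<Rightarrow> bool" where
  "computable f \<longleftrightarrow> partial_computable (\<lambda>x. Some (f x))"

definition comp_enumerable :: "nat set \<Rightarrow> bool" where
  "comp_enumerable S \<longleftrightarrow> S = {} \<or> (\<exists>f. computable f \<and> S = range f)"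

text \<open>Decidability of membership in \<open>S\<close> for inputs from \<open>C\<close>: nothing is required of the algorithm
  outside \<open>C\<close>.  For a computable set \<open>C\<close> and \<open>S \<subseteq> C\<close> this says that \<open>S\<close> is computable.\<close>

definition decidable_among :: "nat set \<Rightarrow> nat set \<Rightarrow> bool" where
  "decidable_among C S \<longleftrightarrow>
     (\<exists>f. partial_computable f \<and> (\<forall>n\<in>C. f n = Some (if n \<in> S then 1 else 0)))"

section \<open>Many-sorted first-order logic\<close>

text \<open>A signature assigns argument sorts and a result sort to its function symbols (constants have
  no arguments), and argument sorts to its relation symbols.\<close>

record 's sig =
  sorts :: "nat set"
  fun_ty :: "'s \<rightharpoonup> nat list \<times> nat"
  rel_ty :: "'s \<rightharpoonup> nat list"

definition wf_sig :: "'s sig \<Rightarrow> bool" where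
  "wf_sig \<Sigma> \<longleftrightarrow>
     (\<forall>f ss s. fun_ty \<Sigma> f = Some (ss, s) \<longrightarrow> set ss \<subseteq> sorts \<Sigma> \<and> s \<in> sorts \<Sigma>) \<and>
     (\<forall>r ss. rel_ty \<Sigma> r = Some ss \<longrightarrow> set ss \<subseteq> sorts \<Sigma>)"

text \<open>Symbols of \<open>L\<close>, the additional symbols \<open>r\<^sub>0, r\<^sub>1, \<dots>\<close>, and constants naming elements.\<close>

datatype 'a name = Old nat | New nat | Elem 'a

text \<open>\<open>Var s n\<close> is the \<open>n\<close>-th variable of sort \<open>s\<close>.\<close>

datatype 'a tm = Var nat nat | Fn "'a name" "'a tm list"

datatype 'a fm =
    Fls
  | Eq "'a tm" "'a tm"
  | Rel "'a name" "'a tm list"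
  | Neg "'a fm"
  | Conj "'a fm" "'a fm"
  | Disj "'a fm" "'a fm"
  | All nat nat "'a fm"
  | Exi nat nat "'a fm"

inductive has_sort :: "'a name sig \<Rightarrow> 'a tm \<Rightarrow> nat \<Rightarrow> bool" for \<Sigma> where
  "s \<in> sorts \<Sigma> \<Longrightarrow> has_sort \<Sigma> (Var s n) s"
| "fun_ty \<Sigma> f = Some (ss, s) \<Longrightarrow> list_all2 (has_sort \<Sigma>) ts ss \<Longrightarrow> has_sort \<Sigma> (Fn f ts) s"

primrec wf_fm :: "'a name sig \<Rightarrow> 'a fm \<Rightarrow> bool" where
  "wf_fm \<Sigma> Fls \<longleftrightarrow> True"
| "wf_fm \<Sigma> (Eq t u) \<longleftrightarrow> (\<exists>s. has_sort \<Sigma> t s \<and> has_sort \<Sigma> u s)"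
| "wf_fm \<Sigma> (Rel r ts) \<longleftrightarrow> (\<exists>ss. rel_ty \<Sigma> r = Some ss \<and> list_all2 (has_sort \<Sigma>) ts ss)"
| "wf_fm \<Sigma> (Neg p) \<longleftrightarrow> wf_fm \<Sigma> p"
| "wf_fm \<Sigma> (Conj p q) \<longleftrightarrow> wf_fm \<Sigma> p \<and> wf_fm \<Sigma> q"
| "wf_fm \<Sigma> (Disj p q) \<longleftrightarrow> wf_fm \<Sigma> p \<and> wf_fm \<Sigma> q"
| "wf_fm \<Sigma> (All s n p) \<longleftrightarrow> s \<in> sorts \<Sigma> \<and> wf_fm \<Sigma> p"
| "wf_fm \<Sigma> (Exi s n p) \<longleftrightarrow> s \<in> sorts \<Sigma> \<and> wf_fm \<Sigma> p"

fun tm_vars :: "'a tm \<Rightarrow> (nat \<times> nat) set" where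
  "tm_vars (Var s n) = {(s, n)}"
| "tm_vars (Fn f ts) = (\<Union>t\<in>set ts. tm_vars t)"

primrec free_vars :: "'a fm \<Rightarrow> (nat \<times> nat) set" where
  "free_vars Fls = {}"
| "free_vars (Eq t u) = tm_vars t \<union> tm_vars u"
| "free_vars (Rel r ts) = (\<Union>t\<in>set ts. tm_vars t)"
| "free_vars (Neg p) = free_vars p"
| "free_vars (Conj p q) = free_vars p \<union> free_vars q"
| "free_vars (Disj p q) = free_vars p \<union> free_vars q"
| "free_vars (All s n p) = free_vars p - {(s, n)}"
| "free_vars (Exi s n p) = free_vars p - {(s, n)}"

primrec quantifier_free :: "'a fm \<Rightarrow> bool" where
  "quantifier_free Fls \<longleftrightarrow> True"
| "quantifier_free (Eq t u) \<longleftrightarrow> True"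
| "quantifier_free (Rel r ts) \<longleftrightarrow> True"
| "quantifier_free (Neg p) \<longleftrightarrow> quantifier_free p"
| "quantifier_free (Conj p q) \<longleftrightarrow> quantifier_free p \<and> quantifier_free q"
| "quantifier_free (Disj p q) \<longleftrightarrow> quantifier_free p \<and> quantifier_free q"
| "quantifier_free (All s n p) \<longleftrightarrow> False"
| "quantifier_free (Exi s n p) \<longleftrightarrow> False"

definition sentences :: "'a name sig \<Rightarrow> 'a fm set" where
  "sentences \<Sigma> = {p. wf_fm \<Sigma> p \<and> free_vars p = {}}"

text \<open>The sorts of a structure are the disjoint sets \<open>{a \<in> univ N. sort_of N a = s}\<close>.  Interpretations
  of symbols matter only on well-sorted tuples from the universe.\<close>

record 'a struct =
  univ :: "'a set"
  sort_of :: "'a \<Rightarrow> nat"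
  fun_int :: "'a name \<Rightarrow> 'a list \<Rightarrow> 'a"
  rel_int :: "'a name \<Rightarrow> 'a list \<Rightarrow> bool"

definition tuples :: "'a struct \<Rightarrow> 'a set \<Rightarrow> nat list \<Rightarrow> 'a list set" where
  "tuples N A ss = {as. set as \<subseteq> A \<and> map (sort_of N) as = ss}"

definition is_struct :: "'a name sig \<Rightarrow> 'a struct \<Rightarrow> bool" where
  "is_struct \<Sigma> N \<longleftrightarrow>
     (\<forall>a\<in>univ N. sort_of N a \<in> sorts \<Sigma>) \<and>
     (\<forall>f ss s. fun_ty \<Sigma> f = Some (ss, s) \<longrightarrow>
        (\<forall>as\<in>tuples N (univ N) ss. fun_int N f as \<in> univ N \<and> sort_of N (fun_int N f as) = s))"

fun tm_val :: "'a struct \<Rightarrow> (nat \<times> nat \<Rightarrow> 'a) \<Rightarrow> 'a tm \<Rightarrow> 'a" where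
  "tm_val N v (Var s n) = v (s, n)"
| "tm_val N v (Fn f ts) = fun_int N f (map (tm_val N v) ts)"

primrec sat :: "'a struct \<Rightarrow> (nat \<times> nat \<Rightarrow> 'a) \<Rightarrow> 'a fm \<Rightarrow> bool" where
  "sat N v Fls \<longleftrightarrow> False"
| "sat N v (Eq t u) \<longleftrightarrow> tm_val N v t = tm_val N v u"
| "sat N v (Rel r ts) \<longleftrightarrow> rel_int N r (map (tm_val N v) ts)"
| "sat N v (Neg p) \<longleftrightarrow> \<not> sat N v p"
| "sat N v (Conj p q) \<longleftrightarrow> sat N v p \<and> sat N v q"
| "sat N v (Disj p q) \<longleftrightarrow> sat N v p \<or> sat N v q"
| "sat N v (All s n p) \<longleftrightarrow> (\<forall>a\<in>univ N. sort_of N a = s \<longrightarrow> sat N (v((s, n) := a)) p)"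
| "sat N v (Exi s n p) \<longleftrightarrow> (\<exists>a\<in>univ N. sort_of N a = s \<and> sat N (v((s, n) := a)) p)"

text \<open>Used for sentences only, whose truth does not depend on the valuation.\<close>

definition valid_in :: "'a struct \<Rightarrow> 'a fm \<Rightarrow> bool" where
  "valid_in N p \<longleftrightarrow> (\<forall>v. sat N v p)"

definition is_model :: "'a name sig \<Rightarrow> 'a fm set \<Rightarrow> 'a struct \<Rightarrow> bool" where
  "is_model \<Sigma> \<Gamma> N \<longleftrightarrow> is_struct \<Sigma> N \<and> (\<forall>p\<in>\<Gamma>. valid_in N p)"

text \<open>The set of sentences that follow from \<open>\<Gamma>\<close>.  Models range over structures with universe in the
  type \<open>'a\<close>; signatures are countable, so by the Loewenheim--Skolem theorem this does not depend on
  the infinite type \<open>'a\<close>.\<close>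

definition consequences :: "('a :: infinite) name sig \<Rightarrow> 'a fm set \<Rightarrow> 'a fm set" where
  "consequences \<Sigma> \<Gamma> = {p \<in> sentences \<Sigma>. \<forall>N :: 'a struct. is_model \<Sigma> \<Gamma> N \<longrightarrow> valid_in N p}"

definition isomorphism :: "'a name sig \<Rightarrow> ('a \<Rightarrow> 'a) \<Rightarrow> 'a struct \<Rightarrow> 'a struct \<Rightarrow> bool" where
  "isomorphism \<Sigma> h N N' \<longleftrightarrow>
     bij_betw h (univ N) (univ N') \<and>
     (\<forall>a\<in>univ N. sort_of N' (h a) = sort_of N a) \<and>
     (\<forall>f ss s. fun_ty \<Sigma> f = Some (ss, s) \<longrightarrow>
        (\<forall>as\<in>tuples N (univ N) ss. h (fun_int N f as) = fun_int N' f (map h as))) \<and>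
     (\<forall>r ss. rel_ty \<Sigma> r = Some ss \<longrightarrow>
        (\<forall>as\<in>tuples N (univ N) ss. rel_int N r as \<longleftrightarrow> rel_int N' r (map h as)))"

text \<open>Applied to complete theories only: these have either no finite models, or only one model up
  to isomorphism, so it is harmless that \<open>countable\<close> includes finite universes.\<close>

definition omega_categorical :: "('a :: infinite) name sig \<Rightarrow> 'a fm set \<Rightarrow> bool" where
  "omega_categorical \<Sigma> \<Gamma> \<longleftrightarrow>
     (\<forall>N N' :: 'a struct. is_model \<Sigma> \<Gamma> N \<and> countable (univ N) \<and> is_model \<Sigma> \<Gamma> N' \<and> countable (univ N')
        \<longrightarrow> (\<exists>h. isomorphism \<Sigma> h N N'))"

subsection \<open>Goedel numbering\<close>

text \<open>\<open>\<nu>\<close> numbers the element constants.\<close>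

fun name_code :: "('a \<Rightarrow> nat) \<Rightarrow> 'a name \<Rightarrow> nat" where
  "name_code \<nu> (Old k) = prod_encode (0, k)"
| "name_code \<nu> (New i) = prod_encode (1, i)"
| "name_code \<nu> (Elem a) = prod_encode (2, \<nu> a)"

fun tm_code :: "('a \<Rightarrow> nat) \<Rightarrow> 'a tm \<Rightarrow> nat" where
  "tm_code \<nu> (Var s n) = prod_encode (0, prod_encode (s, n))"
| "tm_code \<nu> (Fn f ts) = prod_encode (1, prod_encode (name_code \<nu> f, list_encode (map (tm_code \<nu>) ts)))"

primrec fm_code :: "('a \<Rightarrow> nat) \<Rightarrow> 'a fm \<Rightarrow> nat" where
  "fm_code \<nu> Fls = prod_encode (0, 0)"
| "fm_code \<nu> (Eq t u) = prod_encode (1, prod_encode (tm_code \<nu> t, tm_code \<nu> u))"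
| "fm_code \<nu> (Rel r ts) = prod_encode (2, prod_encode (name_code \<nu> r, list_encode (map (tm_code \<nu>) ts)))"
| "fm_code \<nu> (Neg p) = prod_encode (3, fm_code \<nu> p)"
| "fm_code \<nu> (Conj p q) = prod_encode (4, prod_encode (fm_code \<nu> p, fm_code \<nu> q))"
| "fm_code \<nu> (Disj p q) = prod_encode (5, prod_encode (fm_code \<nu> p, fm_code \<nu> q))"
| "fm_code \<nu> (All s n p) = prod_encode (6, prod_encode (prod_encode (s, n), fm_code \<nu> p))"
| "fm_code \<nu> (Exi s n p) = prod_encode (7, prod_encode (prod_encode (s, n), fm_code \<nu> p))"

section \<open>Expansions of a structure by finitely many symbols\<close>

datatype new_sym = NewRel "nat list" | NewFun "nat list" nat

definition wf_new_sym :: "nat sig \<Rightarrow> new_sym \<Rightarrow> bool" where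
  "wf_new_sym L r \<longleftrightarrow>
     (case r of NewRel ss \<Rightarrow> set ss \<subseteq> sorts L | NewFun ss s \<Rightarrow> set ss \<subseteq> sorts L \<and> s \<in> sorts L)"

text \<open>The signature of \<open>L \<union> rs\<close> with additional constants for the elements of \<open>A\<close>.\<close>

definition lang :: "nat sig \<Rightarrow> new_sym list \<Rightarrow> 'a struct \<Rightarrow> 'a set \<Rightarrow> 'a name sig" where
  "lang L rs M A = \<lparr>
     sorts = sorts L,
     fun_ty = (\<lambda>f. case f of
         Old k \<Rightarrow> fun_ty L k
       | New i \<Rightarrow> (if i < length rs then (case rs ! i of NewFun ss s \<Rightarrow> Some (ss, s) | NewRel ss \<Rightarrow> None)
                  else None)
       | Elem a \<Rightarrow> (if a \<in> A then Some ([], sort_of M a) else None)),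
     rel_ty = (\<lambda>r. case r of
         Old k \<Rightarrow> rel_ty L k
       | New i \<Rightarrow> (if i < length rs then (case rs ! i of NewRel ss \<Rightarrow> Some ss | NewFun ss s \<Rightarrow> None)
                  else None)
       | Elem a \<Rightarrow> None) \<rparr>"

text \<open>Constants \<open>Elem a\<close> are interpreted by \<open>a\<close>.\<close>

definition naming :: "'a struct \<Rightarrow> 'a struct" where
  "naming N = N\<lparr>fun_int := (\<lambda>f. case f of Elem a \<Rightarrow> (\<lambda>_. a) | _ \<Rightarrow> fun_int N f)\<rparr>"

text \<open>\<open>Th L M {}\<close> is \<open>Th(M)\<close>, and \<open>Th L M (set as)\<close> is \<open>Th(M, as)\<close>.\<close>

definition Th :: "nat sig \<Rightarrow> 'a struct \<Rightarrow> 'a set \<Rightarrow> 'a fm set" where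
  "Th L M A = {p \<in> sentences (lang L [] M A). valid_in (naming M) p}"

definition automorphism :: "nat sig \<Rightarrow> 'a struct \<Rightarrow> ('a \<Rightarrow> 'a) \<Rightarrow> bool" where
  "automorphism L M \<alpha> \<longleftrightarrow> isomorphism (lang L [] M {}) \<alpha> M M"

text \<open>Sentences \<open>\<forall>x\<^sub>1\<dots>x\<^sub>m. (\<phi>\<^sub>1 \<and> \<psi>\<^sub>1) \<or> \<dots> \<or> (\<phi>\<^sub>k \<and> \<psi>\<^sub>k) \<or> \<bottom>\<close> with \<open>\<phi>\<^sub>i\<close> quantifier-free over \<open>L \<union> rs\<close> and
  \<open>\<psi>\<^sub>i\<close> over \<open>L\<close>.\<close>

definition special_sentences :: "nat sig \<Rightarrow> new_sym list \<Rightarrow> 'a struct \<Rightarrow> 'a fm set" where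
  "special_sentences L rs M = {p \<in> sentences (lang L rs M {}). \<exists>xs \<phi>\<psi>s.
     p = foldr (\<lambda>(s, n). All s n) xs (foldr Disj (map (\<lambda>(\<phi>, \<psi>). Conj \<phi> \<psi>) \<phi>\<psi>s) Fls) \<and>
     (\<forall>(\<phi>, \<psi>)\<in>set \<phi>\<psi>s. wf_fm (lang L rs M {}) \<phi> \<and> quantifier_free \<phi> \<and> wf_fm (lang L [] M {}) \<psi>)}"

definition admissible_theory ::
  "nat sig \<Rightarrow> new_sym list \<Rightarrow> ('a :: infinite) struct \<Rightarrow> 'a fm set \<Rightarrow> bool" where
  "admissible_theory L rs M T \<longleftrightarrow>
     T \<subseteq> sentences (lang L rs M {}) \<and> Th L M {} \<subseteq> T \<and>
     (\<exists>Ax \<subseteq> special_sentences L rs M.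
        consequences (lang L rs M {}) Ax = consequences (lang L rs M {}) T)"

definition is_expansion :: "nat sig \<Rightarrow> new_sym list \<Rightarrow> 'a struct \<Rightarrow> 'a struct \<Rightarrow> bool" where
  "is_expansion L rs M N \<longleftrightarrow>
     is_struct (lang L rs M {}) N \<and> univ N = univ M \<and> sort_of N = sort_of M \<and>
     (\<forall>k. fun_int N (Old k) = fun_int M (Old k) \<and> rel_int N (Old k) = rel_int M (Old k))"

text \<open>The space \<open>\<X>\<^sub>M\<^sub>,\<^sub>T\<close>.\<close>

definition expansions ::
  "nat sig \<Rightarrow> new_sym list \<Rightarrow> 'a struct \<Rightarrow> 'a fm set \<Rightarrow> 'a struct set" where
  "expansions L rs M T = {N. is_expansion L rs M N \<and> (\<forall>p\<in>T. valid_in N p)}"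

section \<open>Diagrams\<close>

text \<open>\<open>dfun D i\<close> is the graph of the partial function attached to \<open>r\<^sub>i\<close>; \<open>drel D i\<close> is the set of
  tuples \<open>as\<close> for which the diagram contains \<open>r\<^sub>i(as)\<close>, so that it contains \<open>\<not> r\<^sub>i(as)\<close> for the other
  tuples from the domain.\<close>

record 'a diagram =
  Dom :: "'a list"
  dfun :: "nat \<Rightarrow> ('a list \<times> 'a) set"
  drel :: "nat \<Rightarrow> 'a list set"

definition wf_diagram :: "nat sig \<Rightarrow> new_sym list \<Rightarrow> 'a struct \<Rightarrow> 'a diagram \<Rightarrow> bool" where
  "wf_diagram L rs M D \<longleftrightarrow>
     distinct (Dom D) \<and> set (Dom D) \<subseteq> univ M \<and>
     (\<forall>i. single_valued (dfun D i)) \<and>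
     (\<forall>i as b. (as, b) \<in> dfun D i \<longrightarrow>
        (\<exists>ss s. fun_ty (lang L rs M {}) (New i) = Some (ss, s) \<and>
           as \<in> tuples M (set (Dom D)) ss \<and> b \<in> set (Dom D) \<and> sort_of M b = s)) \<and>
     (\<forall>i as. as \<in> drel D i \<longrightarrow>
        (\<exists>ss. rel_ty (lang L rs M {}) (New i) = Some ss \<and> as \<in> tuples M (set (Dom D)) ss))"

definition satisfies_diagram ::
  "nat sig \<Rightarrow> new_sym list \<Rightarrow> 'a struct \<Rightarrow> 'a diagram \<Rightarrow> 'a struct \<Rightarrow> bool" where
  "satisfies_diagram L rs M D N \<longleftrightarrow>
     (\<forall>i as b. (as, b) \<in> dfun D i \<longrightarrow> fun_int N (New i) as = b) \<and>
     (\<forall>i ss. rel_ty (lang L rs M {}) (New i) = Some ss \<longrightarrow>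
        (\<forall>as\<in>tuples M (set (Dom D)) ss. rel_int N (New i) as \<longleftrightarrow> as \<in> drel D i))"

text \<open>The set \<open>[D]\<close>.\<close>

definition diagram_class ::
  "nat sig \<Rightarrow> new_sym list \<Rightarrow> 'a struct \<Rightarrow> 'a fm set \<Rightarrow> 'a diagram \<Rightarrow> 'a struct set" where
  "diagram_class L rs M T D = {N \<in> expansions L rs M T. satisfies_diagram L rs M D N}"

definition B_T :: "nat sig \<Rightarrow> new_sym list \<Rightarrow> 'a struct \<Rightarrow> 'a fm set \<Rightarrow> 'a diagram set" where
  "B_T L rs M T = {D. wf_diagram L rs M D \<and> diagram_class L rs M T D \<noteq> {}}"

definition cst :: "'a \<Rightarrow> 'a tm" where
  "cst a = Fn (Elem a) []"

definition diagram_sentences ::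
  "nat sig \<Rightarrow> new_sym list \<Rightarrow> 'a struct \<Rightarrow> 'a diagram \<Rightarrow> 'a fm set" where
  "diagram_sentences L rs M D =
     {Eq (Fn (New i) (map cst as)) (cst b) | i as b. (as, b) \<in> dfun D i} \<union>
     {Rel (New i) (map cst as) | i as. as \<in> drel D i} \<union>
     {Neg (Rel (New i) (map cst as)) | i as ss.
        rel_ty (lang L rs M {}) (New i) = Some ss \<and> as \<in> tuples M (set (Dom D)) ss \<and> as \<notin> drel D i}"

text \<open>The theory \<open>D(as) \<union> T \<union> Th(M, as)\<close>, up to logical consequence.\<close>

definition diagram_theory ::
  "nat sig \<Rightarrow> new_sym list \<Rightarrow> ('a :: infinite) struct \<Rightarrow> 'a fm set \<Rightarrow> 'a diagram \<Rightarrow> 'a fm set" where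
  "diagram_theory L rs M T D =
     consequences (lang L rs M (set (Dom D)))
       (diagram_sentences L rs M D \<union> T \<union> Th L M (set (Dom D)))"

text \<open>\<open>D'\<close> is an extension of \<open>D\<close>: its domain is larger and it implies \<open>D\<close> under \<open>T\<close>.  The last
  clause, that the partial functions of \<open>D'\<close> extend those of \<open>D\<close>, is not a consequence of the
  implication: the values of a function may be forced by \<open>T\<close> without being listed in \<open>D'\<close>.\<close>

definition extends ::
  "nat sig \<Rightarrow> new_sym list \<Rightarrow> ('a :: infinite) struct \<Rightarrow> 'a fm set \<Rightarrow> 'a diagram \<Rightarrow> 'a diagram \<Rightarrow> bool" where
  "extends L rs M T D' D \<longleftrightarrow>
     set (Dom D) \<subseteq> set (Dom D') \<and>
     diagram_sentences L rs M D \<subseteq> diagram_theory L rs M T D' \<and>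
     (\<forall>i. dfun D i \<subseteq> dfun D' i)"

definition map_diagram :: "('a \<Rightarrow> 'a) \<Rightarrow> 'a diagram \<Rightarrow> 'a diagram" where
  "map_diagram \<alpha> D = \<lparr>
     Dom = map \<alpha> (Dom D),
     dfun = (\<lambda>i. (\<lambda>(as, b). (map \<alpha> as, \<alpha> b)) ` dfun D i),
     drel = (\<lambda>i. map \<alpha> ` drel D i) \<rparr>"

text \<open>\<open>D'\<close> is an extension of \<open>D\<close> as required by the weak amalgamation property.\<close>

definition weak_amalgamation_base ::
  "nat sig \<Rightarrow> new_sym list \<Rightarrow> ('a :: infinite) struct \<Rightarrow> 'a fm set \<Rightarrow> 'a diagram \<Rightarrow> 'a diagram \<Rightarrow> bool" where
  "weak_amalgamation_base L rs M T D D' \<longleftrightarrow>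
     D' \<in> B_T L rs M T \<and> extends L rs M T D' D \<and>
     (\<forall>D1\<in>B_T L rs M T. \<forall>D2\<in>B_T L rs M T.
        extends L rs M T D1 D' \<and> extends L rs M T D2 D' \<longrightarrow>
        (\<exists>D3\<in>B_T L rs M T. \<exists>\<alpha>. automorphism L M \<alpha> \<and> (\<forall>a\<in>set (Dom D). \<alpha> a = a) \<and>
           extends L rs M T D3 D1 \<and> extends L rs M T D3 (map_diagram \<alpha> D2)))"

section \<open>The theory \<open>\<Xi>\<close>\<close>

text \<open>Closed terms over \<open>L \<union> rs\<close> with constants for the entries of \<open>es\<close> are exactly the terms
  \<open>t(es')\<close> with \<open>es'\<close> a subtuple of \<open>es\<close>.\<close>

definition conditions :: "nat sig \<Rightarrow> new_sym list \<Rightarrow> 'a struct \<Rightarrow> 'a list \<Rightarrow> 'a fm set" where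
  "conditions L rs M es = sentences (lang L rs M (set es)) \<inter>
     ({Rel (New i) ts | i ts. True} \<union> {Neg (Rel (New i) ts) | i ts. True} \<union>
      {Eq t u | t u. True} \<union> {Neg (Eq t u) | t u. True})"

definition Xi :: "nat sig \<Rightarrow> new_sym list \<Rightarrow> 'a struct \<Rightarrow> 'a list \<Rightarrow> 'a struct \<Rightarrow> 'a fm set" where
  "Xi L rs M es N = {p \<in> conditions L rs M es. valid_in (naming N) p}"

text \<open>Element constants are numbered along a fixed enumeration of the countable universe of \<open>M\<close>.
  Only finitely many constants occur at a time, so the choice of the enumeration is irrelevant.\<close>

definition code :: "'a struct \<Rightarrow> 'a fm \<Rightarrow> nat" where
  "code M = fm_code (to_nat_on (univ M))"

definition Xi_undecidable :: "nat sig \<Rightarrow> new_sym list \<Rightarrow> 'a struct \<Rightarrow> 'a list \<Rightarrow> 'a struct \<Rightarrow> bool" where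
  "Xi_undecidable L rs M es N \<longleftrightarrow>
     \<not> decidable_among (code M ` conditions L rs M es) (code M ` Xi L rs M es N)"

end

theory Submission
  imports Defs
begin

text \<open>Suppose that \<open>D'\<close> extends \<open>D\<close> as the weak amalgamation property requires.  Whether an atomic condition
  on the elements of \<open>Dom D\<close> holds in an expansion is settled by the values of finitely many terms, hence
  by a diagram with a finite domain (\<open>restrict_atom\<close>).  If two expansions in \<open>[D']\<close> disagreed on such a
  condition, the two diagrams that settle it would extend \<open>D'\<close>, and an amalgam of them over \<open>Dom D\<close>
  would make the condition both true and false.  So all expansions in \<open>[D']\<close> satisfy the same
  conditions on \<open>Dom D\<close> (\<open>weak_amalgamation_atom\<close>).

  A sentence that holds in all expansions in \<open>[D']\<close> follows from the theory of \<open>D'\<close>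
  (\<open>diagram_theory_iff\<close>).  Therefore each condition or its negation is listed by the algorithm that
  enumerates this theory, and waiting for one of the two decides \<open>\<Xi>\<close> for every expansion in \<open>[D']\<close>
  (\<open>decidable_among_if_enumerable\<close>).  Since \<open>[D']\<close> is a nonempty part of \<open>[D]\<close>, this contradicts
  undecidability.

  \<open>\<omega>\<close>-categoricity is what makes \<open>diagram_theory_iff\<close> true.  A countermodel may be taken countable by the
  downward Loewenheim--Skolem theorem, and then its reduct to \<open>L\<close> is isomorphic to \<open>M\<close>; but the
  isomorphism may move the named elements, and it has to be corrected by an automorphism of \<open>M\<close>
  (\<open>countable_model_isomorphic\<close>).  The automorphism comes from a back-and-forth argument, for which
  \<open>M\<close> must be homogeneous: tuples of the same type can be extended by elements to tuples of the same
  type.  This is shown by finding a homogeneous countable model of \<open>Th(M)\<close>, to which \<open>M\<close> is then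
  isomorphic.  Such a model lies inside an ultrapower of \<open>M\<close>: the ultrapower realises all types over
  finite tuples, and a countable elementary substructure can be chosen closed under the realisations
  that homogeneity asks for.\<close>

section \<open>Coding and countability of formulas\<close>

lemma finite_tm_vars [simp]: "finite (tm_vars t)"
  by (induction t) auto

lemma finite_free_vars [simp]: "finite (free_vars p)"
  by (induction p) auto

text \<open>Element constants are numbered injectively only along a given set, so codes determine terms and
  formulas only within a signature; well-sortedness bounds the constants that occur.\<close>

lemma tm_code_inj:
  assumes "inj_on (name_code \<nu>) (dom (fun_ty \<Sigma>))" and "has_sort \<Sigma> t s"
  shows "has_sort \<Sigma> u s' \<Longrightarrow> tm_code \<nu> t = tm_code \<nu> u \<Longrightarrow> t = u"
  using assms(2)
proof (induction arbitrary: u s')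
  case (1 s n)
  then show ?case by (cases u) (auto simp: prod_encode_eq)
next
  case (2 f ss s ts)
  show ?case
  proof (cases u)
    case (Var s n)
    then show ?thesis using 2 by (auto simp: prod_encode_eq)
  next
    case (Fn g us)
    then obtain ss' where g: "fun_ty \<Sigma> g = Some (ss', s')" "list_all2 (has_sort \<Sigma>) us ss'"
      using 2(3) by (auto elim: has_sort.cases)
    from 2 Fn have c: "name_code \<nu> f = name_code \<nu> g" "map (tm_code \<nu>) ts = map (tm_code \<nu>) us"
      by (auto simp: prod_encode_eq list_encode_eq)
    then have fg: "f = g"
      using assms(1) 2(1) g(1) by (auto simp: inj_on_def dom_def)
    have "ts = us"
    proof (rule nth_equalityI)
      show len: "length ts = length us"
        using c(2) by (metis length_map)
      fix i assume "i < length ts"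
      then show "ts ! i = us ! i"
        using 2(2) c(2) len g(2) unfolding list_all2_conv_all_nth by (metis nth_map)
    qed
    then show ?thesis using fg Fn by simp
  qed
qed

lemma tm_codes_inj:
  assumes "inj_on (name_code \<nu>) (dom (fun_ty \<Sigma>))"
    and "list_all2 (has_sort \<Sigma>) ts ss" "list_all2 (has_sort \<Sigma>) us ss'"
    and "map (tm_code \<nu>) ts = map (tm_code \<nu>) us"
  shows "ts = us"
proof (rule nth_equalityI)
  show len: "length ts = length us"
    using assms(4) by (metis length_map)
  fix i assume "i < length ts"
  then show "ts ! i = us ! i"
    using assms len tm_code_inj unfolding list_all2_conv_all_nth by (metis nth_map)
qed

lemma fm_code_inj:
  assumes "inj_on (name_code \<nu>) (dom (fun_ty \<Sigma>))" and "inj_on (name_code \<nu>) (dom (rel_ty \<Sigma>))"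
  shows "wf_fm \<Sigma> p \<Longrightarrow> wf_fm \<Sigma> q \<Longrightarrow> fm_code \<nu> p = fm_code \<nu> q \<Longrightarrow> p = q"
proof (induction p arbitrary: q)
  case (Eq t u)
  then show ?case
    by (cases q) (auto simp: prod_encode_eq dest: tm_code_inj[OF assms(1)])
next
  case (Rel r ts)
  show ?case
  proof (cases q)
    case (Rel r' ts')
    with \<open>fm_code \<nu> (fm.Rel r ts) = _\<close> have c: "name_code \<nu> r = name_code \<nu> r'"
      "map (tm_code \<nu>) ts = map (tm_code \<nu>) ts'"
      by (auto simp: prod_encode_eq list_encode_eq)
    with Rel Rel.prems show ?thesis
      using assms(2) tm_codes_inj[OF assms(1)] by (auto simp: inj_on_def dom_def)
  qed (use Rel in \<open>auto simp: prod_encode_eq\<close>)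
next
  case Fls
  then show ?case by (cases q) (auto simp: prod_encode_eq)
next
  case (Neg p)
  from Neg.prems show ?case
    by (cases q) (auto simp: prod_encode_eq intro: Neg.IH)
next
  case (Conj p1 p2)
  from Conj.prems show ?case
    by (cases q) (auto simp: prod_encode_eq intro: Conj.IH)
next
  case (Disj p1 p2)
  from Disj.prems show ?case
    by (cases q) (auto simp: prod_encode_eq intro: Disj.IH)
next
  case (All s n p)
  from All.prems show ?case
    by (cases q) (auto simp: prod_encode_eq intro: All.IH)
next
  case (Exi s n p)
  from Exi.prems show ?case
    by (cases q) (auto simp: prod_encode_eq intro: Exi.IH)
qed

lemma name_code_inj:
  assumes "inj_on \<nu> A"
  shows "inj_on (name_code \<nu>) (dom (fun_ty (lang L rs M A)))"
    and "inj_on (name_code \<nu>) (dom (rel_ty (lang L rs M A)))"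
proof -
  have *: "inj_on (name_code \<nu>) (range Old \<union> range New \<union> Elem ` A)"
    by (rule inj_onI) (auto simp: inj_on_eq_iff[OF assms])
  have "dom (fun_ty (lang L rs M A)) \<subseteq> range Old \<union> range New \<union> Elem ` A"
  proof
    fix f assume "f \<in> dom (fun_ty (lang L rs M A))"
    then show "f \<in> range Old \<union> range New \<union> Elem ` A"
      by (cases f) (auto simp: lang_def split: if_splits)
  qed
  then show "inj_on (name_code \<nu>) (dom (fun_ty (lang L rs M A)))"
    by (rule inj_on_subset[OF *])
  have "dom (rel_ty (lang L rs M A)) \<subseteq> range Old \<union> range New \<union> Elem ` A"
  proof
    fix f assume "f \<in> dom (rel_ty (lang L rs M A))"
    then show "f \<in> range Old \<union> range New \<union> Elem ` A"
      by (cases f) (auto simp: lang_def split: if_splits)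
  qed
  then show "inj_on (name_code \<nu>) (dom (rel_ty (lang L rs M A)))"
    by (rule inj_on_subset[OF *])
qed

text \<open>Apart from making the codes of the theory unambiguous, injectivity yields that there are only
  countably many formulas over \<open>L \<union> rs\<close> with constants from a countable set.\<close>

lemma code_inj:
  assumes "countable A"
  shows "inj_on (fm_code (to_nat_on A)) {p. wf_fm (lang L rs M A) p}"
  using fm_code_inj[OF name_code_inj(1,2)] inj_on_to_nat_on[OF assms]
  by (blast intro!: inj_onI)

lemma countable_wf_fm: "countable A \<Longrightarrow> countable {p. wf_fm (lang L rs M A) p}"
  using code_inj countable_def by blast

lemma countable_dom_fun_ty: "countable A \<Longrightarrow> countable (dom (fun_ty (lang L rs M A)))"
  using name_code_inj(1) inj_on_to_nat_on unfolding countable_def by blast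

definition sublang :: "'a name sig \<Rightarrow> 'a name sig \<Rightarrow> bool" where
  "sublang \<Sigma> \<Sigma>' \<longleftrightarrow> sorts \<Sigma> \<subseteq> sorts \<Sigma>' \<and> fun_ty \<Sigma> \<subseteq>\<^sub>m fun_ty \<Sigma>' \<and> rel_ty \<Sigma> \<subseteq>\<^sub>m rel_ty \<Sigma>'"

lemma has_sort_mono:
  assumes "sublang \<Sigma> \<Sigma>'" and "has_sort \<Sigma> t s"
  shows "has_sort \<Sigma>' t s"
  using assms(2)
proof induction
  case (1 s n)
  then show ?case using assms(1) by (auto simp: sublang_def intro: has_sort.intros)
next
  case (2 f ss s ts)
  then have "fun_ty \<Sigma>' f = Some (ss, s)"
    using assms(1) by (auto simp: sublang_def map_le_def dom_def)
  then show ?case using 2(2) by (auto intro!: has_sort.intros elim: list_all2_mono)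
qed

lemma wf_fm_mono: "sublang \<Sigma> \<Sigma>' \<Longrightarrow> wf_fm \<Sigma> p \<Longrightarrow> wf_fm \<Sigma>' p"
proof (induction p)
  case (Rel r ts)
  then show ?case
    by (force simp: sublang_def map_le_def dom_def has_sort_mono elim: list_all2_mono)
next
  case (Eq t u)
  then show ?case using has_sort_mono by (metis wf_fm.simps(2))
qed (auto simp: sublang_def)

lemma sentences_mono: "sublang \<Sigma> \<Sigma>' \<Longrightarrow> sentences \<Sigma> \<subseteq> sentences \<Sigma>'"
  by (auto simp: sentences_def intro: wf_fm_mono)

lemma sublang_old: "A \<subseteq> B \<Longrightarrow> sublang (lang L [] M A) (lang L rs M B)"
  by (auto simp: sublang_def lang_def map_le_def split: name.splits)

lemma sublang_elem: "A \<subseteq> B \<Longrightarrow> sublang (lang L rs M A) (lang L rs M B)"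
  by (auto simp: sublang_def lang_def map_le_def split: name.splits)

section \<open>Structures up to a congruence\<close>

text \<open>Structures whose elements have a type of their own and in which equality is interpreted by a
  relation.  An ultrapower is of this kind: its elements are sequences, and a quotient is taken only
  after passing to a countable part, because the type \<open>'a\<close> need not have room for all of it.\<close>

record ('a, 'b) prestruct =
  puniv :: "'b set"
  psort :: "'b \<Rightarrow> nat"
  pfun :: "'a name \<Rightarrow> 'b list \<Rightarrow> 'b"
  prel :: "'a name \<Rightarrow> 'b list \<Rightarrow> bool"
  peq :: "'b \<Rightarrow> 'b \<Rightarrow> bool"

fun ptm_val :: "('a, 'b) prestruct \<Rightarrow> (nat \<times> nat \<Rightarrow> 'b) \<Rightarrow> 'a tm \<Rightarrow> 'b" where
  "ptm_val P v (Var s n) = v (s, n)"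
| "ptm_val P v (Fn f ts) = pfun P f (map (ptm_val P v) ts)"

primrec psat :: "('a, 'b) prestruct \<Rightarrow> (nat \<times> nat \<Rightarrow> 'b) \<Rightarrow> 'a fm \<Rightarrow> bool" where
  "psat P v Fls \<longleftrightarrow> False"
| "psat P v (Eq t u) \<longleftrightarrow> peq P (ptm_val P v t) (ptm_val P v u)"
| "psat P v (Rel r ts) \<longleftrightarrow> prel P r (map (ptm_val P v) ts)"
| "psat P v (Neg p) \<longleftrightarrow> \<not> psat P v p"
| "psat P v (Conj p q) \<longleftrightarrow> psat P v p \<and> psat P v q"
| "psat P v (Disj p q) \<longleftrightarrow> psat P v p \<or> psat P v q"
| "psat P v (All s n p) \<longleftrightarrow> (\<forall>b\<in>puniv P. psort P b = s \<longrightarrow> psat P (v((s, n) := b)) p)"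
| "psat P v (Exi s n p) \<longleftrightarrow> (\<exists>b\<in>puniv P. psort P b = s \<and> psat P (v((s, n) := b)) p)"

definition pre_of :: "'a struct \<Rightarrow> ('a, 'a) prestruct" where
  "pre_of N = \<lparr>puniv = univ N, psort = sort_of N, pfun = fun_int N, prel = rel_int N, peq = (=)\<rparr>"

lemma ptm_val_pre_of: "ptm_val (pre_of N) v t = tm_val N v t"
  by (induction t) (auto simp: pre_of_def cong: map_cong)

lemma psat_pre_of: "psat (pre_of N) v p = sat N v p"
  by (induction p arbitrary: v) (simp_all add: ptm_val_pre_of, simp_all add: pre_of_def ptm_val_pre_of[unfolded pre_of_def] cong: map_cong)

lemma ptm_val_cong: "(\<And>x. x \<in> tm_vars t \<Longrightarrow> v x = w x) \<Longrightarrow> ptm_val P v t = ptm_val P w t"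
proof (induction t)
  case (Fn f ts)
  then have "map (ptm_val P v) ts = map (ptm_val P w) ts" by auto
  then show ?case by (simp only: ptm_val.simps)
qed auto

lemma psat_cong: "(\<And>x. x \<in> free_vars p \<Longrightarrow> v x = w x) \<Longrightarrow> psat P v p = psat P w p"
proof (induction p arbitrary: v w)
  case (Eq t u)
  then show ?case using ptm_val_cong[of t v w P] ptm_val_cong[of u v w P] by auto
next
  case (Rel r ts)
  then have "map (ptm_val P v) ts = map (ptm_val P w) ts" by (auto intro!: ptm_val_cong)
  then show ?case by (simp only: psat.simps)
next
  case (Conj p1 p2)
  show ?case using Conj.IH(1)[of v w] Conj.IH(2)[of v w] Conj.prems by auto
next
  case (Disj p1 p2)
  show ?case using Disj.IH(1)[of v w] Disj.IH(2)[of v w] Disj.prems by auto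
next
  case (Neg p)
  show ?case using Neg.IH[of v w] Neg.prems by auto
next
  case (All s n p)
  have "psat P (v((s, n) := b)) p = psat P (w((s, n) := b)) p" for b
    using All.prems by (intro All.IH) auto
  then show ?case by simp
next
  case (Exi s n p)
  have "psat P (v((s, n) := b)) p = psat P (w((s, n) := b)) p" for b
    using Exi.prems by (intro Exi.IH) auto
  then show ?case by simp
qed auto

lemmas sat_cong = psat_cong[of _ _ _ "pre_of N" for N, unfolded psat_pre_of]

lemma valid_in_iff: "free_vars p = {} \<Longrightarrow> valid_in N p \<longleftrightarrow> sat N v p"
  unfolding valid_in_def using sat_cong[of p] by auto

definition prestructure :: "'a name sig \<Rightarrow> ('a, 'b) prestruct \<Rightarrow> bool" where
  "prestructure \<Sigma> P \<longleftrightarrow>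
     (\<forall>b\<in>puniv P. psort P b \<in> sorts \<Sigma>) \<and>
     (\<forall>f ss s bs. fun_ty \<Sigma> f = Some (ss, s) \<and> set bs \<subseteq> puniv P \<and> map (psort P) bs = ss \<longrightarrow>
        pfun P f bs \<in> puniv P \<and> psort P (pfun P f bs) = s) \<and>
     equivp (peq P) \<and>
     (\<forall>b\<in>puniv P. \<forall>c\<in>puniv P. peq P b c \<longrightarrow> psort P b = psort P c) \<and>
     (\<forall>f bs cs. list_all2 (peq P) bs cs \<longrightarrow> peq P (pfun P f bs) (pfun P f cs)) \<and>
     (\<forall>r bs cs. list_all2 (peq P) bs cs \<longrightarrow> prel P r bs = prel P r cs)"

lemma prestructure_fun:
  assumes "prestructure \<Sigma> P" "fun_ty \<Sigma> f = Some (map (psort P) bs, s)" "set bs \<subseteq> puniv P"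
  shows "pfun P f bs \<in> puniv P" "psort P (pfun P f bs) = s"
  using assms by (auto simp: prestructure_def)

lemma prestructure_cong:
  assumes "prestructure \<Sigma> P"
  shows "peq P b c \<Longrightarrow> b \<in> puniv P \<Longrightarrow> c \<in> puniv P \<Longrightarrow> psort P b = psort P c"
    and "list_all2 (peq P) bs cs \<Longrightarrow> peq P (pfun P f bs) (pfun P f cs)"
    and "list_all2 (peq P) bs cs \<Longrightarrow> prel P r bs = prel P r cs"
  using assms by (auto simp: prestructure_def)

lemma prestructure_pre_of: "is_struct \<Sigma> N \<Longrightarrow> prestructure \<Sigma> (pre_of N)"
  by (auto simp: prestructure_def pre_of_def is_struct_def tuples_def list_all2_eq[symmetric] identity_equivp)

lemma set_map_image:
  assumes "set as \<subseteq> e ` C"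
  obtains bs where "as = map e bs" "set bs \<subseteq> C"
proof
  show "as = map e (map (inv_into C e) as)"
    using assms by (induction as) (auto simp: f_inv_into_f)
  show "set (map (inv_into C e) as) \<subseteq> C"
    using assms by (auto intro: inv_into_into)
qed

lemma list_all2_mapD:
  assumes "list_all2 (\<lambda>t s. f t \<in> C \<and> g (f t) = s \<and> h t = e (f t)) ts ss"
  shows "set (map f ts) \<subseteq> C" "map g (map f ts) = ss" "map h ts = map e (map f ts)"
  using assms by (induction rule: list_all2_induct) auto

text \<open>Closing under one chosen witness for each of countably many requirements: every stage adds countably
  many elements, since a countable set has countably many finite lists.  The requirements are arbitrary
  relations, so that beside Skolem functions they can express homogeneity.\<close>

lemma skolem_hull:
  fixes Qs :: "('b list \<Rightarrow> 'b \<Rightarrow> bool) set"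
  assumes "countable Qs"
  shows "\<exists>C. countable C \<and> C \<subseteq> B \<and>
    (\<forall>Q\<in>Qs. \<forall>xs\<in>lists C. (\<exists>b\<in>B. Q xs b) \<longrightarrow> (\<exists>c\<in>C. Q xs c))"
proof -
  define w :: "('b list \<Rightarrow> 'b \<Rightarrow> bool) \<Rightarrow> 'b list \<Rightarrow> 'b" where "w = (\<lambda>Q xs. SOME b. b \<in> B \<and> Q xs b)"
  define S where "S = (\<lambda>C. C \<union> {w Q xs | Q xs. Q \<in> Qs \<and> xs \<in> lists C \<and> (\<exists>b\<in>B. Q xs b)})"
  define Cn where "Cn = (\<lambda>n. (S ^^ n) {})"
  have Cn_Suc: "Cn (Suc n) = S (Cn n)" for n by (simp add: Cn_def)
  have w: "w Q xs \<in> B \<and> Q xs (w Q xs)" if "b \<in> B" "Q xs b" for Q xs b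
    unfolding w_def by (rule someI[of _ b]) (use that in auto)
  have cnt: "countable (Cn n)" for n
  proof (induction n)
    case (Suc n)
    have "countable ((\<lambda>(Q, xs). w Q xs) ` (Qs \<times> lists (Cn n)))"
      using assms Suc by (intro countable_image countable_SIGMA countable_lists)
    then have "countable {w Q xs | Q xs. Q \<in> Qs \<and> xs \<in> lists (Cn n) \<and> (\<exists>b\<in>B. Q xs b)}"
      by (rule countable_subset[rotated]) auto
    then show ?case using Suc by (simp add: Cn_Suc S_def)
  qed (simp add: Cn_def)
  have sub: "Cn n \<subseteq> B" for n
  proof (induction n)
    case (Suc n)
    then show ?case using w by (auto simp: Cn_Suc S_def)
  qed (simp add: Cn_def)
  have mono: "m \<le> n \<Longrightarrow> Cn m \<subseteq> Cn n" for m n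
    by (rule lift_Suc_mono_le[of Cn]) (auto simp: Cn_Suc S_def)
  have closed: "\<exists>c\<in>(\<Union>n. Cn n). Q xs c" if Q: "Q \<in> Qs" "xs \<in> lists (\<Union>n. Cn n)" "b \<in> B" "Q xs b" for Q xs b
  proof -
    have "\<exists>n. xs \<in> lists (Cn n)"
      using Q(2)
    proof (induction xs)
      case (Cons x xs)
      then obtain m n where "x \<in> Cn m" "xs \<in> lists (Cn n)" by auto
      then have "x \<in> Cn (max m n)" "set xs \<subseteq> Cn (max m n)"
        using mono[of m "max m n"] mono[of n "max m n"] by auto
      then show ?case by (intro exI[of _ "max m n"]) auto
    qed simp
    then obtain n where "xs \<in> lists (Cn n)" ..
    then have "w Q xs \<in> Cn (Suc n)" unfolding Cn_Suc S_def using Q by blast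
    then show ?thesis using w Q by blast
  qed
  show ?thesis
  proof (intro exI[of _ "\<Union>n. Cn n"] conjI ballI impI)
    show "countable (\<Union>n. Cn n)" using cnt by blast
    show "(\<Union>n. Cn n) \<subseteq> B" using sub by blast
  qed (elim bexE, rule closed)
qed

definition assigns :: "('a, 'b) prestruct \<Rightarrow> (nat \<times> nat) set \<Rightarrow> (nat \<times> nat \<Rightarrow> 'b) \<Rightarrow> bool" where
  "assigns P V v \<longleftrightarrow> (\<forall>x\<in>V. v x \<in> puniv P \<and> psort P (v x) = fst x)"

text \<open>Finitely many values of a valuation as a list, the form in which \<open>skolem_hull\<close> takes parameters.\<close>

definition val_of :: "(nat \<times> nat) list \<Rightarrow> 'b list \<Rightarrow> nat \<times> nat \<Rightarrow> 'b" where
  "val_of vs bs x = the (map_of (zip vs bs) x)"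

lemma val_of_map [simp]: "x \<in> set vs \<Longrightarrow> val_of vs (map v vs) x = v x"
  by (simp add: val_of_def map_of_zip_map)

text \<open>The hull \<open>C\<close> is closed under the functions and passes the Tarski--Vaught test, so truth in it agrees
  with truth in \<open>P\<close>.  Its quotient by the congruence is countable, and hence fits into the infinite type
  \<open>'a\<close>; the map \<open>e\<close> is the quotient map followed by an injection.  The relations \<open>Qs\<close> are requirements
  of the caller for which \<open>C\<close> has to contain witnesses as well.\<close>

lemma downward_loewenheim_skolem:
  fixes P :: "('a :: infinite, 'b) prestruct" and Qs :: "('b list \<Rightarrow> 'b \<Rightarrow> bool) set"
  assumes P: "prestructure \<Sigma> P" and wf: "countable {p. wf_fm \<Sigma> p}" and fs: "countable (dom (fun_ty \<Sigma>))"
    and Qs: "countable Qs"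
  shows "\<exists>C (e :: 'b \<Rightarrow> 'a) N. countable C \<and> C \<subseteq> puniv P \<and>
    (\<forall>Q\<in>Qs. \<forall>bs\<in>lists C. (\<exists>b\<in>puniv P. Q bs b) \<longrightarrow> (\<exists>c\<in>C. Q bs c)) \<and>
    is_struct \<Sigma> N \<and> univ N = e ` C \<and> (\<forall>b\<in>C. sort_of N (e b) = psort P b) \<and>
    (\<forall>p v. wf_fm \<Sigma> p \<and> (\<forall>x\<in>free_vars p. v x \<in> C \<and> psort P (v x) = fst x) \<longrightarrow>
       sat N (\<lambda>y. e (v y)) p = psat P v p)"
proof -
  define Q1 where "Q1 = (\<lambda>f bs c. c = pfun P f bs) ` dom (fun_ty \<Sigma>)"
  define Q2 where "Q2 = (\<lambda>(x, vs, p) bs c. psort P c = fst x \<and> psat P ((val_of vs bs)(x := c)) p) `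
    ((UNIV :: (nat \<times> nat) set) \<times> (UNIV :: (nat \<times> nat) list set) \<times> {p. wf_fm \<Sigma> p})"
  have "countable (Qs \<union> Q1 \<union> Q2)"
    unfolding Q1_def Q2_def using assms by auto
  then obtain C where C: "countable C" "C \<subseteq> puniv P" and hull0: "\<forall>Q\<in>Qs \<union> Q1 \<union> Q2. \<forall>xs\<in>lists C.
      (\<exists>b\<in>puniv P. Q xs b) \<longrightarrow> (\<exists>c\<in>C. Q xs c)"
    using skolem_hull[of "Qs \<union> Q1 \<union> Q2" "puniv P"] by blast
  have hull: "\<exists>c\<in>C. Q xs c"
    if "Q \<in> Qs \<union> Q1 \<union> Q2" "xs \<in> lists C" "b \<in> puniv P" "Q xs b" for Q xs b
    using bspec[OF bspec[OF hull0 that(1)] that(2)] that(3,4) by blast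
  have funC: "pfun P f bs \<in> C" "psort P (pfun P f bs) = s"
    if "fun_ty \<Sigma> f = Some (map (psort P) bs, s)" "set bs \<subseteq> C" for f bs s
  proof -
    have *: "pfun P f bs \<in> puniv P" "psort P (pfun P f bs) = s"
      using prestructure_fun[OF P that(1)] that(2) C(2) by auto
    then show "psort P (pfun P f bs) = s" by simp
    show "pfun P f bs \<in> C"
      using hull[of "\<lambda>bs c. c = pfun P f bs" bs "pfun P f bs"] that * by (auto simp: Q1_def)
  qed
  \<comment> \<open>the Tarski--Vaught test\<close>
  have tv: "\<exists>c\<in>C. psort P c = s \<and> psat P (v((s, n) := c)) p"
    if "wf_fm \<Sigma> p" "\<forall>x\<in>free_vars p - {(s, n)}. v x \<in> C" "psat P v (Exi s n p)" for s n p v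
  proof -
    obtain vs where vs: "set vs = free_vars p - {(s, n)}"
      using finite_list[of "free_vars p - {(s, n)}"] by auto
    have eq: "psat P ((val_of vs (map v vs))((s, n) := c)) p = psat P (v((s, n) := c)) p" for c
      by (rule psat_cong) (use vs in auto)
    from that(3) obtain b where b: "b \<in> puniv P" "psort P b = s" "psat P (v((s, n) := b)) p" by auto
    have "\<exists>c\<in>C. psort P c = fst (s, n) \<and> psat P ((val_of vs (map v vs))((s, n) := c)) p"
      by (rule hull[of "\<lambda>bs c. psort P c = fst (s, n) \<and> psat P ((val_of vs bs)((s, n) := c)) p" _ b])
        (use that b vs in \<open>auto simp: eq Q2_def intro!: image_eqI[of _ _ "((s, n), vs, p)"]\<close>)
    then show ?thesis unfolding eq by simp
  qed
  have eqv: "equivp (peq P)" using P by (simp add: prestructure_def)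
  obtain \<iota> :: "nat \<Rightarrow> 'a" where \<iota>: "inj \<iota>"
    using infinite_countable_subset[OF infinite_UNIV] by auto
  \<comment> \<open>\<open>q\<close> depends only on the congruence class, so it selects representatives\<close>
  define q where "q = (\<lambda>b. SOME c. c \<in> C \<and> peq P b c)"
  have q: "q b \<in> C \<and> peq P b (q b)" if "b \<in> C" for b
    unfolding q_def by (rule someI[of _ b]) (use that eqv equivp_reflp in auto)
  have qeq: "q b = q c \<longleftrightarrow> peq P b c" if "b \<in> C" "c \<in> C" for b c
  proof
    show "peq P b c" if "q b = q c"
      using q \<open>b \<in> C\<close> \<open>c \<in> C\<close> that by (metis eqv equivp_symp equivp_transp)
    assume "peq P b c"
    then have "peq P b = peq P c" using eqv by (simp add: equivp_def)
    then show "q b = q c" by (simp add: q_def)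
  qed
  define e where "e = \<iota> \<circ> to_nat_on C \<circ> q"
  have eeq: "e b = e c \<longleftrightarrow> peq P b c" if "b \<in> C" "c \<in> C" for b c
    using inj_on_to_nat_on[OF C(1)] \<iota> q that qeq unfolding e_def
    by (auto simp: inj_eq inj_on_eq_iff)
  \<comment> \<open>\<open>r\<close> returns to a representative, by which the interpretations in the quotient are computed\<close>
  define r where "r = (\<lambda>a. SOME b. b \<in> C \<and> e b = a)"
  have r: "r (e b) \<in> C \<and> peq P (r (e b)) b" if "b \<in> C" for b
  proof -
    have "r (e b) \<in> C \<and> e (r (e b)) = e b"
      unfolding r_def by (rule someI[of _ b]) (use that in auto)
    then show ?thesis using eeq that by auto
  qed
  have rs: "psort P (r (e b)) = psort P b" if "b \<in> C" for b
    using r[OF that] prestructure_cong(1)[OF P] C that by blast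
  define N :: "'a struct" where "N = \<lparr>univ = e ` C, sort_of = psort P \<circ> r,
    fun_int = (\<lambda>f as. e (pfun P f (map r as))), rel_int = (\<lambda>R as. prel P R (map r as))\<rparr>"
  have rlist: "list_all2 (peq P) (map r (map e bs)) bs" if "set bs \<subseteq> C" for bs
    using that by (induction bs) (auto simp: r)
  have fe: "fun_int N f (map e bs) = e (pfun P f bs)"
    if "fun_ty \<Sigma> f = Some (map (psort P) bs, s)" "set bs \<subseteq> C" for f bs s
  proof -
    have "peq P (pfun P f (map r (map e bs))) (pfun P f bs)"
      by (rule prestructure_cong(2)[OF P rlist[OF that(2)]])
    moreover have "pfun P f (map r (map e bs)) \<in> C"
    proof (rule funC(1))
      have "map (psort P) (map r (map e bs)) = map (psort P) bs"
        using that(2) rs by auto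
      then show "fun_ty \<Sigma> f = Some (map (psort P) (map r (map e bs)), s)" using that by simp
      show "set (map r (map e bs)) \<subseteq> C" using r that(2) by auto
    qed
    ultimately show ?thesis using eeq funC[OF that] by (simp add: N_def)
  qed
  have str: "is_struct \<Sigma> N"
    unfolding is_struct_def
  proof (intro conjI allI impI ballI)
    fix a assume "a \<in> univ N"
    then show "sort_of N a \<in> sorts \<Sigma>" using r C P by (auto simp: N_def prestructure_def)
  next
    fix f ss s as assume f: "fun_ty \<Sigma> f = Some (ss, s)" and as: "as \<in> tuples N (univ N) ss"
    then have "set as \<subseteq> e ` C" by (simp add: tuples_def N_def)
    then obtain bs where bs: "as = map e bs" "set bs \<subseteq> C" by (rule set_map_image)
    have "map (psort P) bs = ss" using as bs(1) rs subsetD[OF bs(2)] by (auto simp: tuples_def N_def)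
    then have *: "fun_int N f as = e (pfun P f bs)" "pfun P f bs \<in> C" "psort P (pfun P f bs) = s"
      using fe funC bs f by auto
    then show "fun_int N f as \<in> univ N" "sort_of N (fun_int N f as) = s"
      using rs by (auto simp: N_def)
  qed
  have sortN: "sort_of N (e b) = psort P b" if "b \<in> C" for b
    using rs[OF that] by (simp add: N_def)
  have tm: "ptm_val P v t \<in> C \<and> psort P (ptm_val P v t) = s \<and> tm_val N (\<lambda>y. e (v y)) t = e (ptm_val P v t)"
    if "has_sort \<Sigma> t s" "\<forall>x\<in>tm_vars t. v x \<in> C \<and> psort P (v x) = fst x" for v t s
    using that
  proof induction
    case (1 s n)
    then show ?case by auto
  next
    case (2 f ss s ts)
    from 2(2) have *: "list_all2 (\<lambda>t s. ptm_val P v t \<in> C \<and> psort P (ptm_val P v t) = s \<and>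
        tm_val N (\<lambda>y. e (v y)) t = e (ptm_val P v t)) ts ss"
    proof (rule list.rel_mono_strong)
      fix t s assume "t \<in> set ts"
      then have "\<forall>x\<in>tm_vars t. v x \<in> C \<and> psort P (v x) = fst x" using 2(3) by auto
      then show "has_sort \<Sigma> t s \<and> ((\<forall>x\<in>tm_vars t. v x \<in> C \<and> psort P (v x) = fst x) \<longrightarrow>
          ptm_val P v t \<in> C \<and> psort P (ptm_val P v t) = s \<and> tm_val N (\<lambda>y. e (v y)) t = e (ptm_val P v t)) \<Longrightarrow>
        ptm_val P v t \<in> C \<and> psort P (ptm_val P v t) = s \<and> tm_val N (\<lambda>y. e (v y)) t = e (ptm_val P v t)"
        by blast
    qed
    show ?case
      using 2(1) list_all2_mapD[OF *] fe[of f "map (ptm_val P v) ts" s] funC[of f "map (ptm_val P v) ts" s]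
      by (simp del: map_map)
  qed
  have tms: "set (map (ptm_val P v) ts) \<subseteq> C" "map (tm_val N (\<lambda>y. e (v y))) ts = map e (map (ptm_val P v) ts)"
    if "list_all2 (has_sort \<Sigma>) ts ss" "\<forall>x\<in>(\<Union>t\<in>set ts. tm_vars t). v x \<in> C \<and> psort P (v x) = fst x" for v ts ss
  proof -
    from that(1) have *: "list_all2 (\<lambda>t s. ptm_val P v t \<in> C \<and> psort P (ptm_val P v t) = s \<and>
        tm_val N (\<lambda>y. e (v y)) t = e (ptm_val P v t)) ts ss"
      by (rule list.rel_mono_strong) (rule tm, use that(2) in auto)
    show "set (map (ptm_val P v) ts) \<subseteq> C" "map (tm_val N (\<lambda>y. e (v y))) ts = map e (map (ptm_val P v) ts)"
      by (rule list_all2_mapD[OF *])+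
  qed
  have upd: "(\<lambda>y. e (v y))(x := e b) = (\<lambda>y. e ((v(x := b)) y))" for v x b by auto
  have sat_eq: "sat N (\<lambda>y. e (v y)) p = psat P v p"
    if "wf_fm \<Sigma> p" "\<forall>x\<in>free_vars p. v x \<in> C \<and> psort P (v x) = fst x" for p v
    using that
  proof (induction p arbitrary: v)
    case (Eq t u)
    then obtain s where "has_sort \<Sigma> t s" "has_sort \<Sigma> u s" by auto
    then have "ptm_val P v t \<in> C" "tm_val N (\<lambda>y. e (v y)) t = e (ptm_val P v t)"
      "ptm_val P v u \<in> C" "tm_val N (\<lambda>y. e (v y)) u = e (ptm_val P v u)"
      using tm[of t s v] tm[of u s v] Eq(2) by auto
    then show ?case by (simp add: eeq)
  next
    case (Rel R ts)
    then obtain ss where "list_all2 (has_sort \<Sigma>) ts ss" by auto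
    then have *: "set (map (ptm_val P v) ts) \<subseteq> C" "map (tm_val N (\<lambda>y. e (v y))) ts = map e (map (ptm_val P v) ts)"
      using tms[of ts ss v] Rel by auto
    have "prel P R (map r (map e (map (ptm_val P v) ts))) = prel P R (map (ptm_val P v) ts)"
      by (rule prestructure_cong(3)[OF P rlist[OF *(1)]])
    then show ?case using * by (simp add: N_def del: map_map)
  next
    case (All s n p)
    have IH: "sat N (\<lambda>y. e ((v((s, n) := b)) y)) p = psat P (v((s, n) := b)) p" if "b \<in> C" "psort P b = s" for b
      using All that by (intro All.IH) auto
    \<comment> \<open>the Tarski--Vaught test provides witnesses against a universal formula, too\<close>
    have "psat P v (All s n p) \<longleftrightarrow> \<not> psat P v (Exi s n (Neg p))" by simp
    also have "\<dots> \<longleftrightarrow> \<not> (\<exists>b\<in>C. psort P b = s \<and> psat P (v((s, n) := b)) (Neg p))"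
      using tv[of "Neg p" s n v] All C by auto
    also have "\<dots> \<longleftrightarrow> sat N (\<lambda>y. e (v y)) (All s n p)"
      using IH sortN by (auto simp: N_def upd)
    finally show ?case by simp
  next
    case (Exi s n p)
    have IH: "sat N (\<lambda>y. e ((v((s, n) := b)) y)) p = psat P (v((s, n) := b)) p" if "b \<in> C" "psort P b = s" for b
      using Exi that by (intro Exi.IH) auto
    have "psat P v (Exi s n p) \<longleftrightarrow> (\<exists>b\<in>C. psort P b = s \<and> psat P (v((s, n) := b)) p)"
      using tv[of p s n v] Exi C by auto
    also have "\<dots> \<longleftrightarrow> sat N (\<lambda>y. e (v y)) (Exi s n p)"
      using IH sortN by (auto simp: N_def upd)
    finally show ?case by simp
  qed auto
  show ?thesis
  proof (intro exI[of _ C] exI[of _ e] exI[of _ N] conjI)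
    show "univ N = e ` C" by (simp add: N_def)
    show "\<forall>Q\<in>Qs. \<forall>bs\<in>lists C. (\<exists>b\<in>puniv P. Q bs b) \<longrightarrow> (\<exists>c\<in>C. Q bs c)"
      using hull0 by blast
  qed (use C str sortN sat_eq in blast)+
qed

section \<open>Homogeneity and ultrapowers\<close>

lemma psat_foldr_Conj: "psat P v (foldr Conj ps q) \<longleftrightarrow> (\<forall>p\<in>set ps. psat P v p) \<and> psat P v q"
  by (induction ps) auto

lemmas sat_foldr_Conj = psat_foldr_Conj[of "pre_of N" for N, unfolded psat_pre_of]

lemma wf_foldr_Conj: "wf_fm \<Sigma> (foldr Conj ps q) \<longleftrightarrow> (\<forall>p\<in>set ps. wf_fm \<Sigma> p) \<and> wf_fm \<Sigma> q"
  by (induction ps) auto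

lemma free_vars_foldr_Conj: "free_vars (foldr Conj ps q) = (\<Union>p\<in>set ps. free_vars p) \<union> free_vars q"
  by (induction ps) auto

text \<open>Finite tuples are given as the values of a valuation on a finite set \<open>V\<close> of variables, so that
  formulas apply to them without substitution.\<close>

definition same_type where
  "same_type \<Sigma> P V v w \<longleftrightarrow> (\<forall>p. wf_fm \<Sigma> p \<and> free_vars p \<subseteq> V \<longrightarrow> psat P v p = psat P w p)"

definition homogeneous :: "'a name sig \<Rightarrow> ('a, 'b) prestruct \<Rightarrow> bool" where
  "homogeneous \<Sigma> P \<longleftrightarrow> (\<forall>V v w x. \<forall>a\<in>puniv P.
     finite V \<and> assigns P V v \<and> assigns P V w \<and> same_type \<Sigma> P V v w \<and> x \<notin> V \<and> psort P a = fst x \<longrightarrow>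
     (\<exists>b\<in>puniv P. psort P b = fst x \<and> same_type \<Sigma> P (insert x V) (v(x := a)) (w(x := b))))"

lemma homogeneousD:
  assumes "homogeneous \<Sigma> P" "finite V" "assigns P V v" "assigns P V w" "same_type \<Sigma> P V v w"
    "x \<notin> V" "a \<in> puniv P" "psort P a = fst x"
  obtains b where "b \<in> puniv P" "psort P b = fst x" "same_type \<Sigma> P (insert x V) (v(x := a)) (w(x := b))"
  using assms unfolding homogeneous_def by blast

text \<open>An ultrafilter is free iff its members are infinite; this also makes it a proper filter.\<close>

definition free_ultrafilter :: "nat set set \<Rightarrow> bool" where
  "free_ultrafilter U \<longleftrightarrow> (\<forall>X. X \<in> U \<longleftrightarrow> - X \<notin> U) \<and> (\<forall>X\<in>U. \<forall>Y\<in>U. X \<inter> Y \<in> U) \<and>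
     (\<forall>X\<in>U. \<forall>Y. X \<subseteq> Y \<longrightarrow> Y \<in> U) \<and> (\<forall>X\<in>U. infinite X)"

text \<open>A maximal family of sets all of whose finite intersections are infinite.  If neither \<open>X\<close> nor \<open>- X\<close>
  could be added, then finite intersections of members would meet \<open>X\<close> and \<open>- X\<close>, respectively, in
  finite sets, and the intersection of the two would be finite.\<close>

lemma free_ultrafilter_exists: "\<exists>U. free_ultrafilter U"
proof -
  define A where "A = {U :: nat set set. \<forall>F\<subseteq>U. finite F \<longrightarrow> infinite (\<Inter>F)}"
  have "\<exists>M\<in>A. \<forall>X\<in>A. M \<subseteq> X \<longrightarrow> X = M"
  proof (rule subset_Zorn_nonempty)
    have "{} \<in> A" by (auto simp: A_def infinite_UNIV_nat)
    then show "A \<noteq> {}" by blast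
    fix C assume C: "C \<noteq> {}" "subset.chain A C"
    show "\<Union>C \<in> A"
      unfolding A_def
    proof (intro CollectI allI impI)
      fix F assume F: "F \<subseteq> \<Union>C" "finite F"
      then obtain B where "B \<in> C" "F \<subseteq> B"
        using C finite_subset_Union_chain[of F C] unfolding subset.chain_def subset_chain_def
        by (metis F(1) F(2) subset.chain_def)
      then show "infinite (\<Inter>F)"
        using C F by (auto simp: A_def subset.chain_def)
    qed
  qed
  then obtain U where U: "U \<in> A" and max: "\<And>X. X \<in> A \<Longrightarrow> U \<subseteq> X \<Longrightarrow> X = U" by blast
  have inf: "infinite X" if "X \<in> U" for X
    using U that by (auto simp: A_def dest: spec[of _ "{X}"])
  have fin: "\<exists>F\<subseteq>U. finite F \<and> finite (\<Inter>F \<inter> X)" if "X \<notin> U" for X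
  proof -
    have "insert X U \<notin> A" using max that by blast
    then obtain F where F: "F \<subseteq> insert X U" "finite F" "finite (\<Inter>F)" by (auto simp: A_def)
    have "\<Inter>(F - {X}) \<inter> X \<subseteq> \<Inter>F" by auto
    then show ?thesis using F by (intro exI[of _ "F - {X}"]) (auto intro: finite_subset)
  qed
  have compl: "X \<in> U \<or> - X \<in> U" for X
  proof (rule ccontr)
    assume "\<not> (X \<in> U \<or> - X \<in> U)"
    then obtain F G where FG: "F \<subseteq> U" "finite F" "finite (\<Inter>F \<inter> X)" "G \<subseteq> U" "finite G" "finite (\<Inter>G \<inter> - X)"
      using fin by meson
    have "finite (\<Inter>(F \<union> G))"
      by (rule finite_subset[OF _ finite_UnI[OF FG(3,6)]]) auto
    then show False using FG U by (auto simp: A_def)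
  qed
  have meet: "infinite (X \<inter> Y)" "infinite (X \<inter> Y \<inter> Z)" if "X \<in> U" "Y \<in> U" "Z \<in> U" for X Y Z
  proof -
    have "infinite (\<Inter>F)" if "F \<subseteq> U" "finite F" for F using U that by (auto simp: A_def)
    from this[of "{X, Y}"] this[of "{X, Y, Z}"] that
    show "infinite (X \<inter> Y)" "infinite (X \<inter> Y \<inter> Z)" by (auto simp: Int_assoc)
  qed
  have "free_ultrafilter U"
    unfolding free_ultrafilter_def
  proof (intro conjI allI ballI impI)
    show "X \<in> U \<longleftrightarrow> - X \<notin> U" for X using compl[of X] meet(1)[of X "- X"] by auto
    show "X \<inter> Y \<in> U" if "X \<in> U" "Y \<in> U" for X Y
    proof (rule ccontr)
      assume "X \<inter> Y \<notin> U"
      then have "infinite (X \<inter> Y \<inter> - (X \<inter> Y))" using compl[of "X \<inter> Y"] meet(2) that by blast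
      moreover have "X \<inter> Y \<inter> - (X \<inter> Y) = {}" by auto
      ultimately show False by simp
    qed
    show "Y \<in> U" if "X \<in> U" "X \<subseteq> Y" for X Y
    proof (rule ccontr)
      assume "Y \<notin> U"
      then have "infinite (X \<inter> - Y)" using compl[of Y] meet(1)[of X "- Y"] that by blast
      moreover have "X \<inter> - Y = {}" using that by auto
      ultimately show False by simp
    qed
  qed (rule inf)
  then show ?thesis ..
qed

definition almost_all :: "nat set set \<Rightarrow> (nat \<Rightarrow> bool) \<Rightarrow> bool" where
  "almost_all U Q \<longleftrightarrow> {k. Q k} \<in> U"

context
  fixes U assumes U: "free_ultrafilter U"
begin

lemma almost_all_mono: "almost_all U Q \<Longrightarrow> (\<And>k. Q k \<Longrightarrow> R k) \<Longrightarrow> almost_all U R"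
  using U unfolding free_ultrafilter_def almost_all_def by (metis Collect_mono)

lemma almost_all_not: "almost_all U (\<lambda>k. \<not> Q k) \<longleftrightarrow> \<not> almost_all U Q"
  using U unfolding free_ultrafilter_def almost_all_def by (metis Collect_neg_eq)

lemma almost_all_conj: "almost_all U (\<lambda>k. Q k \<and> R k) \<longleftrightarrow> almost_all U Q \<and> almost_all U R"
proof
  show "almost_all U Q \<and> almost_all U R" if "almost_all U (\<lambda>k. Q k \<and> R k)"
    using almost_all_mono[OF that] by blast
  show "almost_all U (\<lambda>k. Q k \<and> R k)" if "almost_all U Q \<and> almost_all U R"
    using that U unfolding free_ultrafilter_def almost_all_def Collect_conj_eq by blast
qed

lemma almost_all_mp: "almost_all U Q \<Longrightarrow> almost_all U R \<Longrightarrow> (\<And>k. Q k \<Longrightarrow> R k \<Longrightarrow> S k) \<Longrightarrow> almost_all U S"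
  using almost_all_mono[of "\<lambda>k. Q k \<and> R k" S] almost_all_conj by blast

lemma almost_all_disj: "almost_all U (\<lambda>k. Q k \<or> R k) \<longleftrightarrow> almost_all U Q \<or> almost_all U R"
  using almost_all_not[of "\<lambda>k. Q k \<or> R k"] almost_all_not[of Q] almost_all_not[of R]
    almost_all_conj[of "\<lambda>k. \<not> Q k" "\<lambda>k. \<not> R k"]
  by (simp, blast)

lemma almost_all_tail: "almost_all U (\<lambda>k. n \<le> k)"
proof -
  have "\<not> almost_all U (\<lambda>k. k < n)"
    using U unfolding free_ultrafilter_def almost_all_def by (metis finite_Collect_less_nat)
  then show ?thesis using almost_all_not[of "\<lambda>k. k < n"] by (simp add: not_less)
qed

lemma almost_all_const: "almost_all U (\<lambda>_. Q) \<longleftrightarrow> Q"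
  using almost_all_tail[of 0] almost_all_not[of "\<lambda>_. True"] by (cases Q) auto

text \<open>The elements of a sort are the sequences within that sort, so no sequence mixes sorts.\<close>

definition ultrapower :: "'a struct \<Rightarrow> ('a, nat \<Rightarrow> 'a) prestruct" where
  "ultrapower M = \<lparr>
     puniv = {g. \<forall>k. g k \<in> univ M \<and> sort_of M (g k) = sort_of M (g 0)},
     psort = (\<lambda>g. sort_of M (g 0)),
     pfun = (\<lambda>f gs k. fun_int M f (map (\<lambda>g. g k) gs)),
     prel = (\<lambda>r gs. almost_all U (\<lambda>k. rel_int M r (map (\<lambda>g. g k) gs))),
     peq = (\<lambda>g h. almost_all U (\<lambda>k. g k = h k))\<rparr>"

lemma ultrapower_sel [simp]:
  "puniv (ultrapower M) = {g. \<forall>k. g k \<in> univ M \<and> sort_of M (g k) = sort_of M (g 0)}"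
  "psort (ultrapower M) g = sort_of M (g 0)"
  "pfun (ultrapower M) f gs = (\<lambda>k. fun_int M f (map (\<lambda>g. g k) gs))"
  "prel (ultrapower M) r gs = almost_all U (\<lambda>k. rel_int M r (map (\<lambda>g. g k) gs))"
  "peq (ultrapower M) g h = almost_all U (\<lambda>k. g k = h k)"
  by (simp_all add: ultrapower_def)

lemma prestructure_ultrapower:
  assumes M: "is_struct \<Sigma> M"
  shows "prestructure \<Sigma> (ultrapower M)"
proof -
  have lists: "almost_all U (\<lambda>k. map (\<lambda>g. g k) gs = map (\<lambda>g. g k) hs)"
    if "list_all2 (peq (ultrapower M)) gs hs" for gs hs :: "(nat \<Rightarrow> 'a) list"
    using that
  proof (induction rule: list_all2_induct)
    case Nil
    then show ?case using almost_all_const by simp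
  next
    case (Cons g gs h hs)
    then show ?case by (auto simp: almost_all_conj)
  qed
  show ?thesis
    unfolding prestructure_def
  proof (intro conjI allI ballI impI)
    fix b assume "b \<in> puniv (ultrapower M)"
    then show "psort (ultrapower M) b \<in> sorts \<Sigma>"
      using M by (auto simp: is_struct_def)
  next
    fix f ss s gs
    assume f: "fun_ty \<Sigma> f = Some (ss, s) \<and> set gs \<subseteq> puniv (ultrapower M) \<and> map (psort (ultrapower M)) gs = ss"
    have "map (\<lambda>g. g k) gs \<in> tuples M (univ M) ss" for k
    proof -
      have "g k \<in> univ M \<and> sort_of M (g k) = sort_of M (g 0)" if "g \<in> set gs" for g
        using f that by auto
      then show ?thesis using f by (auto simp: tuples_def)
    qed
    then have "fun_int M f (map (\<lambda>g. g k) gs) \<in> univ M \<and> sort_of M (fun_int M f (map (\<lambda>g. g k) gs)) = s" for k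
      using M f by (auto simp: is_struct_def)
    then show "pfun (ultrapower M) f gs \<in> puniv (ultrapower M)" "psort (ultrapower M) (pfun (ultrapower M) f gs) = s"
      by auto
  next
    show "equivp (peq (ultrapower M))"
    proof (rule equivpI)
      show "reflp (peq (ultrapower M))" using almost_all_const by (auto simp: reflp_def)
      show "symp (peq (ultrapower M))" by (auto simp: symp_def ultrapower_def elim: almost_all_mono)
      show "transp (peq (ultrapower M))" by (auto simp: transp_def ultrapower_def elim: almost_all_mp)
    qed
  next
    fix g h assume gh: "g \<in> puniv (ultrapower M)" "h \<in> puniv (ultrapower M)" "peq (ultrapower M) g h"
    then have "almost_all U (\<lambda>k. g k = h k)" by simp
    then have "almost_all U (\<lambda>k. sort_of M (g 0) = sort_of M (h 0))"
    proof (rule almost_all_mono)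
      fix k assume "g k = h k"
      moreover have "sort_of M (g k) = sort_of M (g 0)" "sort_of M (h k) = sort_of M (h 0)"
        using gh by auto
      ultimately show "sort_of M (g 0) = sort_of M (h 0)" by simp
    qed
    then show "psort (ultrapower M) g = psort (ultrapower M) h"
      by (simp add: almost_all_const)
  next
    fix f and gs hs :: "(nat \<Rightarrow> 'a) list" assume "list_all2 (peq (ultrapower M)) gs hs"
    then show "peq (ultrapower M) (pfun (ultrapower M) f gs) (pfun (ultrapower M) f hs)"
      using lists[of gs hs] by (auto simp: elim: almost_all_mono)
  next
    fix r and gs hs :: "(nat \<Rightarrow> 'a) list" assume "list_all2 (peq (ultrapower M)) gs hs"
    then have *: "almost_all U (\<lambda>k. map (\<lambda>g. g k) gs = map (\<lambda>g. g k) hs)" by (rule lists)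
    show "prel (ultrapower M) r gs = prel (ultrapower M) r hs"
      unfolding ultrapower_sel
    proof
      assume "almost_all U (\<lambda>k. rel_int M r (map (\<lambda>g. g k) gs))"
      then show "almost_all U (\<lambda>k. rel_int M r (map (\<lambda>g. g k) hs))"
        by (rule almost_all_mp[OF *]) simp
    next
      assume "almost_all U (\<lambda>k. rel_int M r (map (\<lambda>g. g k) hs))"
      then show "almost_all U (\<lambda>k. rel_int M r (map (\<lambda>g. g k) gs))"
        by (rule almost_all_mp[OF *]) simp
    qed
  qed
qed

lemma los_term: "ptm_val (ultrapower M) v t = (\<lambda>k. tm_val M (\<lambda>x. v x k) t)"
  by (induction t) (auto simp: cong: map_cong)

text \<open>The theorem of Los.  For an existential formula the witnesses are chosen at each index separately;
  at the exceptional indices any element of the sort will do, and one exists because almost all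
  indices have a witness.\<close>

lemma los: "psat (ultrapower M) v p \<longleftrightarrow> almost_all U (\<lambda>k. sat M (\<lambda>x. v x k) p)"
proof (induction p arbitrary: v)
  case Fls
  then show ?case by (simp add: almost_all_const)
next
  case (Eq t u)
  then show ?case by (simp add: los_term)
next
  case (Rel r ts)
  then show ?case by (simp add: los_term comp_def)
next
  case (Neg p)
  then show ?case by (simp add: almost_all_not)
next
  case (Conj p q)
  then show ?case by (simp add: almost_all_conj)
next
  case (Disj p q)
  then show ?case by (simp add: almost_all_disj)
next
  have exi: "(\<exists>g\<in>puniv (ultrapower M). psort (ultrapower M) g = s \<and> almost_all U (\<lambda>k. Q k (g k))) \<longleftrightarrow>
    almost_all U (\<lambda>k. \<exists>a\<in>univ M. sort_of M a = s \<and> Q k a)" for s and Q :: "nat \<Rightarrow> 'a \<Rightarrow> bool"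
  proof
    assume "\<exists>g\<in>puniv (ultrapower M). psort (ultrapower M) g = s \<and> almost_all U (\<lambda>k. Q k (g k))"
    then show "almost_all U (\<lambda>k. \<exists>a\<in>univ M. sort_of M a = s \<and> Q k a)"
      by (auto simp: elim!: almost_all_mono)
  next
    assume R: "almost_all U (\<lambda>k. \<exists>a\<in>univ M. sort_of M a = s \<and> Q k a)"
    then obtain a where a: "a \<in> univ M" "sort_of M a = s"
      using almost_all_const[of False] almost_all_mono[of _ "\<lambda>_. False"] by blast
    define g where "g = (\<lambda>k. if \<exists>a\<in>univ M. sort_of M a = s \<and> Q k a
       then SOME a. a \<in> univ M \<and> sort_of M a = s \<and> Q k a else a)"
    have g: "g k \<in> univ M \<and> sort_of M (g k) = s \<and> ((\<exists>a\<in>univ M. sort_of M a = s \<and> Q k a) \<longrightarrow> Q k (g k))" for k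
    proof (cases "\<exists>a\<in>univ M. sort_of M a = s \<and> Q k a")
      case True
      then have "g k = (SOME a. a \<in> univ M \<and> sort_of M a = s \<and> Q k a)" by (simp add: g_def)
      then show ?thesis using True someI_ex[of "\<lambda>a. a \<in> univ M \<and> sort_of M a = s \<and> Q k a"] by auto
    qed (use a in \<open>auto simp: g_def\<close>)
    have "almost_all U (\<lambda>k. Q k (g k))" by (rule almost_all_mono[OF R]) (use g in blast)
    then show "\<exists>g\<in>puniv (ultrapower M). psort (ultrapower M) g = s \<and> almost_all U (\<lambda>k. Q k (g k))"
      using g by (auto simp: intro!: exI[of _ g])
  qed
  have upd: "(\<lambda>x. (v(y := g)) x k) = (\<lambda>x. v x k)(y := g k)" for v :: "nat \<times> nat \<Rightarrow> nat \<Rightarrow> 'a" and y g k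
    by auto
  case (Exi s n p)
  show ?case
    using exi[of s "\<lambda>k a. sat M ((\<lambda>x. v x k)((s, n) := a)) p"] by (simp add: Exi.IH upd del: fun_upd_apply)
  case (All s n p)
  have "psat (ultrapower M) v (All s n p) \<longleftrightarrow>
    \<not> (\<exists>g\<in>puniv (ultrapower M). psort (ultrapower M) g = s \<and> almost_all U (\<lambda>k. \<not> sat M ((\<lambda>x. v x k)((s, n) := g k)) p))"
    by (simp only: psat.simps All.IH upd almost_all_not) blast
  also have "\<dots> \<longleftrightarrow> almost_all U (\<lambda>k. sat M (\<lambda>x. v x k) (All s n p))"
    unfolding exi[of s "\<lambda>k a. \<not> sat M ((\<lambda>x. v x k)((s, n) := a)) p"] almost_all_not[symmetric] by simp
  finally show "psat (ultrapower M) v (All s n p) \<longleftrightarrow> almost_all U (\<lambda>k. sat M (\<lambda>x. v x k) (All s n p))" .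
qed

text \<open>Let \<open>p 0, p 1, \<dots>\<close> be the type of \<open>(v, a)\<close>.  The formula \<open>E n\<close>, saying that some element satisfies the
  first \<open>n\<close> of them, holds of \<open>v\<close>, hence of \<open>w\<close>, hence at almost all indices.  Let \<open>b k\<close> be a witness for
  \<open>E n\<close> at index \<open>k\<close>, where \<open>n \<le> k\<close> is as large as possible.  For a fixed \<open>i\<close>, almost all indices \<open>k\<close> are at
  least \<open>i + 1\<close> and satisfy \<open>E (i + 1)\<close>, so that \<open>b k\<close> satisfies \<open>p i\<close> there.\<close>

lemma homogeneous_ultrapower:
  assumes M: "is_struct \<Sigma> M" and wf: "countable {p. wf_fm \<Sigma> p}"
  shows "homogeneous \<Sigma> (ultrapower M)"
  unfolding homogeneous_def
proof (intro allI ballI impI, elim conjE)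
  fix V v w x a
  assume a: "a \<in> puniv (ultrapower M)" "psort (ultrapower M) a = fst x" and "x \<notin> V"
    and same: "same_type \<Sigma> (ultrapower M) V v w"
  define \<Phi> where "\<Phi> = {p. wf_fm \<Sigma> p \<and> free_vars p \<subseteq> insert x V \<and> psat (ultrapower M) (v(x := a)) p}"
  have ne: "Neg Fls \<in> \<Phi>" by (simp add: \<Phi>_def)
  have "countable \<Phi>" by (rule countable_subset[OF _ wf]) (auto simp: \<Phi>_def)
  define p where "p = from_nat_into \<Phi>"
  have p: "range p = \<Phi>"
    unfolding p_def using ne \<open>countable \<Phi>\<close> by (intro range_from_nat_into) auto
  \<comment> \<open>\<open>Neg Fls\<close> is the empty conjunction\<close>
  define E where "E = (\<lambda>n. Exi (fst x) (snd x) (foldr Conj (map p [0..<n]) (Neg Fls)))"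
  have satE: "sat M u (E n) \<longleftrightarrow> (\<exists>c\<in>univ M. sort_of M c = fst x \<and> (\<forall>i<n. sat M (u(x := c)) (p i)))" for u n
    by (auto simp: E_def sat_foldr_Conj)
  have psatE: "psat (ultrapower M) u (E n) \<longleftrightarrow> (\<exists>c\<in>puniv (ultrapower M). psort (ultrapower M) c = fst x \<and>
      (\<forall>i<n. psat (ultrapower M) (u(x := c)) (p i)))" for u n
    by (auto simp: E_def psat_foldr_Conj simp del: ultrapower_sel)
  have pin: "p i \<in> \<Phi>" for i using p by auto
  have "fst x \<in> sorts \<Sigma>"
    using prestructure_ultrapower[OF M] a by (auto simp: prestructure_def simp del: ultrapower_sel)
  moreover have "wf_fm \<Sigma> (p i)" "free_vars (p i) \<subseteq> insert x V" for i
    using pin[of i] by (auto simp: \<Phi>_def)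
  ultimately have "wf_fm \<Sigma> (E n)" "free_vars (E n) \<subseteq> V" for n
    by (fastforce simp: E_def wf_foldr_Conj free_vars_foldr_Conj)+
  moreover have "psat (ultrapower M) v (E n)" for n
    unfolding psatE using a pin by (auto simp: \<Phi>_def simp del: ultrapower_sel)
  ultimately have "psat (ultrapower M) w (E n)" for n
    using same unfolding same_type_def by blast
  then have E: "almost_all U (\<lambda>k. sat M (\<lambda>y. w y k) (E n))" for n by (simp add: los)
  define m where "m = (\<lambda>k. Max {n. n \<le> k \<and> sat M (\<lambda>y. w y k) (E n)})"
  have E0: "sat M u (E 0)" for u using a by (auto simp: satE)
  have "finite {n. n \<le> k \<and> sat M (\<lambda>y. w y k) (E n)}" for k by simp
  then have m: "sat M (\<lambda>y. w y k) (E (m k))" "n \<le> k \<Longrightarrow> sat M (\<lambda>y. w y k) (E n) \<Longrightarrow> n \<le> m k" for k n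
    using Max_in[of "{n. n \<le> k \<and> sat M (\<lambda>y. w y k) (E n)}"] E0 unfolding m_def by (auto intro!: Max_ge)
  then have "\<exists>c. c \<in> univ M \<and> sort_of M c = fst x \<and> (\<forall>i<m k. sat M ((\<lambda>y. w y k)(x := c)) (p i))" for k
    using m(1)[of k] unfolding satE by blast
  then obtain b where b: "\<And>k. b k \<in> univ M" "\<And>k. sort_of M (b k) = fst x"
    "\<And>k i. i < m k \<Longrightarrow> sat M ((\<lambda>y. w y k)(x := b k)) (p i)"
    by metis
  have upd: "(\<lambda>y. (w(x := b)) y k) = (\<lambda>y. w y k)(x := b k)" for k by auto
  have wb: "psat (ultrapower M) (w(x := b)) (p i)" for i
    unfolding los upd
    by (rule almost_all_mp[OF E[of "Suc i"] almost_all_tail[of "Suc i"]]) (rule b(3), rule Suc_le_lessD, rule m(2))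
  have "same_type \<Sigma> (ultrapower M) (insert x V) (v(x := a)) (w(x := b))"
    unfolding same_type_def
  proof (intro allI impI, elim conjE)
    fix q assume q: "wf_fm \<Sigma> q" "free_vars q \<subseteq> insert x V"
    show "psat (ultrapower M) (v(x := a)) q = psat (ultrapower M) (w(x := b)) q"
    proof (cases "psat (ultrapower M) (v(x := a)) q")
      case True
      then have "q \<in> range p" using q p by (simp add: \<Phi>_def)
      then show ?thesis using True wb by auto
    next
      case False
      \<comment> \<open>types are complete, so one inclusion suffices\<close>
      then have "Neg q \<in> range p" using q p by (simp add: \<Phi>_def)
      then have "psat (ultrapower M) (w(x := b)) (Neg q)" using wb by (metis rangeE)
      then show ?thesis using False by simp
    qed
  qed
  then show "\<exists>b\<in>puniv (ultrapower M). psort (ultrapower M) b = fst x \<and>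
      same_type \<Sigma> (ultrapower M) (insert x V) (v(x := a)) (w(x := b))"
    using b by (intro bexI[of _ b]) auto
qed

end

section \<open>Isomorphisms\<close>

lemma isomorphismD:
  assumes "isomorphism \<Sigma> h N N'"
  shows "bij_betw h (univ N) (univ N')" "a \<in> univ N \<Longrightarrow> sort_of N' (h a) = sort_of N a"
    "fun_ty \<Sigma> f = Some (ss, s) \<Longrightarrow> as \<in> tuples N (univ N) ss \<Longrightarrow> h (fun_int N f as) = fun_int N' f (map h as)"
    "rel_ty \<Sigma> r = Some ss \<Longrightarrow> as \<in> tuples N (univ N) ss \<Longrightarrow> rel_int N r as \<longleftrightarrow> rel_int N' r (map h as)"
  using assms by (auto simp: isomorphism_def)

lemma tm_val_iso:
  assumes "isomorphism \<Sigma> h N N'" and N: "is_struct \<Sigma> N"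
  shows "has_sort \<Sigma> t s \<Longrightarrow> assigns (pre_of N) (tm_vars t) v \<Longrightarrow>
    tm_val N v t \<in> univ N \<and> sort_of N (tm_val N v t) = s \<and> tm_val N' (\<lambda>x. h (v x)) t = h (tm_val N v t)"
proof (induction rule: has_sort.induct)
  case (1 s n)
  then show ?case by (auto simp: assigns_def pre_of_def)
next
  case (2 f ss s ts)
  from 2(2) have *: "list_all2 (\<lambda>t s. tm_val N v t \<in> univ N \<and> sort_of N (tm_val N v t) = s \<and>
      tm_val N' (\<lambda>x. h (v x)) t = h (tm_val N v t)) ts ss"
  proof (rule list.rel_mono_strong)
    fix t s assume "t \<in> set ts"
    then have "assigns (pre_of N) (tm_vars t) v" using 2(3) by (auto simp: assigns_def)
    then show "has_sort \<Sigma> t s \<and> (assigns (pre_of N) (tm_vars t) v \<longrightarrow>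
        tm_val N v t \<in> univ N \<and> sort_of N (tm_val N v t) = s \<and> tm_val N' (\<lambda>x. h (v x)) t = h (tm_val N v t)) \<Longrightarrow>
      tm_val N v t \<in> univ N \<and> sort_of N (tm_val N v t) = s \<and> tm_val N' (\<lambda>x. h (v x)) t = h (tm_val N v t)"
      by blast
  qed
  have "map (tm_val N v) ts \<in> tuples N (univ N) ss"
    using list_all2_mapD[OF *] by (simp add: tuples_def)
  then show ?case
    using list_all2_mapD(3)[OF *] isomorphismD(3)[OF assms(1) 2(1)] N 2(1)
    by (auto simp: is_struct_def simp del: map_map)
qed

lemma tm_vals_iso:
  assumes "isomorphism \<Sigma> h N N'" and N: "is_struct \<Sigma> N" and "list_all2 (has_sort \<Sigma>) ts ss"
    "assigns (pre_of N) (\<Union>t\<in>set ts. tm_vars t) v"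
  shows "map (tm_val N v) ts \<in> tuples N (univ N) ss"
    "map (tm_val N' (\<lambda>x. h (v x))) ts = map h (map (tm_val N v) ts)"
proof -
  from assms(3) have *: "list_all2 (\<lambda>t s. tm_val N v t \<in> univ N \<and> sort_of N (tm_val N v t) = s \<and>
      tm_val N' (\<lambda>x. h (v x)) t = h (tm_val N v t)) ts ss"
    by (rule list.rel_mono_strong) (rule tm_val_iso[OF assms(1,2)], use assms(4) in \<open>auto simp: assigns_def\<close>)
  show "map (tm_val N v) ts \<in> tuples N (univ N) ss"
    "map (tm_val N' (\<lambda>x. h (v x))) ts = map h (map (tm_val N v) ts)"
    using list_all2_mapD[OF *] by (simp_all add: tuples_def)
qed

lemma sat_iso:
  assumes iso: "isomorphism \<Sigma> h N N'" and N: "is_struct \<Sigma> N"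
  shows "wf_fm \<Sigma> p \<Longrightarrow> assigns (pre_of N) (free_vars p) v \<Longrightarrow> sat N' (\<lambda>x. h (v x)) p = sat N v p"
proof (induction p arbitrary: v)
  case (Eq t u)
  then obtain s where s: "has_sort \<Sigma> t s" "has_sort \<Sigma> u s" by auto
  have v: "assigns (pre_of N) (tm_vars t) v" "assigns (pre_of N) (tm_vars u) v"
    using Eq(2) by (auto simp: assigns_def)
  have inj: "inj_on h (univ N)" using isomorphismD(1)[OF iso] by (simp add: bij_betw_def)
  note t = tm_val_iso[OF iso N s(1) v(1)] and u = tm_val_iso[OF iso N s(2) v(2)]
  have "h (tm_val N v t) = h (tm_val N v u) \<longleftrightarrow> tm_val N v t = tm_val N v u"
    using inj_on_eq_iff[OF inj] t u by blast
  then show ?case using t u by (simp only: sat.simps)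
next
  case (Rel r ts)
  then obtain ss where ss: "rel_ty \<Sigma> r = Some ss" "list_all2 (has_sort \<Sigma>) ts ss" by auto
  have v: "assigns (pre_of N) (\<Union>t\<in>set ts. tm_vars t) v" using Rel(2) by simp
  show ?case
    using tm_vals_iso[OF iso N ss(2) v] isomorphismD(4)[OF iso ss(1)] by (simp del: map_map)
next
  case (All s n p)
  have bij: "univ N' = h ` univ N" using isomorphismD(1)[OF iso] by (simp add: bij_betw_def)
  have "sat N' ((\<lambda>x. h (v x))((s, n) := h a)) p = sat N (v((s, n) := a)) p"
    if "a \<in> univ N" "sort_of N a = s" for a
  proof -
    have "assigns (pre_of N) (free_vars p) (v((s, n) := a))"
      using that All.prems by (auto simp: assigns_def pre_of_def)
    moreover have "(\<lambda>x. h (v x))((s, n) := h a) = (\<lambda>x. h ((v((s, n) := a)) x))" by auto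
    ultimately show ?thesis using All.IH[of "v((s, n) := a)"] All.prems by (simp del: fun_upd_apply)
  qed
  then show ?case using isomorphismD(2)[OF iso] by (auto simp: bij)
next
  case (Exi s n p)
  have bij: "univ N' = h ` univ N" using isomorphismD(1)[OF iso] by (simp add: bij_betw_def)
  have "sat N' ((\<lambda>x. h (v x))((s, n) := h a)) p = sat N (v((s, n) := a)) p"
    if "a \<in> univ N" "sort_of N a = s" for a
  proof -
    have "assigns (pre_of N) (free_vars p) (v((s, n) := a))"
      using that Exi.prems by (auto simp: assigns_def pre_of_def)
    moreover have "(\<lambda>x. h (v x))((s, n) := h a) = (\<lambda>x. h ((v((s, n) := a)) x))" by auto
    ultimately show ?thesis using Exi.IH[of "v((s, n) := a)"] Exi.prems by (simp del: fun_upd_apply)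
  qed
  then show ?case using isomorphismD(2)[OF iso] by (auto simp: bij)
qed (auto simp: assigns_def)

lemma valid_in_iso:
  assumes "isomorphism \<Sigma> h N N'" "is_struct \<Sigma> N" "p \<in> sentences \<Sigma>"
  shows "valid_in N' p = valid_in N p"
proof -
  have p: "wf_fm \<Sigma> p" "free_vars p = {}" using assms(3) by (auto simp: sentences_def)
  show ?thesis
    using sat_iso[OF assms(1,2) p(1), of undefined] valid_in_iff[OF p(2)] p(2) by (auto simp: assigns_def)
qed

lemma homogeneous_iso:
  assumes iso: "isomorphism \<Sigma> h M N" and M: "is_struct \<Sigma> M" and N: "homogeneous \<Sigma> (pre_of N)"
  shows "homogeneous \<Sigma> (pre_of M)"
  unfolding homogeneous_def
proof (intro allI ballI impI, elim conjE)
  fix V v w x a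
  assume V: "finite V" and v: "assigns (pre_of M) V v" and w: "assigns (pre_of M) V w" and x: "x \<notin> V"
    and same: "same_type \<Sigma> (pre_of M) V v w" and a: "a \<in> puniv (pre_of M)" "psort (pre_of M) a = fst x"
  have bij: "univ N = h ` univ M" using isomorphismD(1)[OF iso] by (simp add: bij_betw_def)
  have as: "assigns (pre_of N) W (\<lambda>y. h (u y))" if "assigns (pre_of M) W u" for W u
    using that isomorphismD(2)[OF iso] by (auto simp: assigns_def pre_of_def bij)
  have sub: "assigns P W u" if "assigns P W' u" "W \<subseteq> W'" for P :: "('a, 'a) prestruct" and W W' u
    using that by (auto simp: assigns_def)
  have same_iff: "same_type \<Sigma> (pre_of N) W (\<lambda>y. h (u y)) (\<lambda>y. h (u' y)) \<longleftrightarrow> same_type \<Sigma> (pre_of M) W u u'"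
    if "assigns (pre_of M) W u" "assigns (pre_of M) W u'" for W u u'
    unfolding same_type_def psat_pre_of using sat_iso[OF iso M] sub[OF that(1)] sub[OF that(2)] by metis
  have "h a \<in> puniv (pre_of N)" "psort (pre_of N) (h a) = fst x"
    using a isomorphismD(2)[OF iso] by (auto simp: pre_of_def bij)
  then obtain b where b: "b \<in> puniv (pre_of N)" "psort (pre_of N) b = fst x"
    "same_type \<Sigma> (pre_of N) (insert x V) ((\<lambda>y. h (v y))(x := h a)) ((\<lambda>y. h (w y))(x := b))"
    using homogeneousD[OF N V as[OF v] as[OF w] _ x] same same_iff[OF v w] by blast
  then obtain c where c: "c \<in> univ M" "b = h c" by (auto simp: pre_of_def bij)
  have upd: "(\<lambda>y. h (u y))(x := h d) = (\<lambda>y. h ((u(x := d)) y))" for u d by auto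
  have sc: "psort (pre_of M) c = fst x" using b(2) c isomorphismD(2)[OF iso] by (simp add: pre_of_def)
  have "assigns (pre_of M) (insert x V) (v(x := a))" "assigns (pre_of M) (insert x V) (w(x := c))"
    using v w a c sc by (auto simp: assigns_def pre_of_def)
  then have "same_type \<Sigma> (pre_of M) (insert x V) (v(x := a)) (w(x := c))"
    using b(3) unfolding c(2) upd by (simp only: same_iff)
  then show "\<exists>b\<in>puniv (pre_of M). psort (pre_of M) b = fst x \<and>
      same_type \<Sigma> (pre_of M) (insert x V) (v(x := a)) (w(x := b))"
    using c sc by (auto simp: pre_of_def)
qed

section \<open>Back and forth\<close>

text \<open>Finite relations between tuples of the same type.  As types contain equalities, these are graphs of
  partial injections, and the symmetric form makes the back step the converse of the forth step.\<close>

definition partial_elementary :: "'a name sig \<Rightarrow> 'a struct \<Rightarrow> ('a \<times> 'a) set \<Rightarrow> bool" where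
  "partial_elementary \<Sigma> M R \<longleftrightarrow> (\<exists>V v w. finite V \<and> assigns (pre_of M) V v \<and> assigns (pre_of M) V w \<and>
     same_type \<Sigma> (pre_of M) V v w \<and> R = (\<lambda>x. (v x, w x)) ` V)"

lemma partial_elementary_converse:
  assumes "partial_elementary \<Sigma> M R" shows "partial_elementary \<Sigma> M (R\<inverse>)"
proof -
  obtain V v w where V: "finite V" "assigns (pre_of M) V v" "assigns (pre_of M) V w"
    "same_type \<Sigma> (pre_of M) V v w" "R = (\<lambda>x. (v x, w x)) ` V"
    using assms unfolding partial_elementary_def by blast
  have "same_type \<Sigma> (pre_of M) V w v" using V(4) by (auto simp: same_type_def)
  moreover have "R\<inverse> = (\<lambda>x. (w x, v x)) ` V" using V(5) by auto
  ultimately show ?thesis using V(1-3) unfolding partial_elementary_def by blast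
qed

lemma partial_elementary_forth:
  assumes M: "homogeneous \<Sigma> (pre_of M)" and R: "partial_elementary \<Sigma> M R" and a: "a \<in> univ M"
  shows "\<exists>b. partial_elementary \<Sigma> M (insert (a, b) R)"
proof -
  obtain V v w where V: "finite V" "assigns (pre_of M) V v" "assigns (pre_of M) V w"
    "same_type \<Sigma> (pre_of M) V v w" "R = (\<lambda>x. (v x, w x)) ` V"
    using R unfolding partial_elementary_def by blast
  obtain n where "n \<notin> snd ` V" using V(1) ex_new_if_finite[of "snd ` V"] infinite_UNIV_nat by blast
  then obtain x where x: "x \<notin> V" "fst x = sort_of M a" by (metis fst_conv image_eqI snd_conv)
  have "a \<in> puniv (pre_of M)" "psort (pre_of M) a = fst x" using a x(2) by (simp_all add: pre_of_def)
  then obtain b where b: "b \<in> puniv (pre_of M)" "psort (pre_of M) b = fst x"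
    "same_type \<Sigma> (pre_of M) (insert x V) (v(x := a)) (w(x := b))"
    using homogeneousD[OF M V(1-4) x(1)] by blast
  have "(\<lambda>y. ((v(x := a)) y, (w(x := b)) y)) ` insert x V = insert (a, b) ((\<lambda>x. (v x, w x)) ` V)"
    using x(1) by (auto simp: image_iff)
  moreover have "assigns (pre_of M) (insert x V) (v(x := a))" "assigns (pre_of M) (insert x V) (w(x := b))"
    using V a b x by (auto simp: assigns_def pre_of_def)
  ultimately show ?thesis
    using V(1,5) b(3) unfolding partial_elementary_def by (metis finite_insert)
qed

lemma partial_elementary_back:
  assumes "homogeneous \<Sigma> (pre_of M)" and "partial_elementary \<Sigma> M R" and "b \<in> univ M"
  shows "\<exists>a. partial_elementary \<Sigma> M (insert (a, b) R)"
proof -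
  obtain a where "partial_elementary \<Sigma> M (insert (b, a) (R\<inverse>))"
    using partial_elementary_forth[OF assms(1) partial_elementary_converse[OF assms(2)] assms(3)] ..
  moreover have "(insert (b, a) (R\<inverse>))\<inverse> = insert (a, b) R" by auto
  ultimately show ?thesis using partial_elementary_converse by metis
qed

text \<open>The entries of a list of pairs are values of variables in \<open>V\<close>, so an instance of a function or
  relation symbol is an atomic formula with variables in \<open>V\<close>, about which both tuples agree.\<close>

lemma partial_elementary_preserves:
  assumes R: "partial_elementary \<Sigma> M R" and M: "is_struct \<Sigma> M" and ps: "set ps \<subseteq> R"
  shows "(a, b) \<in> R \<Longrightarrow> a \<in> univ M \<and> b \<in> univ M \<and> sort_of M a = sort_of M b"
    and "(a, b) \<in> R \<Longrightarrow> (a', b') \<in> R \<Longrightarrow> a = a' \<longleftrightarrow> b = b'"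
    and "fun_ty \<Sigma> f = Some (map (sort_of M) (map fst ps), s) \<Longrightarrow> (a, b) \<in> R \<Longrightarrow> sort_of M a = s \<Longrightarrow>
      fun_int M f (map fst ps) = a \<longleftrightarrow> fun_int M f (map snd ps) = b"
    and "rel_ty \<Sigma> r = Some (map (sort_of M) (map fst ps)) \<Longrightarrow>
      rel_int M r (map fst ps) \<longleftrightarrow> rel_int M r (map snd ps)"
proof -
  obtain V v w where V: "finite V" "assigns (pre_of M) V v" "assigns (pre_of M) V w"
    "same_type \<Sigma> (pre_of M) V v w" "R = (\<lambda>x. (v x, w x)) ` V"
    using R unfolding partial_elementary_def by blast
  have v: "v x \<in> univ M" "sort_of M (v x) = fst x" and w: "w x \<in> univ M" "sort_of M (w x) = fst x"
    if "x \<in> V" for x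
    using V(2,3) that by (auto simp: assigns_def pre_of_def)
  show sorts: "a \<in> univ M \<and> b \<in> univ M \<and> sort_of M a = sort_of M b" if "(a, b) \<in> R" for a b
    using that v w by (auto simp: V(5))
  define var :: "nat \<times> nat \<Rightarrow> 'a tm" where "var = (\<lambda>x. Var (fst x) (snd x))"
  have val: "tm_val M u (var x) = u x" and vars: "tm_vars (var x) = {x}" for u x by (simp_all add: var_def)
  have so: "has_sort \<Sigma> (var x) (fst x)" if "x \<in> V" for x
    using v[OF that] M unfolding var_def is_struct_def by (auto intro!: has_sort.intros)
  have same: "sat M v p \<longleftrightarrow> sat M w p" if "wf_fm \<Sigma> p" "free_vars p \<subseteq> V" for p
    using V(4) that unfolding same_type_def psat_pre_of by blast
  obtain xs where xs: "ps = map (\<lambda>x. (v x, w x)) xs" "set xs \<subseteq> V"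
    using ps unfolding V(5) by (rule set_map_image)
  then have fs: "map fst ps = map v xs" "map snd ps = map w xs" by auto
  have tys: "list_all2 (has_sort \<Sigma>) (map var xs) (map (sort_of M) (map fst ps))"
    using xs(2) so v unfolding fs by (induction xs) auto
  have sub: "(\<Union>t\<in>set (map var xs). tm_vars t) \<subseteq> V" using xs(2) vars by auto
  have vals: "map (tm_val M u) (map var xs) = map u xs" for u by (simp add: val)
  show "a = a' \<longleftrightarrow> b = b'" if ab: "(a, b) \<in> R" "(a', b') \<in> R"
  proof (cases "sort_of M a = sort_of M a'")
    case True
    obtain x y where xy: "x \<in> V" "y \<in> V" "a = v x" "b = w x" "a' = v y" "b' = w y" using ab V(5) by auto
    then have "fst x = fst y" using True v by auto
    then have "wf_fm \<Sigma> (Eq (var x) (var y))" using so[OF xy(1)] so[OF xy(2)] by auto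
    then show ?thesis using same[of "Eq (var x) (var y)"] xy by (simp add: val vars)
  next
    case False
    then show ?thesis using sorts[OF ab(1)] sorts[OF ab(2)] by metis
  qed
  show "fun_int M f (map fst ps) = a \<longleftrightarrow> fun_int M f (map snd ps) = b"
    if f: "fun_ty \<Sigma> f = Some (map (sort_of M) (map fst ps), s)" "(a, b) \<in> R" "sort_of M a = s"
  proof -
    obtain x where x: "x \<in> V" "a = v x" "b = w x" using f(2) V(5) by auto
    have "has_sort \<Sigma> (var x) s" using so[OF x(1)] v(2)[OF x(1)] x(2) f(3) by simp
    moreover have "has_sort \<Sigma> (Fn f (map var xs)) s" using f(1) tys by (rule has_sort.intros)
    ultimately have "wf_fm \<Sigma> (Eq (Fn f (map var xs)) (var x))" by auto
    moreover have "free_vars (Eq (Fn f (map var xs)) (var x)) \<subseteq> V" using sub vars x(1) by simp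
    ultimately show ?thesis
      using same[of "Eq (Fn f (map var xs)) (var x)"] x
      by (simp add: val vals fs del: map_map)
  qed
  show "rel_int M r (map fst ps) \<longleftrightarrow> rel_int M r (map snd ps)"
    if r: "rel_ty \<Sigma> r = Some (map (sort_of M) (map fst ps))"
  proof -
    have "wf_fm \<Sigma> (Rel r (map var xs))" using r tys by auto
    then show ?thesis
      using same[of "Rel r (map var xs)"] sub by (simp add: vals fs del: map_map)
  qed
qed

text \<open>Putting the elements of an enumeration of the universe one by one into both the domain and the
  range gives an increasing sequence of partial elementary relations whose union is total on both sides.
  Each instance of a symbol involves finitely many elements and so takes place at a finite stage.\<close>

lemma back_and_forth:
  assumes hom: "homogeneous \<Sigma> (pre_of M)" and M: "is_struct \<Sigma> M" and cnt: "countable (univ M)"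
    and R: "partial_elementary \<Sigma> M R"
  shows "\<exists>\<alpha>. isomorphism \<Sigma> \<alpha> M M \<and> (\<forall>(a, b)\<in>R. \<alpha> a = b)"
proof -
  have step: "\<exists>S. partial_elementary \<Sigma> M S \<and> R \<subseteq> S \<and> (a \<in> univ M \<longrightarrow> a \<in> Domain S \<and> a \<in> Range S)"
    if pe: "partial_elementary \<Sigma> M R" for R a
  proof (cases "a \<in> univ M")
    case True
    obtain b where b: "partial_elementary \<Sigma> M (insert (a, b) R)"
      using partial_elementary_forth[OF hom pe True] ..
    obtain c where "partial_elementary \<Sigma> M (insert (c, a) (insert (a, b) R))"
      using partial_elementary_back[OF hom b True] ..
    then show ?thesis by (intro exI[of _ "insert (c, a) (insert (a, b) R)"]) auto
  qed (use pe in auto)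
  have "\<exists>S. \<forall>n. (partial_elementary \<Sigma> M (S n) \<and> (n = 0 \<longrightarrow> S n = R)) \<and> S n \<subseteq> S (Suc n) \<and>
     (from_nat_into (univ M) n \<in> univ M \<longrightarrow> from_nat_into (univ M) n \<in> Domain (S (Suc n)) \<and>
        from_nat_into (univ M) n \<in> Range (S (Suc n)))"
    \<comment> \<open>for an empty universe \<open>from_nat_into\<close> is arbitrary, whence the condition on membership\<close>
    by (rule dependent_nat_choice) (use R step in auto)
  then obtain S where S: "\<And>n. partial_elementary \<Sigma> M (S n)" "S 0 = R" "\<And>n. S n \<subseteq> S (Suc n)"
    "\<And>n. from_nat_into (univ M) n \<in> univ M \<Longrightarrow> from_nat_into (univ M) n \<in> Domain (S (Suc n)) \<and>
        from_nat_into (univ M) n \<in> Range (S (Suc n))"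
    by metis
  have mono: "m \<le> n \<Longrightarrow> S m \<subseteq> S n" for m n by (rule lift_Suc_mono_le[of S]) (rule S(3))
  have fin: "\<exists>n. set ps \<subseteq> S n" if "set ps \<subseteq> (\<Union>n. S n)" for ps
    using that
  proof (induction ps)
    case (Cons p ps)
    then obtain m n where "p \<in> S m" "set ps \<subseteq> S n" by auto
    then show ?case using mono[of m "max m n"] mono[of n "max m n"] by (intro exI[of _ "max m n"]) auto
  qed simp
  define G where "G = (\<Union>n. S n)"
  have G: "a \<in> univ M \<and> b \<in> univ M \<and> sort_of M a = sort_of M b" if "(a, b) \<in> G" for a b
    using that partial_elementary_preserves(1)[OF S(1) M, of "[]"] unfolding G_def by auto
  have G_eq: "a = a' \<longleftrightarrow> b = b'" if ab: "(a, b) \<in> G" "(a', b') \<in> G" for a b a' b'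
  proof -
    obtain n where n: "set [(a, b), (a', b')] \<subseteq> S n" using fin[of "[(a, b), (a', b')]"] ab unfolding G_def by auto
    have "set [] \<subseteq> S n" by simp
    from partial_elementary_preserves(2)[OF S(1) M this] n show ?thesis by simp
  qed
  have G_tot: "a \<in> Domain G" "a \<in> Range G" if a: "a \<in> univ M" for a
  proof -
    obtain n where n: "from_nat_into (univ M) n = a" using from_nat_into_surj[OF cnt a] ..
    then have "a \<in> Domain (S (Suc n))" "a \<in> Range (S (Suc n))" using S(4)[of n] a by auto
    then show "a \<in> Domain G" "a \<in> Range G" unfolding G_def by blast+
  qed
  define \<alpha> where "\<alpha> a = (SOME b. (a, b) \<in> G)" for a
  have \<alpha>: "(a, \<alpha> a) \<in> G" if "a \<in> univ M" for a
    unfolding \<alpha>_def by (rule someI_ex) (use G_tot(1)[OF that] in auto)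
  have \<alpha>_eq: "\<alpha> a = b" if "(a, b) \<in> G" for a b
    using G_eq[OF \<alpha> that] G[OF that] by auto
  have ps: "\<exists>n. set (map (\<lambda>a. (a, \<alpha> a)) as) \<subseteq> S n" if "set as \<subseteq> univ M" for as
    by (rule fin) (use \<alpha> subsetD[OF that] in \<open>auto simp: G_def\<close>)
  have proj: "map fst (map (\<lambda>a. (a, \<alpha> a)) as) = as" "map snd (map (\<lambda>a. (a, \<alpha> a)) as) = map \<alpha> as" for as
    by (simp_all add: comp_def)
  have "isomorphism \<Sigma> \<alpha> M M"
    unfolding isomorphism_def
  proof (intro conjI ballI allI impI)
    show "bij_betw \<alpha> (univ M) (univ M)"
      unfolding bij_betw_def
    proof
      show "inj_on \<alpha> (univ M)" using G_eq \<alpha> by (metis inj_onI)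
      show "\<alpha> ` univ M = univ M"
      proof
        show "\<alpha> ` univ M \<subseteq> univ M" using G \<alpha> by blast
        show "univ M \<subseteq> \<alpha> ` univ M"
        proof
          fix b assume "b \<in> univ M"
          then obtain a where a: "(a, b) \<in> G" using G_tot(2)[of b] by auto
          then show "b \<in> \<alpha> ` univ M" using \<alpha>_eq[OF a] G[OF a] by auto
        qed
      qed
    qed
    show "sort_of M (\<alpha> a) = sort_of M a" if "a \<in> univ M" for a using G[OF \<alpha>[OF that]] by simp
    fix f ss s as assume f: "fun_ty \<Sigma> f = Some (ss, s)" and as: "as \<in> tuples M (univ M) ss"
    have c: "fun_int M f as \<in> univ M" "sort_of M (fun_int M f as) = s"
      using M f as by (auto simp: is_struct_def)
    let ?c = "fun_int M f as"
    obtain n where n: "set (map (\<lambda>a. (a, \<alpha> a)) (?c # as)) \<subseteq> S n"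
      using ps[of "?c # as"] as c by (auto simp: tuples_def)
    have "fun_int M f as = ?c \<longleftrightarrow> fun_int M f (map \<alpha> as) = \<alpha> ?c"
      using partial_elementary_preserves(3)[OF S(1) M, of "map (\<lambda>a. (a, \<alpha> a)) as" n f s ?c "\<alpha> ?c", unfolded proj]
        n as f c by (auto simp: tuples_def)
    then show "\<alpha> (fun_int M f as) = fun_int M f (map \<alpha> as)" by simp
  next
    fix r ss as assume r: "rel_ty \<Sigma> r = Some ss" and as: "as \<in> tuples M (univ M) ss"
    obtain n where n: "set (map (\<lambda>a. (a, \<alpha> a)) as) \<subseteq> S n" using ps[of as] as by (auto simp: tuples_def)
    then show "rel_int M r as \<longleftrightarrow> rel_int M r (map \<alpha> as)"
      using partial_elementary_preserves(4)[OF S(1) M n, of r, unfolded proj] as r by (simp add: tuples_def)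
  qed
  moreover have "\<forall>(a, b)\<in>R. \<alpha> a = b" using S(2) \<alpha>_eq unfolding G_def by auto
  ultimately show ?thesis by blast
qed

text \<open>A countable elementary part of an ultrapower that contains, for each instance of homogeneity with
  parameters in it, one of the elements by which the ultrapower satisfies this instance.\<close>

lemma countable_homogeneous_model:
  fixes M :: "('a :: infinite) struct"
  assumes M: "is_struct \<Sigma> M" and wf: "countable {p. wf_fm \<Sigma> p}" and fs: "countable (dom (fun_ty \<Sigma>))"
  shows "\<exists>N :: 'a struct. is_struct \<Sigma> N \<and> countable (univ N) \<and> homogeneous \<Sigma> (pre_of N) \<and>
    (\<forall>p\<in>sentences \<Sigma>. valid_in N p = valid_in M p)"
proof -
  obtain U where U: "free_ultrafilter U" using free_ultrafilter_exists ..
  define P where "P = ultrapower U M"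
  have P: "prestructure \<Sigma> P" "homogeneous \<Sigma> P"
    unfolding P_def by (rule prestructure_ultrapower[OF U M], rule homogeneous_ultrapower[OF U M wf])
  \<comment> \<open>the list of parameters consists of the values of \<open>v\<close>, the values of \<open>w\<close>, and the new element \<open>a\<close>\<close>
  define Q where "Q = (\<lambda>(x, vs) bs c. psort P c = fst x \<and> same_type \<Sigma> P (insert x (set vs))
     ((val_of vs (take (length vs) bs))(x := bs ! (2 * length vs)))
     ((val_of vs (take (length vs) (drop (length vs) bs)))(x := c)))"
  have "countable (range Q)" by simp
  from downward_loewenheim_skolem[OF P(1) wf fs this] obtain C and e :: "(nat \<Rightarrow> 'a) \<Rightarrow> 'a" and N where C: "countable C" "C \<subseteq> puniv P"
    and hull: "\<forall>q\<in>range Q. \<forall>bs\<in>lists C. (\<exists>b\<in>puniv P. q bs b) \<longrightarrow> (\<exists>c\<in>C. q bs c)"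
    and N: "is_struct \<Sigma> N" "univ N = e ` C" "\<forall>b\<in>C. sort_of N (e b) = psort P b"
    and sat0: "\<forall>p v. wf_fm \<Sigma> p \<and> (\<forall>x\<in>free_vars p. v x \<in> C \<and> psort P (v x) = fst x) \<longrightarrow>
      sat N (\<lambda>y. e (v y)) p = psat P v p"
    by (elim exE conjE)
  have sat: "sat N (\<lambda>y. e (v y)) p = psat P v p"
    if "wf_fm \<Sigma> p" "\<forall>x\<in>free_vars p. v x \<in> C \<and> psort P (v x) = fst x" for p v
    using sat0 that by blast
  have "valid_in N p = valid_in M p" if "p \<in> sentences \<Sigma>" for p
  proof -
    have p: "wf_fm \<Sigma> p" "free_vars p = {}" using that by (auto simp: sentences_def)
    have "valid_in N p \<longleftrightarrow> sat N (\<lambda>y. e (undefined y)) p" by (rule valid_in_iff[OF p(2)])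
    also have "\<dots> \<longleftrightarrow> psat P undefined p" by (rule sat[OF p(1)]) (simp add: p(2))
    also have "\<dots> \<longleftrightarrow> valid_in M p"
      unfolding P_def los[OF U] valid_in_iff[OF p(2), symmetric] by (rule almost_all_const[OF U])
    finally show ?thesis .
  qed
  moreover have "homogeneous \<Sigma> (pre_of N)"
    unfolding homogeneous_def
  proof (intro allI ballI impI, elim conjE)
    fix V v w x a
    assume V: "finite V" and v: "assigns (pre_of N) V v" and w: "assigns (pre_of N) V w" and x: "x \<notin> V"
      and same: "same_type \<Sigma> (pre_of N) V v w" and a: "a \<in> puniv (pre_of N)" "psort (pre_of N) a = fst x"
    have lift: "inv_into C e b \<in> C" "e (inv_into C e b) = b" "psort P (inv_into C e b) = sort_of N b"
      if "b \<in> univ N" for b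
      using that N(2) bspec[OF N(3), of "inv_into C e b"] by (auto simp: inv_into_into f_inv_into_f)
    define v' where "v' = (\<lambda>y. inv_into C e (v y))"
    define w' where "w' = (\<lambda>y. inv_into C e (w y))"
    define a' where "a' = inv_into C e a"
    have v': "v' y \<in> C" "psort P (v' y) = fst y" "e (v' y) = v y" if "y \<in> V" for y
      using v that lift[of "v y"] by (auto simp: assigns_def pre_of_def v'_def)
    have w': "w' y \<in> C" "psort P (w' y) = fst y" "e (w' y) = w y" if "y \<in> V" for y
      using w that lift[of "w y"] by (auto simp: assigns_def pre_of_def w'_def)
    have a': "a' \<in> C" "psort P a' = fst x" "e a' = a"
      using a lift[of a] by (auto simp: pre_of_def a'_def)
    have sat': "sat N u p = psat P u' p"
      if "wf_fm \<Sigma> p" "free_vars p \<subseteq> W" "\<And>y. y \<in> W \<Longrightarrow> u' y \<in> C \<and> psort P (u' y) = fst y \<and> e (u' y) = u y"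
      for p W u u'
    proof -
      have "sat N u p = sat N (\<lambda>y. e (u' y)) p" by (rule sat_cong) (use that in auto)
      also have "\<dots> = psat P u' p" by (rule sat) (use that in auto)
      finally show ?thesis .
    qed
    obtain vs where vs: "set vs = V" using finite_list[OF V] ..
    have "psat P v' p = psat P w' p" if "wf_fm \<Sigma> p" "free_vars p \<subseteq> V" for p
      using sat'[OF that, of v' v] sat'[OF that, of w' w] v' w' same that
      unfolding same_type_def psat_pre_of by auto
    then have "same_type \<Sigma> P V v' w'" by (simp add: same_type_def)
    moreover have "assigns P V v'" "assigns P V w'" "a' \<in> puniv P"
      using v' w' a' C(2) by (auto simp: assigns_def)
    ultimately obtain b where b: "b \<in> puniv P" "psort P b = fst x" "same_type \<Sigma> P (insert x V) (v'(x := a')) (w'(x := b))"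
      using homogeneousD[OF P(2) V _ _ _ x _ a'(2)] by blast
    let ?bs = "map v' vs @ map w' vs @ [a']"
    have Qbs: "Q (x, vs) ?bs c \<longleftrightarrow> psort P c = fst x \<and> same_type \<Sigma> P (insert x V) (v'(x := a')) (w'(x := c))" for c
    proof -
      have "psat P ((val_of vs (map u vs))(x := d)) p = psat P (u(x := d)) p" if "free_vars p \<subseteq> insert x V"
        for u :: "nat \<times> nat \<Rightarrow> nat \<Rightarrow> 'a" and d p
        by (rule psat_cong) (use that vs in auto)
      moreover have "?bs ! (2 * length vs) = a'" by (simp add: nth_append)
      ultimately show ?thesis unfolding Q_def same_type_def by (auto simp: vs)
    qed
    have "\<exists>c\<in>C. Q (x, vs) ?bs c"
    proof -
      have "?bs \<in> lists C" using v' w' a' vs by auto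
      moreover have "\<exists>b\<in>puniv P. Q (x, vs) ?bs b" using b unfolding Qbs by blast
      ultimately show ?thesis using bspec[OF bspec[OF hull rangeI[of Q "(x, vs)"]]] by blast
    qed
    then obtain c where c: "c \<in> C" "psort P c = fst x" "same_type \<Sigma> P (insert x V) (v'(x := a')) (w'(x := c))"
      unfolding Qbs by blast
    have "sat N (v(x := a)) p = sat N (w(x := e c)) p" if "wf_fm \<Sigma> p" "free_vars p \<subseteq> insert x V" for p
    proof -
      have "sat N (v(x := a)) p = psat P (v'(x := a')) p" by (rule sat'[OF that]) (use v' a' in auto)
      moreover have "sat N (w(x := e c)) p = psat P (w'(x := c)) p" by (rule sat'[OF that]) (use w' c in auto)
      ultimately show ?thesis using c(3) that by (simp add: same_type_def)
    qed
    then have "same_type \<Sigma> (pre_of N) (insert x V) (v(x := a)) (w(x := e c))"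
      by (simp add: same_type_def psat_pre_of)
    then show "\<exists>b\<in>puniv (pre_of N). psort (pre_of N) b = fst x \<and>
        same_type \<Sigma> (pre_of N) (insert x V) (v(x := a)) (w(x := b))"
      using c N(2) bspec[OF N(3) c(1)] by (intro bexI[of _ "e c"]) (auto simp: pre_of_def)
  qed
  ultimately show ?thesis using N(1,2) C(1) by (auto intro!: exI[of _ N])
qed

text \<open>By categoricity \<open>M\<close> is isomorphic to the homogeneous countable model of its theory.\<close>

lemma omega_categorical_homogeneous:
  fixes M :: "('a :: infinite) struct"
  assumes cat: "omega_categorical \<Sigma> \<Gamma>" and "\<Gamma> \<subseteq> sentences \<Sigma>" and M: "is_model \<Sigma> \<Gamma> M" "countable (univ M)"
    and "countable {p. wf_fm \<Sigma> p}" "countable (dom (fun_ty \<Sigma>))"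
  shows "homogeneous \<Sigma> (pre_of M)"
proof -
  have M': "is_struct \<Sigma> M" using M by (simp add: is_model_def)
  obtain N :: "'a struct" where N: "is_struct \<Sigma> N" "countable (univ N)" "homogeneous \<Sigma> (pre_of N)"
    "\<forall>p\<in>sentences \<Sigma>. valid_in N p = valid_in M p"
    using countable_homogeneous_model[OF M' assms(5,6)] by blast
  then have "is_model \<Sigma> \<Gamma> N" using M assms(2) by (auto simp: is_model_def)
  then obtain h where "isomorphism \<Sigma> h M N" using cat M N(2) unfolding omega_categorical_def by blast
  then show ?thesis using homogeneous_iso M' N(3) by blast
qed

section \<open>Countable models with named elements\<close>

lemma isomorphism_idI:
  assumes "univ N' = univ N" "sort_of N' = sort_of N"
    and "\<And>f. fun_ty \<Sigma> f \<noteq> None \<Longrightarrow> fun_int N' f = fun_int N f"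
    and "\<And>r. rel_ty \<Sigma> r \<noteq> None \<Longrightarrow> rel_int N' r = rel_int N r"
  shows "isomorphism \<Sigma> id N N'"
  using assms by (auto simp: isomorphism_def)

lemma isomorphism_comp:
  assumes h: "isomorphism \<Sigma> h N N'" and g: "isomorphism \<Sigma> g N' N''" and N: "is_struct \<Sigma> N"
  shows "isomorphism \<Sigma> (\<lambda>a. g (h a)) N N''"
proof -
  have hU: "h a \<in> univ N'" if "a \<in> univ N" for a
    using isomorphismD(1)[OF h] that by (auto simp: bij_betw_def)
  have tup: "map h as \<in> tuples N' (univ N') ss" if "as \<in> tuples N (univ N) ss" for as ss
    using that isomorphismD(2)[OF h] hU by (auto simp: tuples_def subset_iff)
  show ?thesis
    unfolding isomorphism_def
  proof (intro conjI ballI allI impI)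
    show "bij_betw (\<lambda>a. g (h a)) (univ N) (univ N'')"
      using bij_betw_trans[OF isomorphismD(1)[OF h] isomorphismD(1)[OF g]] by (simp add: comp_def)
    show "sort_of N'' (g (h a)) = sort_of N a" if "a \<in> univ N" for a
      using isomorphismD(2)[OF g hU[OF that]] isomorphismD(2)[OF h that] by simp
    show "g (h (fun_int N f as)) = fun_int N'' f (map (\<lambda>a. g (h a)) as)"
      if "fun_ty \<Sigma> f = Some (ss, s)" "as \<in> tuples N (univ N) ss" for f ss s as
      using isomorphismD(3)[OF g that(1) tup[OF that(2)]] isomorphismD(3)[OF h that] by (simp add: comp_def)
    show "rel_int N r as \<longleftrightarrow> rel_int N'' r (map (\<lambda>a. g (h a)) as)"
      if "rel_ty \<Sigma> r = Some ss" "as \<in> tuples N (univ N) ss" for r ss as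
      using isomorphismD(4)[OF g that(1) tup[OF that(2)]] isomorphismD(4)[OF h that] by (simp add: comp_def)
  qed
qed

lemma is_struct_iso:
  assumes h: "isomorphism \<Sigma> h N N'" and N: "is_struct \<Sigma> N"
  shows "is_struct \<Sigma> N'"
proof -
  have U: "univ N' = h ` univ N" using isomorphismD(1)[OF h] by (simp add: bij_betw_def)
  show ?thesis
    unfolding is_struct_def
  proof (intro conjI ballI allI impI)
    show "sort_of N' b \<in> sorts \<Sigma>" if "b \<in> univ N'" for b
      using that N isomorphismD(2)[OF h] by (auto simp: U is_struct_def)
    fix f ss s bs assume f: "fun_ty \<Sigma> f = Some (ss, s)" and bs: "bs \<in> tuples N' (univ N') ss"
    then have "set bs \<subseteq> h ` univ N" by (simp add: tuples_def U)
    then obtain as where as: "bs = map h as" "set as \<subseteq> univ N" by (rule set_map_image)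
    have "map (sort_of N') (map h as) = map (sort_of N) as"
      using isomorphismD(2)[OF h] subsetD[OF as(2)] by auto
    then have tup: "as \<in> tuples N (univ N) ss" using bs as by (simp add: tuples_def del: map_map)
    then have "fun_int N f as \<in> univ N" "sort_of N (fun_int N f as) = s" using N f by (auto simp: is_struct_def)
    then show "fun_int N' f bs \<in> univ N'" "sort_of N' (fun_int N' f bs) = s"
      using isomorphismD(3)[OF h f tup] isomorphismD(2)[OF h] as(1) U by (metis image_eqI)+
  qed
qed

lemma naming_sel [simp]:
  "univ (naming N) = univ N" "sort_of (naming N) = sort_of N" "rel_int (naming N) = rel_int N"
  "fun_int (naming N) (Old k) = fun_int N (Old k)" "fun_int (naming N) (New i) = fun_int N (New i)"
  "fun_int (naming N) (Elem a) = (\<lambda>_. a)"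
  by (simp_all add: naming_def)

lemma lang_sel [simp]:
  "sorts (lang L rs M A) = sorts L"
  "fun_ty (lang L rs M A) (Old k) = fun_ty L k"
  "fun_ty (lang L rs M A) (Elem a) = (if a \<in> A then Some ([], sort_of M a) else None)"
  "rel_ty (lang L rs M A) (Old k) = rel_ty L k"
  "rel_ty (lang L rs M A) (Elem a) = None"
  by (simp_all add: lang_def)

lemma lang_New [simp]:
  "fun_ty (lang L [] M A) (New i) = None"
  "rel_ty (lang L [] M A) (New i) = None"
  by (simp_all add: lang_def)

lemma lang_New_any:
  "NO_MATCH {} A \<Longrightarrow> fun_ty (lang L rs M A) (New i) = fun_ty (lang L rs M {}) (New i)"
  "NO_MATCH {} A \<Longrightarrow> rel_ty (lang L rs M A) (New i) = rel_ty (lang L rs M {}) (New i)"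
  by (simp_all add: lang_def)

lemma valid_in_naming:
  assumes "is_struct (lang L rs M {}) N" and "p \<in> sentences (lang L rs M {})"
  shows "valid_in (naming N) p = valid_in N p"
proof (rule valid_in_iso[OF isomorphism_idI assms])
  show "fun_int (naming N) f = fun_int N f" if "fun_ty (lang L rs M {}) f \<noteq> None" for f
    using that by (cases f) auto
qed auto

lemma isomorphism_naming:
  assumes h: "isomorphism (lang L rs M {}) h K N" and c: "\<forall>a\<in>A. h (fun_int K (Elem a) []) = a"
  shows "isomorphism (lang L rs M A) h K (naming N)"
  unfolding isomorphism_def
proof (intro conjI ballI allI impI)
  show "bij_betw h (univ K) (univ (naming N))" using isomorphismD(1)[OF h] by simp
  show "sort_of (naming N) (h a) = sort_of K a" if "a \<in> univ K" for a
    using isomorphismD(2)[OF h that] by simp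
  show "h (fun_int K f as) = fun_int (naming N) f (map h as)"
    if f: "fun_ty (lang L rs M A) f = Some (ss, s)" and as: "as \<in> tuples K (univ K) ss" for f ss s as
  proof (cases f)
    case (Elem a)
    then show ?thesis using f as c by (auto simp: tuples_def split: if_splits)
  next
    case (Old k)
    then show ?thesis using isomorphismD(3)[OF h _ as, of f s] f by simp
  next
    case (New i)
    then show ?thesis using isomorphismD(3)[OF h _ as, of f s] f by (simp add: lang_New_any)
  qed
  show "rel_int K r as = rel_int (naming N) r (map h as)"
    if r: "rel_ty (lang L rs M A) r = Some ss" and as: "as \<in> tuples K (univ K) ss" for r ss as
  proof (cases r)
    case (Old k)
    then show ?thesis using isomorphismD(4)[OF h _ as, of r] r by simp
  next
    case (New i)
    then show ?thesis using isomorphismD(4)[OF h _ as, of r] r by (simp add: lang_New_any)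
  qed (use r in simp)
qed

lemma is_struct_mono:
  assumes "sublang \<Sigma> \<Sigma>'" "sorts \<Sigma> = sorts \<Sigma>'" "is_struct \<Sigma>' N"
  shows "is_struct \<Sigma> N"
proof -
  have "fun_ty \<Sigma> f = Some t \<Longrightarrow> fun_ty \<Sigma>' f = Some t" for f t
    using assms(1) by (auto simp: sublang_def map_le_def dom_def)
  then show ?thesis using assms(2,3) unfolding is_struct_def by metis
qed

lemma is_struct_naming:
  assumes "is_struct (lang L rs M {}) N" "A \<subseteq> univ N" "sort_of N = sort_of M"
  shows "is_struct (lang L rs M A) (naming N)"
  unfolding is_struct_def
proof (intro conjI ballI allI impI)
  show "sort_of (naming N) a \<in> sorts (lang L rs M A)" if "a \<in> univ (naming N)" for a
    using assms(1) that by (auto simp: is_struct_def)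
  fix f ss s as assume f: "fun_ty (lang L rs M A) f = Some (ss, s)" and as: "as \<in> tuples (naming N) (univ (naming N)) ss"
  have as': "as \<in> tuples N (univ N) ss" using as by (simp add: tuples_def)
  have "fun_int (naming N) f as \<in> univ N \<and> sort_of N (fun_int (naming N) f as) = s"
  proof (cases f)
    case (Elem a)
    then show ?thesis using f assms(2,3) by (auto split: if_splits)
  next
    case (Old k)
    then have "fun_ty (lang L rs M {}) f = Some (ss, s)" using f by simp
    then show ?thesis using assms(1) as' Old by (auto simp: is_struct_def)
  next
    case (New i)
    then have "fun_ty (lang L rs M {}) f = Some (ss, s)" using f by (simp add: lang_New_any)
    then show ?thesis using assms(1) as' New by (auto simp: is_struct_def)
  qed
  then show "fun_int (naming N) f as \<in> univ (naming N)" "sort_of (naming N) (fun_int (naming N) f as) = s" by auto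
qed

text \<open>\<open>\<exists>x\<^sub>1. x\<^sub>1 = c\<^sub>1 \<and> (\<exists>x\<^sub>2. x\<^sub>2 = c\<^sub>2 \<and> \<dots> p)\<close>, which says the same as \<open>p\<close> with constants substituted for variables,
  but without a recursion over \<open>p\<close>.\<close>

definition bind_constants :: "(nat \<times> nat \<Rightarrow> 'a) \<Rightarrow> (nat \<times> nat) list \<Rightarrow> 'a fm \<Rightarrow> 'a fm" where
  "bind_constants v vs p = foldr (\<lambda>x q. Exi (fst x) (snd x) (Conj (Eq (Var (fst x) (snd x)) (cst (v x))) q)) vs p"

lemma free_vars_bind_constants: "free_vars (bind_constants v vs p) = free_vars p - set vs"
  by (induction vs) (auto simp: bind_constants_def cst_def)

lemma wf_bind_constants:
  assumes "wf_fm \<Sigma> p" and "\<forall>x\<in>set vs. fst x \<in> sorts \<Sigma> \<and> fun_ty \<Sigma> (Elem (v x)) = Some ([], fst x)"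
  shows "wf_fm \<Sigma> (bind_constants v vs p)"
  using assms(2)
proof (induction vs)
  case (Cons x vs)
  have "has_sort \<Sigma> (cst (v x)) (fst x)" "has_sort \<Sigma> (Var (fst x) (snd x)) (fst x)"
    using Cons.prems unfolding cst_def by (auto intro!: has_sort.intros)
  then show ?case using Cons by (auto simp: bind_constants_def)
qed (use assms(1) in \<open>simp add: bind_constants_def\<close>)

lemma sat_bind_constants:
  assumes "\<forall>x\<in>set vs. fun_int N (Elem (v x)) [] \<in> univ N \<and> sort_of N (fun_int N (Elem (v x)) []) = fst x"
  shows "sat N u (bind_constants v vs p) \<longleftrightarrow> sat N (\<lambda>x. if x \<in> set vs then fun_int N (Elem (v x)) [] else u x) p"
  using assms
proof (induction vs arbitrary: u)
  case (Cons x vs)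
  let ?c = "\<lambda>x. fun_int N (Elem (v x)) []"
  have "sat N u (bind_constants v (x # vs) p) \<longleftrightarrow> sat N (u(x := ?c x)) (bind_constants v vs p)"
    using Cons.prems by (auto simp: bind_constants_def cst_def)
  also have "\<dots> \<longleftrightarrow> sat N (\<lambda>y. if y \<in> set vs then ?c y else (u(x := ?c x)) y) p"
    using Cons by auto
  also have "(\<lambda>y. if y \<in> set vs then ?c y else (u(x := ?c x)) y) = (\<lambda>y. if y \<in> set (x # vs) then ?c y else u y)"
    by auto
  finally show ?case .
qed (simp add: bind_constants_def)

lemma same_type_automorphism:
  assumes "homogeneous \<Sigma> (pre_of M)" "is_struct \<Sigma> M" "countable (univ M)"
    and "finite V" "assigns (pre_of M) V v" "assigns (pre_of M) V w" "same_type \<Sigma> (pre_of M) V v w"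
  shows "\<exists>\<alpha>. isomorphism \<Sigma> \<alpha> M M \<and> (\<forall>x\<in>V. \<alpha> (v x) = w x)"
proof -
  have "partial_elementary \<Sigma> M ((\<lambda>x. (v x, w x)) ` V)"
    using assms(4-) unfolding partial_elementary_def by blast
  from back_and_forth[OF assms(1-3) this] show ?thesis by auto
qed

locale omega_categorical_structure =
  fixes L :: "nat sig" and M :: "('a :: infinite) struct"
  assumes struct: "is_struct (lang L [] M {}) M"
    and cnt: "countable (univ M)"
    and cat: "omega_categorical (lang L [] M {}) (Th L M {})"
begin

lemma hom: "homogeneous (lang L [] M {}) (pre_of M)"
proof (rule omega_categorical_homogeneous[OF cat])
  show "Th L M {} \<subseteq> sentences (lang L [] M {})" by (auto simp: Th_def)
  show "is_model (lang L [] M {}) (Th L M {}) M"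
    using valid_in_naming[OF struct] struct by (auto simp: is_model_def Th_def)
qed (use cnt in \<open>auto simp: countable_wf_fm countable_dom_fun_ty\<close>)

lemma Th_complete:
  assumes "is_model (lang L [] M A) (Th L M A) K" and "p \<in> sentences (lang L [] M A)"
  shows "valid_in K p \<longleftrightarrow> valid_in (naming M) p"
proof -
  have "Neg p \<in> sentences (lang L [] M A)" using assms(2) by (auto simp: sentences_def)
  then have "valid_in (naming M) p \<Longrightarrow> valid_in K p" "valid_in (naming M) (Neg p) \<Longrightarrow> valid_in K (Neg p)"
    using assms by (auto simp: is_model_def Th_def)
  moreover have "free_vars p = {}" using assms(2) by (auto simp: sentences_def)
  ultimately show ?thesis
    using valid_in_iff[of p] valid_in_iff[of "Neg p"] by auto
qed

text \<open>Naming finitely many elements preserves \<open>\<omega>\<close>-categoricity.  An isomorphism \<open>h\<close> of the \<open>L\<close>-reducts maps the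
  interpretations of the constants in \<open>K\<close> to elements with the same type in \<open>M\<close> as the elements named;
  by homogeneity an automorphism \<open>\<alpha>\<close> of \<open>M\<close> brings them back, and \<open>\<alpha> \<circ> h\<close> respects the constants.\<close>

theorem countable_model_isomorphic:
  assumes A: "finite A" "A \<subseteq> univ M" and K: "is_model (lang L [] M A) (Th L M A) K" "countable (univ K)"
  shows "\<exists>h. isomorphism (lang L [] M A) h K (naming M)"
proof -
  let ?\<Sigma> = "lang L [] M {}" and ?\<Sigma>A = "lang L [] M A"
  have sub: "sublang ?\<Sigma> ?\<Sigma>A" by (rule sublang_old) simp
  have KA: "is_struct ?\<Sigma>A K" using K by (simp add: is_model_def)
  have K0: "is_struct ?\<Sigma> K" by (rule is_struct_mono[OF sub _ KA]) simp
  have "Th L M {} \<subseteq> Th L M A" using sentences_mono[OF sub] by (auto simp: Th_def)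
  then have "is_model ?\<Sigma> (Th L M {}) K" using K K0 by (auto simp: is_model_def)
  moreover have "is_model ?\<Sigma> (Th L M {}) M"
    using valid_in_naming[OF struct] struct by (auto simp: is_model_def Th_def)
  ultimately obtain h where h: "isomorphism ?\<Sigma> h K M"
    using cat K(2) cnt unfolding omega_categorical_def by blast
  \<comment> \<open>one variable for each element of \<open>A\<close>; \<open>v\<close> gives it that element, and \<open>w\<close> the image under \<open>h\<close> of the
    interpretation in \<open>K\<close> of the constant for it\<close>
  define var where "var = (\<lambda>a. (sort_of M a, to_nat_on A a))"
  define v where "v = inv_into A var"
  have "inj_on var A"
    using inj_on_to_nat_on[OF countable_finite[OF A(1)]] by (auto simp: var_def inj_on_def)
  then have v: "v (var a) = a" if "a \<in> A" for a using that by (simp add: v_def)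
  define c where "c = (\<lambda>a. fun_int K (Elem a) [])"
  have c: "c a \<in> univ K" "sort_of K (c a) = sort_of M a" if "a \<in> A" for a
    using KA that by (auto simp: is_struct_def c_def tuples_def)
  have hU: "h a \<in> univ M" if "a \<in> univ K" for a using isomorphismD(1)[OF h] that by (auto simp: bij_betw_def)
  let ?V = "var ` A"
  define w where "w = (\<lambda>x. h (c (v x)))"
  have av: "assigns (pre_of M) ?V v" using A by (auto simp: assigns_def pre_of_def v var_def[symmetric]) (simp add: var_def)
  have ac: "assigns (pre_of K) ?V (\<lambda>x. c (v x))"
    using c by (auto simp: assigns_def pre_of_def v) (simp add: var_def)
  have aw: "assigns (pre_of M) ?V w"
    using ac hU isomorphismD(2)[OF h] by (auto simp: assigns_def pre_of_def w_def)
  obtain vs where vs: "set vs = ?V" using finite_list[of ?V] A(1) by auto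
  have "sat M w p = sat M v p" if p: "wf_fm ?\<Sigma> p" "free_vars p \<subseteq> ?V" for p
  proof -
    let ?q = "bind_constants v vs p"
    have fv: "free_vars ?q = {}" using p(2) by (auto simp: free_vars_bind_constants vs)
    have "wf_fm ?\<Sigma>A ?q"
    proof (rule wf_bind_constants[OF wf_fm_mono[OF sub p(1)]], intro ballI)
      fix x assume "x \<in> set vs"
      then obtain a where a: "a \<in> A" "x = var a" by (auto simp: vs)
      then have "sort_of M a \<in> sorts L" using struct A by (auto simp: is_struct_def)
      then show "fst x \<in> sorts ?\<Sigma>A \<and> fun_ty ?\<Sigma>A (Elem (v x)) = Some ([], fst x)"
        using a v by (simp add: var_def)
    qed
    then have q: "?q \<in> sentences ?\<Sigma>A" using fv by (simp add: sentences_def)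
    have ap: "assigns (pre_of K) (free_vars p) (\<lambda>x. c (v x))" "assigns (pre_of M) (free_vars p) v"
      using ac av p(2) by (auto simp: assigns_def)
    have "sat M w p = sat K (\<lambda>x. c (v x)) p"
      unfolding w_def using sat_iso[OF h K0 p(1) ap(1)] .
    also have "\<dots> = sat K (\<lambda>x. if x \<in> set vs then c (v x) else undefined x) p"
      by (rule sat_cong) (use p(2) in \<open>auto simp: vs\<close>)
    also have "\<dots> = sat K undefined ?q"
      using sat_bind_constants[of vs K v undefined p] c v unfolding c_def by (auto simp: vs) (auto simp: var_def)
    also have "\<dots> = valid_in (naming M) ?q"
      using Th_complete[OF K(1) q] valid_in_iff[OF fv] by simp
    also have "\<dots> = sat (naming M) undefined ?q" by (rule valid_in_iff[OF fv])
    also have "\<dots> = sat (naming M) (\<lambda>x. if x \<in> set vs then v x else undefined x) p"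
    proof -
      have "\<forall>x\<in>set vs. v x \<in> univ M \<and> sort_of M (v x) = fst x"
        using av by (simp add: vs assigns_def pre_of_def)
      then show ?thesis using sat_bind_constants[of vs "naming M" v undefined p] by (simp cong: if_cong)
    qed
    also have "\<dots> = sat (naming M) v p"
      by (rule sat_cong) (use p(2) in \<open>auto simp: vs\<close>)
    also have "\<dots> = sat M v p"
    proof -
      have "isomorphism ?\<Sigma> id M (naming M)"
      proof (rule isomorphism_idI)
        show "fun_int (naming M) f = fun_int M f" if "fun_ty ?\<Sigma> f \<noteq> None" for f
          using that by (cases f) auto
      qed auto
      from sat_iso[OF this struct p(1) ap(2)] show ?thesis by simp
    qed
    finally show ?thesis .
  qed
  then have "same_type ?\<Sigma> (pre_of M) ?V w v" by (simp add: same_type_def psat_pre_of)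
  from same_type_automorphism[OF hom struct cnt finite_imageI[OF A(1)] aw av this]
  obtain \<alpha> where \<alpha>: "isomorphism ?\<Sigma> \<alpha> M M" "\<forall>x\<in>?V. \<alpha> (w x) = v x" by blast
  have "isomorphism ?\<Sigma> (\<lambda>a. \<alpha> (h a)) K M" by (rule isomorphism_comp[OF h \<alpha>(1) K0])
  moreover have "\<forall>a\<in>A. \<alpha> (h (fun_int K (Elem a) [])) = a"
    using \<alpha>(2) v by (auto simp: w_def c_def)
  ultimately show ?thesis by (intro exI) (rule isomorphism_naming)
qed

text \<open>The interpretations of the additional symbols are carried over to \<open>M\<close> along the isomorphism.\<close>

lemma expansion_from_model:
  assumes A: "finite A" "A \<subseteq> univ M" and K: "is_struct (lang L rs M A) K" "countable (univ K)"
    and Th: "\<forall>p\<in>Th L M A. valid_in K p"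
  shows "\<exists>N. is_expansion L rs M N \<and> (\<forall>p\<in>sentences (lang L rs M A). valid_in (naming N) p = valid_in K p)"
proof -
  have sub: "sublang (lang L [] M A) (lang L rs M A)" by (rule sublang_old) simp
  have "is_model (lang L [] M A) (Th L M A) K"
    using Th is_struct_mono[OF sub _ K(1)] by (simp add: is_model_def)
  then obtain h where h: "isomorphism (lang L [] M A) h K (naming M)"
    using countable_model_isomorphic[OF A _ K(2)] by blast
  let ?g = "map (inv_into (univ K) h)"
  define N where "N = M\<lparr>
    fun_int := (\<lambda>f as. case f of New i \<Rightarrow> h (fun_int K f (?g as)) | _ \<Rightarrow> fun_int M f as),
    rel_int := (\<lambda>r as. case r of New i \<Rightarrow> rel_int K r (?g as) | _ \<Rightarrow> rel_int M r as)\<rparr>"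
  have bij: "bij_betw h (univ K) (univ M)" using isomorphismD(1)[OF h] by simp
  have inv: "?g (map h as) = as" if "as \<in> tuples K (univ K) ss" for as ss
  proof -
    have "set as \<subseteq> univ K" using that by (simp add: tuples_def)
    then show ?thesis using bij by (induction as) (auto simp: bij_betw_def)
  qed
  have iso: "isomorphism (lang L rs M A) h K (naming N)"
    unfolding isomorphism_def
  proof (intro conjI ballI allI impI)
    show "bij_betw h (univ K) (univ (naming N))" using bij by (simp add: N_def)
    show "sort_of (naming N) (h a) = sort_of K a" if "a \<in> univ K" for a
      using isomorphismD(2)[OF h that] by (simp add: N_def)
    show "h (fun_int K f as) = fun_int (naming N) f (map h as)"
      if f: "fun_ty (lang L rs M A) f = Some (ss, s)" and as: "as \<in> tuples K (univ K) ss" for f ss s as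
    proof (cases f)
      case (New i)
      then show ?thesis using inv[OF as] by (simp add: N_def del: map_map)
    next
      case (Old k)
      then show ?thesis using isomorphismD(3)[OF h _ as, of f s] f by (simp add: N_def)
    next
      case (Elem a)
      then show ?thesis using isomorphismD(3)[OF h _ as, of f s] f by (simp add: N_def)
    qed
    show "rel_int K r as = rel_int (naming N) r (map h as)"
      if r: "rel_ty (lang L rs M A) r = Some ss" and as: "as \<in> tuples K (univ K) ss" for r ss as
    proof (cases r)
      case (New i)
      then show ?thesis using inv[OF as] by (simp add: N_def del: map_map)
    next
      case (Old k)
      then show ?thesis using isomorphismD(4)[OF h _ as, of r] r by (simp add: N_def)
    qed (use r in simp)
  qed
  have "is_struct (lang L rs M {}) (naming N)"
    by (rule is_struct_mono[OF sublang_elem _ is_struct_iso[OF iso K(1)]]) auto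
  moreover have "isomorphism (lang L rs M {}) id (naming N) N"
  proof (rule isomorphism_idI)
    show "fun_int N f = fun_int (naming N) f" if "fun_ty (lang L rs M {}) f \<noteq> None" for f
      using that by (cases f) auto
  qed auto
  ultimately have "is_struct (lang L rs M {}) N" using is_struct_iso by blast
  then have "is_expansion L rs M N" by (auto simp: is_expansion_def N_def)
  then show ?thesis using valid_in_iso[OF iso K(1)] by blast
qed

end

section \<open>Diagrams and their theories\<close>

lemma countable_elementarily_equivalent:
  fixes K :: "('a :: infinite) struct"
  assumes "is_struct \<Sigma> K" "countable {p. wf_fm \<Sigma> p}" "countable (dom (fun_ty \<Sigma>))"
  shows "\<exists>N :: 'a struct. is_struct \<Sigma> N \<and> countable (univ N) \<and> (\<forall>p\<in>sentences \<Sigma>. valid_in N p = valid_in K p)"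
proof -
  have "countable {}" by simp
  from downward_loewenheim_skolem[OF prestructure_pre_of[OF assms(1)] assms(2,3) this]
  obtain C and e :: "'a \<Rightarrow> 'a" and N where N: "countable C" "is_struct \<Sigma> N" "univ N = e ` C"
    and sat: "\<forall>p v. wf_fm \<Sigma> p \<and> (\<forall>x\<in>free_vars p. v x \<in> C \<and> psort (pre_of K) (v x) = fst x) \<longrightarrow>
       sat N (\<lambda>y. e (v y)) p = psat (pre_of K) v p"
    by (elim exE conjE)
  have "valid_in N p = valid_in K p" if "p \<in> sentences \<Sigma>" for p
  proof -
    have p: "wf_fm \<Sigma> p" "free_vars p = {}" using that by (auto simp: sentences_def)
    then have "sat N (\<lambda>y. e (undefined y)) p = sat K undefined p" using sat by (auto simp: psat_pre_of)
    then show ?thesis using valid_in_iff[OF p(2)] by auto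
  qed
  then show ?thesis using N by (intro exI[of _ N]) simp
qed

lemma has_sort_csts:
  assumes "set as \<subseteq> A"
  shows "list_all2 (has_sort (lang L rs M A)) (map cst as) (map (sort_of M) as)"
proof -
  have "has_sort (lang L rs M A) (cst a) (sort_of M a)" if "a \<in> A" for a
    using that unfolding cst_def by (intro has_sort.intros(2)[of _ _ "[]"]) auto
  then show ?thesis using assms by (induction as) auto
qed

lemma tm_vars_cst [simp]: "tm_vars (cst a) = {}"
  by (simp add: cst_def)

lemma tm_val_cst [simp]: "tm_val (naming N) v (cst a) = a"
  by (simp add: cst_def)

lemma tm_val_csts [simp]: "map (tm_val (naming N) v) (map cst as) = as"
  by (induction as) auto

lemma diagram_sentences_wf:
  assumes D: "wf_diagram L rs M D"
  shows "diagram_sentences L rs M D \<subseteq> sentences (lang L rs M (set (Dom D)))"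
proof
  let ?\<Sigma> = "lang L rs M (set (Dom D))"
  have csts: "list_all2 (has_sort ?\<Sigma>) (map cst as) ss" if "as \<in> tuples M (set (Dom D)) ss" for as ss
    using that has_sort_csts[of as "set (Dom D)"] by (auto simp: tuples_def)
  have rel: "Rel (New i) (map cst as) \<in> sentences ?\<Sigma>"
    if "rel_ty (lang L rs M {}) (New i) = Some ss" "as \<in> tuples M (set (Dom D)) ss" for i as ss
    using csts[OF that(2)] that(1) by (auto simp: sentences_def lang_New_any)
  fix p assume "p \<in> diagram_sentences L rs M D"
  then consider (f) i as b where "p = Eq (Fn (New i) (map cst as)) (cst b)" "(as, b) \<in> dfun D i"
    | (r) i as where "p = Rel (New i) (map cst as)" "as \<in> drel D i"
    | (n) i as ss where "p = Neg (Rel (New i) (map cst as))"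
       "rel_ty (lang L rs M {}) (New i) = Some ss" "as \<in> tuples M (set (Dom D)) ss"
    unfolding diagram_sentences_def by blast
  then show "p \<in> sentences ?\<Sigma>"
  proof cases
    case f
    then obtain ss s where s: "fun_ty (lang L rs M {}) (New i) = Some (ss, s)" "as \<in> tuples M (set (Dom D)) ss"
      "b \<in> set (Dom D)" "sort_of M b = s"
      using D unfolding wf_diagram_def by blast
    have "fun_ty ?\<Sigma> (New i) = Some (ss, s)" using s(1) by (simp add: lang_New_any)
    then have "has_sort ?\<Sigma> (Fn (New i) (map cst as)) s" using csts[OF s(2)] by (rule has_sort.intros)
    moreover have "has_sort ?\<Sigma> (cst b) s" using has_sort_csts[of "[b]" "set (Dom D)"] s(3,4) by auto
    ultimately show ?thesis using f(1) by (auto simp: sentences_def)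
  next
    case r
    then show ?thesis using D rel unfolding wf_diagram_def by blast
  next
    case n
    then show ?thesis using rel[OF n(2,3)] by (simp add: sentences_def)
  qed
qed

lemma satisfies_diagram_iff:
  assumes D: "wf_diagram L rs M D"
  shows "satisfies_diagram L rs M D N \<longleftrightarrow> (\<forall>p\<in>diagram_sentences L rs M D. valid_in (naming N) p)"
proof -
  have eq: "valid_in (naming N) (Eq (Fn (New i) (map cst as)) (cst b)) \<longleftrightarrow> fun_int N (New i) as = b" for i as b
    by (simp add: valid_in_def del: map_map)
  have rel: "valid_in (naming N) (Rel (New i) (map cst as)) \<longleftrightarrow> rel_int N (New i) as" for i as
    by (simp add: valid_in_def del: map_map)
  have neg: "valid_in (naming N) (Neg (Rel (New i) (map cst as))) \<longleftrightarrow> \<not> rel_int N (New i) as" for i as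
    by (simp add: valid_in_def del: map_map)
  show ?thesis
  proof
    assume N: "satisfies_diagram L rs M D N"
    show "\<forall>p\<in>diagram_sentences L rs M D. valid_in (naming N) p"
    proof
      fix p assume "p \<in> diagram_sentences L rs M D"
      then consider (f) i as b where "p = Eq (Fn (New i) (map cst as)) (cst b)" "(as, b) \<in> dfun D i"
        | (r) i as where "p = Rel (New i) (map cst as)" "as \<in> drel D i"
        | (n) i as ss where "p = Neg (Rel (New i) (map cst as))"
           "rel_ty (lang L rs M {}) (New i) = Some ss" "as \<in> tuples M (set (Dom D)) ss" "as \<notin> drel D i"
        unfolding diagram_sentences_def by blast
      then show "valid_in (naming N) p"
      proof cases
        case f
        then show ?thesis using N unfolding satisfies_diagram_def by (simp only: eq)
      next
        case r
        then obtain ss where "rel_ty (lang L rs M {}) (New i) = Some ss" "as \<in> tuples M (set (Dom D)) ss"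
          using D unfolding wf_diagram_def by blast
        then show ?thesis using N r unfolding satisfies_diagram_def by (simp only: rel)
      next
        case n
        then show ?thesis using N unfolding satisfies_diagram_def n(1) neg by blast
      qed
    qed
  next
    assume p: "\<forall>p\<in>diagram_sentences L rs M D. valid_in (naming N) p"
    have "fun_int N (New i) as = b" if "(as, b) \<in> dfun D i" for i as b
      using bspec[OF p, of "Eq (Fn (New i) (map cst as)) (cst b)"] that
      unfolding eq diagram_sentences_def by blast
    moreover have "rel_int N (New i) as \<longleftrightarrow> as \<in> drel D i"
      if "rel_ty (lang L rs M {}) (New i) = Some ss" "as \<in> tuples M (set (Dom D)) ss" for i as ss
    proof (cases "as \<in> drel D i")
      case True
      then show ?thesis
        using bspec[OF p, of "Rel (New i) (map cst as)"] unfolding rel diagram_sentences_def by blast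
    next
      case False
      then show ?thesis
        using bspec[OF p, of "Neg (Rel (New i) (map cst as))"] that unfolding neg diagram_sentences_def by blast
    qed
    ultimately show "satisfies_diagram L rs M D N" unfolding satisfies_diagram_def by blast
  qed
qed

locale expansion_theory = omega_categorical_structure L M
  for L and M :: "('a :: infinite) struct" +
  fixes rs :: "new_sym list" and T :: "'a fm set"
  assumes T: "T \<subseteq> sentences (lang L rs M {})" "Th L M {} \<subseteq> T"
begin

lemma expansionD:
  assumes "is_expansion L rs M N"
  shows "is_struct (lang L rs M {}) N" "univ N = univ M" "sort_of N = sort_of M"
    "fun_int N (Old k) = fun_int M (Old k)" "tuples N A ss = tuples M A ss"
    "B \<subseteq> univ M \<Longrightarrow> is_struct (lang L rs M B) (naming N)"
  using assms is_struct_naming[of L rs M N B] by (auto simp: is_expansion_def tuples_def)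

lemma valid_Th_iff:
  assumes N: "is_expansion L rs M N" and p: "p \<in> sentences (lang L [] M A)" and A: "A \<subseteq> univ M"
  shows "valid_in (naming N) p \<longleftrightarrow> valid_in (naming M) p"
proof (rule valid_in_iso[OF isomorphism_idI is_struct_naming[OF struct A refl] p])
  show "fun_int (naming N) f = fun_int (naming M) f" if "fun_ty (lang L [] M A) f \<noteq> None" for f
    using that N by (cases f) (auto simp: is_expansion_def)
  show "rel_int (naming N) r = rel_int (naming M) r" if "rel_ty (lang L [] M A) r \<noteq> None" for r
    using that N by (cases r) (auto simp: is_expansion_def)
qed (use N in \<open>auto simp: is_expansion_def\<close>)

text \<open>Completeness relative to expansions of \<open>M\<close>.  A countermodel can be replaced by a countable one, and
  that is isomorphic over \<open>Dom D\<close> to an expansion of \<open>M\<close>.\<close>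

theorem diagram_theory_iff:
  assumes D: "wf_diagram L rs M D" and p: "p \<in> sentences (lang L rs M (set (Dom D)))"
  shows "p \<in> diagram_theory L rs M T D \<longleftrightarrow> (\<forall>N\<in>diagram_class L rs M T D. valid_in (naming N) p)"
proof -
  let ?A = "set (Dom D)" and ?\<Sigma> = "lang L rs M (set (Dom D))"
  let ?\<Gamma> = "diagram_sentences L rs M D \<union> T \<union> Th L M ?A"
  have A: "?A \<subseteq> univ M" using D by (simp add: wf_diagram_def)
  have sub: "sentences (lang L rs M {}) \<subseteq> sentences ?\<Sigma>" "sentences (lang L [] M ?A) \<subseteq> sentences ?\<Sigma>"
    by (rule sentences_mono, rule sublang_elem, simp, rule sentences_mono, rule sublang_old, simp)
  then have \<Gamma>: "?\<Gamma> \<subseteq> sentences ?\<Sigma>"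
    using diagram_sentences_wf[OF D] T(1) by (auto simp: Th_def)
  have "is_model ?\<Sigma> ?\<Gamma> (naming N)" if N: "N \<in> diagram_class L rs M T D" for N
  proof -
    have e: "is_expansion L rs M N" using N by (auto simp: diagram_class_def expansions_def)
    have "valid_in (naming N) q" if "q \<in> ?\<Gamma>" for q
      using that
    proof (elim UnE)
      assume "q \<in> diagram_sentences L rs M D"
      then show ?thesis using N satisfies_diagram_iff[OF D] by (auto simp: diagram_class_def)
    next
      assume "q \<in> T"
      then show ?thesis
        using N valid_in_naming[OF expansionD(1)[OF e]] T(1) by (auto simp: diagram_class_def expansions_def)
    next
      assume "q \<in> Th L M ?A"
      then show ?thesis using valid_Th_iff[OF e _ A] by (auto simp: Th_def)
    qed
    then show ?thesis using expansionD(6)[OF e A] by (simp add: is_model_def)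
  qed
  moreover have "\<exists>N\<in>diagram_class L rs M T D. \<not> valid_in (naming N) p"
    if K: "is_model ?\<Sigma> ?\<Gamma> K" "\<not> valid_in K p" for K
  proof -
    have Ks: "is_struct ?\<Sigma> K" using K(1) by (simp add: is_model_def)
    have c: "countable ?A" by (simp add: countable_finite)
    obtain K' where K': "is_struct ?\<Sigma> K'" "countable (univ K')" "\<forall>p\<in>sentences ?\<Sigma>. valid_in K' p = valid_in K p"
      using countable_elementarily_equivalent[OF Ks countable_wf_fm[OF c] countable_dom_fun_ty[OF c]] by blast
    have K'\<Gamma>: "valid_in K' q" if "q \<in> ?\<Gamma>" for q using that K' K(1) \<Gamma> unfolding is_model_def by blast
    obtain N where N: "is_expansion L rs M N" "\<forall>p\<in>sentences ?\<Sigma>. valid_in (naming N) p = valid_in K' p"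
      using expansion_from_model[OF _ A K'(1,2)] K'\<Gamma> by auto
    have N\<Gamma>: "valid_in (naming N) q" if "q \<in> ?\<Gamma>" for q using that N(2) K'\<Gamma> \<Gamma> by blast
    have "valid_in N q" if "q \<in> T" for q
      using N\<Gamma>[of q] that valid_in_naming[OF expansionD(1)[OF N(1)], of q] T(1) by blast
    moreover have "satisfies_diagram L rs M D N" using N\<Gamma> satisfies_diagram_iff[OF D] by blast
    ultimately have "N \<in> diagram_class L rs M T D" using N(1) by (simp add: diagram_class_def expansions_def)
    moreover have "\<not> valid_in (naming N) p" using N(2) K'(3) K(2) p by blast
    ultimately show ?thesis by blast
  qed
  ultimately show ?thesis using p unfolding diagram_theory_def consequences_def by blast
qed

text \<open>By completeness, implication between diagrams is inclusion of the classes of expansions.\<close>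

lemma extends_iff:
  assumes D: "wf_diagram L rs M D" and D': "wf_diagram L rs M D'"
  shows "extends L rs M T D' D \<longleftrightarrow> set (Dom D) \<subseteq> set (Dom D') \<and> (\<forall>i. dfun D i \<subseteq> dfun D' i) \<and>
    diagram_class L rs M T D' \<subseteq> diagram_class L rs M T D"
proof (cases "set (Dom D) \<subseteq> set (Dom D')")
  case True
  have "sentences (lang L rs M (set (Dom D))) \<subseteq> sentences (lang L rs M (set (Dom D')))"
    by (rule sentences_mono, rule sublang_elem[OF True])
  then have "diagram_sentences L rs M D \<subseteq> sentences (lang L rs M (set (Dom D')))"
    using diagram_sentences_wf[OF D] by blast
  then have "diagram_sentences L rs M D \<subseteq> diagram_theory L rs M T D' \<longleftrightarrow>
    (\<forall>N\<in>diagram_class L rs M T D'. \<forall>p\<in>diagram_sentences L rs M D. valid_in (naming N) p)"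
    using diagram_theory_iff[OF D'] by blast
  then show ?thesis
    unfolding extends_def satisfies_diagram_iff[OF D, symmetric] by (auto simp: diagram_class_def)
qed (simp add: extends_def)

text \<open>The largest diagram with domain \<open>A\<close> that \<open>N\<close> satisfies.\<close>

definition restrict_diagram :: "'a struct \<Rightarrow> 'a set \<Rightarrow> 'a diagram" where
  "restrict_diagram N A = \<lparr>
     Dom = (SOME as. distinct as \<and> set as = A),
     dfun = (\<lambda>i. {(as, b). \<exists>ss s. fun_ty (lang L rs M {}) (New i) = Some (ss, s) \<and> as \<in> tuples M A ss \<and>
        b \<in> A \<and> fun_int N (New i) as = b}),
     drel = (\<lambda>i. {as. \<exists>ss. rel_ty (lang L rs M {}) (New i) = Some ss \<and> as \<in> tuples M A ss \<and> rel_int N (New i) as})\<rparr>"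

lemma Dom_restrict:
  assumes "finite A"
  shows "set (Dom (restrict_diagram N A)) = A" "distinct (Dom (restrict_diagram N A))"
proof -
  have "\<exists>as. distinct as \<and> set as = A" using finite_distinct_list[OF assms] by blast
  from someI_ex[OF this]
  show "set (Dom (restrict_diagram N A)) = A" "distinct (Dom (restrict_diagram N A))"
    by (simp_all add: restrict_diagram_def)
qed

lemma wf_restrict:
  assumes N: "is_expansion L rs M N" and A: "finite A" "A \<subseteq> univ M"
  shows "wf_diagram L rs M (restrict_diagram N A)"
  unfolding wf_diagram_def Dom_restrict(1)[OF A(1)]
proof (intro conjI allI impI)
  show "single_valued (dfun (restrict_diagram N A) i)" for i
    by (auto simp: single_valued_def restrict_diagram_def)
  show "\<exists>ss s. fun_ty (lang L rs M {}) (New i) = Some (ss, s) \<and> as \<in> tuples M A ss \<and> b \<in> A \<and> sort_of M b = s"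
    if ab: "(as, b) \<in> dfun (restrict_diagram N A) i" for i as b
  proof -
    obtain ss s where s: "fun_ty (lang L rs M {}) (New i) = Some (ss, s)" "as \<in> tuples M A ss" "b \<in> A"
      "fun_int N (New i) as = b" using ab by (auto simp: restrict_diagram_def)
    have "as \<in> tuples N (univ N) ss" using s(2) A(2) expansionD[OF N] by (auto simp: tuples_def)
    then have "sort_of M b = s" using s expansionD[OF N] unfolding is_struct_def by metis
    then show ?thesis using s by blast
  qed
qed (use Dom_restrict A in \<open>auto simp: restrict_diagram_def\<close>)

lemma restrict_class:
  assumes "N \<in> expansions L rs M T" and A: "finite A" "A \<subseteq> univ M"
  shows "N \<in> diagram_class L rs M T (restrict_diagram N A)" "restrict_diagram N A \<in> B_T L rs M T"
proof -
  show "N \<in> diagram_class L rs M T (restrict_diagram N A)"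
    using assms(1) Dom_restrict(1)[OF A(1)]
    by (auto simp: diagram_class_def satisfies_diagram_def) (auto simp: restrict_diagram_def)
  then show "restrict_diagram N A \<in> B_T L rs M T"
    using wf_restrict[OF _ A] assms(1) by (auto simp: B_T_def expansions_def)
qed

lemma restrict_extends:
  assumes D: "wf_diagram L rs M D" and N: "N \<in> diagram_class L rs M T D" and A: "finite A" "A \<subseteq> univ M" "set (Dom D) \<subseteq> A"
  shows "extends L rs M T (restrict_diagram N A) D"
proof -
  have e: "is_expansion L rs M N" using N by (auto simp: diagram_class_def expansions_def)
  have tup: "as \<in> tuples M A ss" if "as \<in> tuples M (set (Dom D)) ss" for as ss
    using that A(3) by (auto simp: tuples_def)
  have sub: "dfun D i \<subseteq> dfun (restrict_diagram N A) i" for i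
  proof
    fix ab assume "ab \<in> dfun D i"
    then obtain as b where ab: "ab = (as, b)" "(as, b) \<in> dfun D i" by (cases ab) auto
    then obtain ss s where "fun_ty (lang L rs M {}) (New i) = Some (ss, s)" "as \<in> tuples M (set (Dom D)) ss"
      "b \<in> set (Dom D)" using D unfolding wf_diagram_def by blast
    moreover have "fun_int N (New i) as = b" using N ab by (auto simp: diagram_class_def satisfies_diagram_def)
    ultimately show "ab \<in> dfun (restrict_diagram N A) i" using ab(1) tup A(3) by (auto simp: restrict_diagram_def)
  qed
  have "N' \<in> diagram_class L rs M T D" if N': "N' \<in> diagram_class L rs M T (restrict_diagram N A)" for N'
  proof -
    have "rel_int N' (New i) as \<longleftrightarrow> as \<in> drel D i"
      if r: "rel_ty (lang L rs M {}) (New i) = Some ss" "as \<in> tuples M (set (Dom D)) ss" for i ss as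
    proof -
      have "rel_int N' (New i) as \<longleftrightarrow> as \<in> drel (restrict_diagram N A) i"
        using N' r tup Dom_restrict(1)[OF A(1)] by (auto simp: diagram_class_def satisfies_diagram_def)
      also have "\<dots> \<longleftrightarrow> rel_int N (New i) as" using r tup by (auto simp: restrict_diagram_def)
      also have "\<dots> \<longleftrightarrow> as \<in> drel D i" using N r by (auto simp: diagram_class_def satisfies_diagram_def)
      finally show ?thesis .
    qed
    moreover have "fun_int N' (New i) as = b" if "(as, b) \<in> dfun D i" for i as b
      using N' subsetD[OF sub that] by (simp add: diagram_class_def satisfies_diagram_def)
    ultimately show ?thesis using N' by (simp add: diagram_class_def satisfies_diagram_def)
  qed
  then show ?thesis
    using extends_iff[OF D wf_restrict[OF e A(1,2)]] sub A(3) Dom_restrict(1)[OF A(1)] by blast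
qed

end

section \<open>Amalgamation and atomic conditions\<close>

text \<open>The finitely many elements that are computed in evaluating a closed term.  A diagram on a set that
  contains them determines the value of the term, although it may leave functions undefined elsewhere.\<close>

fun subterm_values :: "'a struct \<Rightarrow> 'a tm \<Rightarrow> 'a set" where
  "subterm_values N (Var s n) = {}"
| "subterm_values N (Fn f ts) = insert (tm_val N undefined (Fn f ts)) (\<Union>t\<in>set ts. subterm_values N t)"

lemma finite_subterm_values: "finite (subterm_values N t)"
  by (induction t) auto

lemma subterm_values_self: "tm_vars t = {} \<Longrightarrow> tm_val N undefined t \<in> subterm_values N t"
  by (cases t) auto

lemma tm_val_closed:
  assumes "is_struct \<Sigma> N" "has_sort \<Sigma> t s" "tm_vars t = {}"
  shows "tm_val N v t \<in> univ N" "sort_of N (tm_val N v t) = s"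
  using tm_val_iso[OF isomorphism_idI assms(1,2), of N v] assms(3) by (auto simp: assigns_def)

lemma subterm_values_univ:
  assumes N: "is_struct \<Sigma> N"
  shows "has_sort \<Sigma> t s \<Longrightarrow> tm_vars t = {} \<Longrightarrow> subterm_values N t \<subseteq> univ N"
proof (induction rule: has_sort.induct)
  case (2 f ss s ts)
  have "has_sort \<Sigma> (Fn f ts) s"
    using 2(1,2) by (intro has_sort.intros) (auto elim!: list_all2_mono)
  then have "tm_val N undefined (Fn f ts) \<in> univ N" using tm_val_closed[OF N] 2(3) by blast
  moreover have "list_all2 (\<lambda>t s. subterm_values N t \<subseteq> univ N) ts ss"
    using 2(2) by (rule list.rel_mono_strong) (use 2(3) in auto)
  then have "\<forall>t\<in>set ts. subterm_values N t \<subseteq> univ N"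
    by (induction rule: list_all2_induct) auto
  ultimately show ?case by auto
qed simp

fun atom_values :: "'a struct \<Rightarrow> 'a fm \<Rightarrow> 'a set" where
  "atom_values N (Eq t u) = subterm_values N t \<union> subterm_values N u"
| "atom_values N (Rel r ts) = (\<Union>t\<in>set ts. subterm_values N t)"
| "atom_values N p = {}"

lemma finite_atom_values: "finite (atom_values N p)"
  by (cases p) (auto simp: finite_subterm_values)

definition atomic :: "'a fm \<Rightarrow> bool" where
  "atomic p \<longleftrightarrow> (\<exists>t u. p = Eq t u) \<or> (\<exists>i ts. p = Rel (New i) ts)"

lemma atom_values_univ:
  assumes N: "is_struct \<Sigma> N" and p: "p \<in> sentences \<Sigma>"
  shows "atom_values N p \<subseteq> univ N"
proof (cases p)
  case (Eq t u)
  then obtain s where "has_sort \<Sigma> t s" "has_sort \<Sigma> u s" "tm_vars t = {}" "tm_vars u = {}"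
    using p by (auto simp: sentences_def)
  then show ?thesis using Eq subterm_values_univ[OF N] by auto
next
  case (Rel r ts)
  then obtain ss where "list_all2 (has_sort \<Sigma>) ts ss" "\<forall>t\<in>set ts. tm_vars t = {}"
    using p by (auto simp: sentences_def)
  then have "\<forall>t\<in>set ts. subterm_values N t \<subseteq> univ N"
    using subterm_values_univ[OF N] by (induction rule: list_all2_induct) auto
  then show ?thesis using Rel by auto
qed auto

lemma map_diagram_id: "map_diagram id D = D"
proof -
  have "(\<lambda>(as, b). (map id as, id b)) = id" by (auto simp: fun_eq_iff)
  then show ?thesis by (simp add: map_diagram_def)
qed

context expansion_theory
begin

lemma automorphismD:
  assumes "automorphism L M \<alpha>"
  shows "inj_on \<alpha> (univ M)" "a \<in> univ M \<Longrightarrow> \<alpha> a \<in> univ M" "a \<in> univ M \<Longrightarrow> sort_of M (\<alpha> a) = sort_of M a"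
    "fun_ty L k = Some (ss, s) \<Longrightarrow> as \<in> tuples M (univ M) ss \<Longrightarrow>
      \<alpha> (fun_int M (Old k) as) = fun_int M (Old k) (map \<alpha> as)"
proof -
  have \<alpha>: "isomorphism (lang L [] M {}) \<alpha> M M" using assms by (simp add: automorphism_def)
  show "inj_on \<alpha> (univ M)" "a \<in> univ M \<Longrightarrow> \<alpha> a \<in> univ M" "a \<in> univ M \<Longrightarrow> sort_of M (\<alpha> a) = sort_of M a"
    using isomorphismD(1,2)[OF \<alpha>] by (auto simp: bij_betw_def)
  show "\<alpha> (fun_int M (Old k) as) = fun_int M (Old k) (map \<alpha> as)"
    if "fun_ty L k = Some (ss, s)" "as \<in> tuples M (univ M) ss"
    using isomorphismD(3)[OF \<alpha> _ that(2), of "Old k" s] that(1) by simp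
qed

lemma inj_map_automorphism:
  assumes "automorphism L M \<alpha>" "set as \<subseteq> univ M" "set bs \<subseteq> univ M"
  shows "map \<alpha> as = map \<alpha> bs \<longleftrightarrow> as = bs"
  using inj_on_map_eq_map[OF inj_on_subset[OF automorphismD(1)[OF assms(1)]], of as bs] assms(2,3) by auto

lemma tuples_automorphism:
  assumes "automorphism L M \<alpha>" "A \<subseteq> univ M" "as \<in> tuples M A ss"
  shows "map \<alpha> as \<in> tuples M (\<alpha> ` A) ss"
proof -
  have sub: "set as \<subseteq> A" using assms(3) by (simp add: tuples_def)
  then have "map (sort_of M) (map \<alpha> as) = map (sort_of M) as"
    using automorphismD(3)[OF assms(1)] subsetD[OF assms(2)] by auto
  then show ?thesis using assms(3) sub unfolding tuples_def by (auto simp del: map_map)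
qed

lemma wf_map_diagram:
  assumes \<alpha>: "automorphism L M \<alpha>" and D: "wf_diagram L rs M D"
  shows "wf_diagram L rs M (map_diagram \<alpha> D)"
proof -
  let ?A = "set (Dom D)"
  have A: "?A \<subseteq> univ M" "distinct (Dom D)" using D by (auto simp: wf_diagram_def)
  have f: "\<exists>ss s. fun_ty (lang L rs M {}) (New i) = Some (ss, s) \<and> as \<in> tuples M ?A ss \<and> b \<in> ?A \<and> sort_of M b = s"
    if "(as, b) \<in> dfun D i" for i as b
    using D that unfolding wf_diagram_def by blast
  have r: "\<exists>ss. rel_ty (lang L rs M {}) (New i) = Some ss \<and> as \<in> tuples M ?A ss" if "as \<in> drel D i" for i as
    using D that unfolding wf_diagram_def by blast
  have Dom: "Dom (map_diagram \<alpha> D) = map \<alpha> (Dom D)" by (simp add: map_diagram_def)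
  show ?thesis
    unfolding wf_diagram_def Dom set_map
  proof (intro conjI allI impI)
    show "distinct (map \<alpha> (Dom D))"
      using A inj_on_subset[OF automorphismD(1)[OF \<alpha>] A(1)] by (simp add: distinct_map)
    show "\<alpha> ` ?A \<subseteq> univ M" using A(1) automorphismD(2)[OF \<alpha>] by blast
    show "single_valued (dfun (map_diagram \<alpha> D) i)" for i
    proof (rule single_valuedI)
      fix cs b b' assume "(cs, b) \<in> dfun (map_diagram \<alpha> D) i" "(cs, b') \<in> dfun (map_diagram \<alpha> D) i"
      then obtain as as' c c' where c: "(as, c) \<in> dfun D i" "(as', c') \<in> dfun D i" "b = \<alpha> c" "b' = \<alpha> c'"
        "map \<alpha> as = map \<alpha> as'"
        by (auto simp: map_diagram_def)
      have "set as \<subseteq> univ M" "set as' \<subseteq> univ M" using f[OF c(1)] f[OF c(2)] A(1) by (auto simp: tuples_def)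
      then have "as = as'" using inj_map_automorphism[OF \<alpha>] c(5) by blast
      moreover have "single_valued (dfun D i)" using D by (simp add: wf_diagram_def)
      ultimately show "b = b'" using c by (auto dest: single_valuedD)
    qed
    show "\<exists>ss s. fun_ty (lang L rs M {}) (New i) = Some (ss, s) \<and> cs \<in> tuples M (\<alpha> ` ?A) ss \<and> d \<in> \<alpha> ` ?A \<and> sort_of M d = s"
      if cs: "(cs, d) \<in> dfun (map_diagram \<alpha> D) i" for i cs d
    proof -
      obtain as b where ab: "(as, b) \<in> dfun D i" "cs = map \<alpha> as" "d = \<alpha> b"
        using cs by (auto simp: map_diagram_def)
      obtain ss s where s: "fun_ty (lang L rs M {}) (New i) = Some (ss, s)" "as \<in> tuples M ?A ss" "b \<in> ?A" "sort_of M b = s"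
        using f[OF ab(1)] by blast
      have "sort_of M d = s" using automorphismD(3)[OF \<alpha>] s(3,4) A(1) ab(3) by auto
      then show ?thesis using tuples_automorphism[OF \<alpha> A(1) s(2)] s ab by blast
    qed
    show "\<exists>ss. rel_ty (lang L rs M {}) (New i) = Some ss \<and> cs \<in> tuples M (\<alpha> ` ?A) ss"
      if cs: "cs \<in> drel (map_diagram \<alpha> D) i" for i cs
    proof -
      obtain as where as: "as \<in> drel D i" "cs = map \<alpha> as" using cs by (auto simp: map_diagram_def)
      then show ?thesis using r[OF as(1)] tuples_automorphism[OF \<alpha> A(1)] by blast
    qed
  qed
qed

text \<open>If \<open>N'\<close> satisfies the \<open>\<alpha>\<close>-image of a diagram of \<open>N\<close>, evaluation of a closed term in \<open>N'\<close> follows the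
  \<open>\<alpha>\<close>-image of the evaluation in \<open>N\<close>: a step with a symbol of \<open>L\<close> is respected by the automorphism,
  a step with an additional symbol is recorded in the diagram, and \<open>\<alpha>\<close> fixes the constants.\<close>

lemma restrict_term:
  assumes \<alpha>: "automorphism L M \<alpha>" "\<forall>a\<in>E. \<alpha> a = a" and E: "E \<subseteq> univ M"
    and N: "is_expansion L rs M N" and N': "is_expansion L rs M N'" and A: "finite A" "A \<subseteq> univ M"
    and sat: "satisfies_diagram L rs M (map_diagram \<alpha> (restrict_diagram N A)) N'"
  shows "has_sort (lang L rs M E) t s \<Longrightarrow> tm_vars t = {} \<Longrightarrow> subterm_values (naming N) t \<subseteq> A \<Longrightarrow>
    tm_val (naming N') undefined t = \<alpha> (tm_val (naming N) undefined t)"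
proof (induction rule: has_sort.induct)
  case (2 f ss s ts)
  let ?v = "tm_val (naming N) undefined"
  have NE: "is_struct (lang L rs M E) (naming N)" by (rule expansionD(6)[OF N E])
  have *: "list_all2 (\<lambda>t s. ?v t \<in> A \<and> sort_of M (?v t) = s \<and> tm_val (naming N') undefined t = \<alpha> (?v t)) ts ss"
    using 2(2)
  proof (rule list.rel_mono_strong)
    fix t s assume "t \<in> set ts" and t: "has_sort (lang L rs M E) t s \<and> (tm_vars t = {} \<longrightarrow> subterm_values (naming N) t \<subseteq> A \<longrightarrow>
      tm_val (naming N') undefined t = \<alpha> (?v t))"
    then have c: "tm_vars t = {}" and v: "subterm_values (naming N) t \<subseteq> A" using 2(3,4) by auto
    have "?v t \<in> A" using subterm_values_self[OF c] v by blast
    then show "?v t \<in> A \<and> sort_of M (?v t) = s \<and> tm_val (naming N') undefined t = \<alpha> (?v t)"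
      using t c v tm_val_closed(2)[OF NE _ c, of s undefined] expansionD(3)[OF N] by auto
  qed
  let ?as = "map ?v ts"
  note l = list_all2_mapD[OF *]
  have as: "?as \<in> tuples M A ss" using l(1,2) by (simp add: tuples_def)
  then have asU: "?as \<in> tuples M (univ M) ss" using A(2) by (auto simp: tuples_def)
  have b: "fun_int (naming N) f ?as \<in> A" using 2(4) by simp
  have "fun_int (naming N') f (map \<alpha> ?as) = \<alpha> (fun_int (naming N) f ?as)"
  proof (cases f)
    case (Old k)
    then show ?thesis
      using automorphismD(4)[OF \<alpha>(1) _ asU, of k s] 2(1) expansionD(4)[OF N] expansionD(4)[OF N'] by simp
  next
    case (New i)
    then have "(?as, fun_int N f ?as) \<in> dfun (restrict_diagram N A) i"
      using 2(1) as b by (auto simp: restrict_diagram_def lang_New_any)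
    then have "(map \<alpha> ?as, \<alpha> (fun_int N f ?as)) \<in> dfun (map_diagram \<alpha> (restrict_diagram N A)) i"
      by (force simp: map_diagram_def)
    then show ?thesis using sat New unfolding satisfies_diagram_def by simp
  next
    case (Elem a)
    then show ?thesis using \<alpha>(2) 2(1) by (auto split: if_splits)
  qed
  then show ?case using l(3) by (simp del: map_map)
qed simp

text \<open>The truth value of an atomic sentence is transported in the same way; injectivity of \<open>\<alpha>\<close> is needed
  for equations and for the negative part of the diagram.\<close>

lemma restrict_atom:
  assumes \<alpha>: "automorphism L M \<alpha>" "\<forall>a\<in>E. \<alpha> a = a" and E: "E \<subseteq> univ M"
    and N: "is_expansion L rs M N" and N': "is_expansion L rs M N'" and A: "finite A" "A \<subseteq> univ M"
    and sat: "satisfies_diagram L rs M (map_diagram \<alpha> (restrict_diagram N A)) N'"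
    and p: "p \<in> sentences (lang L rs M E)" "atomic p" "atom_values (naming N) p \<subseteq> A"
  shows "valid_in (naming N') p \<longleftrightarrow> valid_in (naming N) p"
proof -
  note tm = restrict_term[OF \<alpha> E N N' A sat]
  have NE: "is_struct (lang L rs M E) (naming N)" by (rule expansionD(6)[OF N E])
  have fv: "free_vars p = {}" and wf: "wf_fm (lang L rs M E) p" using p(1) by (auto simp: sentences_def)
  let ?v = "tm_val (naming N) undefined" and ?v' = "tm_val (naming N') undefined"
  from p(2) consider (eq) t u where "p = Eq t u" | (rel) i ts where "p = Rel (New i) ts" by (auto simp: atomic_def)
  then have "sat (naming N') undefined p \<longleftrightarrow> sat (naming N) undefined p"
  proof cases
    case eq
    then obtain s where s: "has_sort (lang L rs M E) t s" "has_sort (lang L rs M E) u s" using wf by auto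
    have c: "tm_vars t = {}" "tm_vars u = {}" using fv eq by auto
    have "?v' t = \<alpha> (?v t)" "?v' u = \<alpha> (?v u)" using tm[OF s(1) c(1)] tm[OF s(2) c(2)] p(3) eq by auto
    moreover have "?v t \<in> univ M" "?v u \<in> univ M"
      using tm_val_closed(1)[OF NE s(1) c(1)] tm_val_closed(1)[OF NE s(2) c(2)] expansionD(2)[OF N] by auto
    ultimately show ?thesis
      using inj_on_eq_iff[OF automorphismD(1)[OF \<alpha>(1)], of "?v t" "?v u"] eq by simp
  next
    case rel
    then obtain ss where ss: "rel_ty (lang L rs M {}) (New i) = Some ss" "list_all2 (has_sort (lang L rs M E)) ts ss"
      using wf by (auto simp: lang_New_any)
    have *: "list_all2 (\<lambda>t s. ?v t \<in> A \<and> sort_of M (?v t) = s \<and> ?v' t = \<alpha> (?v t)) ts ss"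
      using ss(2)
    proof (rule list.rel_mono_strong)
      fix t s assume t: "t \<in> set ts" "has_sort (lang L rs M E) t s"
      then have c: "tm_vars t = {}" and v: "subterm_values (naming N) t \<subseteq> A" using fv p(3) rel by auto
      have "?v t \<in> A" using subterm_values_self[OF c] v by blast
      then show "?v t \<in> A \<and> sort_of M (?v t) = s \<and> ?v' t = \<alpha> (?v t)"
        using tm[OF t(2) c v] tm_val_closed(2)[OF NE t(2) c] expansionD(3)[OF N] by auto
    qed
    let ?as = "map ?v ts"
    note l = list_all2_mapD[OF *]
    have as: "?as \<in> tuples M A ss" using l(1,2) by (simp add: tuples_def)
    have as': "map \<alpha> ?as \<in> tuples M (\<alpha> ` A) ss" by (rule tuples_automorphism[OF \<alpha>(1) A(2) as])
    have "set (Dom (map_diagram \<alpha> (restrict_diagram N A))) = \<alpha> ` A"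
      using Dom_restrict(1)[OF A(1)] by (simp add: map_diagram_def)
    then have "rel_int N' (New i) (map \<alpha> ?as) \<longleftrightarrow> map \<alpha> ?as \<in> drel (map_diagram \<alpha> (restrict_diagram N A)) i"
      using sat ss(1) as' unfolding satisfies_diagram_def by metis
    also have "\<dots> \<longleftrightarrow> (\<exists>bs\<in>drel (restrict_diagram N A) i. map \<alpha> ?as = map \<alpha> bs)"
      by (auto simp: map_diagram_def image_iff)
    also have "\<dots> \<longleftrightarrow> ?as \<in> drel (restrict_diagram N A) i"
    proof -
      have "set bs \<subseteq> univ M" if "bs \<in> drel (restrict_diagram N A) i" for bs
        using that A(2) by (auto simp: restrict_diagram_def tuples_def)
      moreover have "set ?as \<subseteq> univ M" using l(1) A(2) by blast
      ultimately show ?thesis using inj_map_automorphism[OF \<alpha>(1)] by blast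
    qed
    also have "\<dots> \<longleftrightarrow> rel_int N (New i) ?as" using ss(1) as by (auto simp: restrict_diagram_def)
    finally show ?thesis using l(3) rel by (simp del: map_map)
  qed
  then show ?thesis using valid_in_iff[OF fv] by blast
qed

lemma automorphism_id: "automorphism L M id"
  unfolding automorphism_def by (rule isomorphism_idI) auto

text \<open>Diagrams of \<open>N1\<close> and \<open>N2\<close> on domains large enough to evaluate \<open>p\<close> both extend \<open>D'\<close>.  An expansion that
  satisfies an amalgam of them agrees on \<open>p\<close> with \<open>N1\<close>, and also with \<open>N2\<close> because the amalgamating
  automorphism fixes the constants of \<open>p\<close>.\<close>

theorem weak_amalgamation_atom:
  assumes D: "wf_diagram L rs M D" and wab: "weak_amalgamation_base L rs M T D D'"
    and N1: "N1 \<in> diagram_class L rs M T D'" and N2: "N2 \<in> diagram_class L rs M T D'"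
    and p: "p \<in> sentences (lang L rs M (set (Dom D)))" "atomic p"
  shows "valid_in (naming N1) p \<longleftrightarrow> valid_in (naming N2) p"
proof -
  have D': "wf_diagram L rs M D'" using wab by (auto simp: weak_amalgamation_base_def B_T_def)
  have ex: "N1 \<in> expansions L rs M T" "N2 \<in> expansions L rs M T" using N1 N2 by (auto simp: diagram_class_def)
  then have e: "is_expansion L rs M N1" "is_expansion L rs M N2" by (auto simp: expansions_def)
  have U: "set (Dom D) \<subseteq> univ M" "set (Dom D') \<subseteq> univ M" using D D' by (auto simp: wf_diagram_def)
  define A where "A N = set (Dom D') \<union> atom_values (naming N) p" for N
  have A: "finite (A N)" "set (Dom D') \<subseteq> A N" "atom_values (naming N) p \<subseteq> A N" for N
    by (auto simp: A_def finite_atom_values)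
  have AU: "A N \<subseteq> univ M" if "is_expansion L rs M N" for N
    using atom_values_univ[OF expansionD(6)[OF that U(1)] p(1)] U expansionD(2)[OF that] by (auto simp: A_def)
  let ?D1 = "restrict_diagram N1 (A N1)" and ?D2 = "restrict_diagram N2 (A N2)"
  have "?D1 \<in> B_T L rs M T" "?D2 \<in> B_T L rs M T"
    by (rule restrict_class(2)[OF ex(1) A(1) AU[OF e(1)]], rule restrict_class(2)[OF ex(2) A(1) AU[OF e(2)]])
  moreover have "extends L rs M T ?D1 D'" "extends L rs M T ?D2 D'"
    by (rule restrict_extends[OF D' N1 A(1) AU[OF e(1)] A(2)], rule restrict_extends[OF D' N2 A(1) AU[OF e(2)] A(2)])
  ultimately obtain D3 \<alpha> where D3: "D3 \<in> B_T L rs M T" and \<alpha>: "automorphism L M \<alpha>" "\<forall>a\<in>set (Dom D). \<alpha> a = a"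
    and ext: "extends L rs M T D3 ?D1" "extends L rs M T D3 (map_diagram \<alpha> ?D2)"
    using wab unfolding weak_amalgamation_base_def by blast
  obtain N3 where N3: "N3 \<in> diagram_class L rs M T D3" using D3 by (auto simp: B_T_def)
  then have e3: "is_expansion L rs M N3" by (auto simp: diagram_class_def expansions_def)
  have wf: "wf_diagram L rs M ?D1" "wf_diagram L rs M ?D2" "wf_diagram L rs M D3"
    using wf_restrict[OF e(1) A(1) AU[OF e(1)]] wf_restrict[OF e(2) A(1) AU[OF e(2)]] D3 by (auto simp: B_T_def)
  have "satisfies_diagram L rs M ?D1 N3"
    using ext(1) extends_iff[OF wf(1,3)] N3 by (auto simp: diagram_class_def)
  then have "valid_in (naming N3) p \<longleftrightarrow> valid_in (naming N1) p"
    using restrict_atom[OF automorphism_id _ U(1) e(1) e3 A(1) AU[OF e(1)] _ p A(3)] by (simp add: map_diagram_id)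
  moreover have "satisfies_diagram L rs M (map_diagram \<alpha> ?D2) N3"
    using ext(2) extends_iff[OF wf_map_diagram[OF \<alpha>(1) wf(2)] wf(3)] N3 by (auto simp: diagram_class_def)
  then have "valid_in (naming N3) p \<longleftrightarrow> valid_in (naming N2) p"
    using restrict_atom[OF \<alpha> U(1) e(2) e3 A(1) AU[OF e(2)] _ p A(3)] by simp
  ultimately show ?thesis by simp
qed

end

section \<open>Deciding by enumeration\<close>

inductive_cases computes_elims:
  "computes Zero xs y" "computes Succ xs y" "computes (Proj i) xs y" "computes (Comp f gs) xs y"
  "computes (PrimRec f g) (0 # xs) y" "computes (PrimRec f g) (Suc n # xs) y" "computes (Mu f) xs y"

lemma computes_functional:
  "computes r xs y \<Longrightarrow> computes r xs z \<Longrightarrow> y = z"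
proof (induction arbitrary: z rule: computes.induct)
  case (1 xs)
  then show ?case by (auto elim: computes_elims)
next
  case (2 x xs)
  then show ?case by (auto elim: computes_elims)
next
  case (3 i xs)
  then show ?case by (auto elim: computes_elims)
next
  case (4 xs gs ys f z')
  from "4.prems" obtain us where us: "list_all2 (\<lambda>g y. computes g xs y) gs us" "computes f us z"
    by (rule computes_elims(4))
  have "ys = us"
    using "4.IH"(1) us(1)
  proof (induction arbitrary: us rule: list_all2_induct)
    case (Cons g gs y ys)
    then show ?case by (auto simp: list_all2_Cons1)
  qed simp
  then show ?case using "4.IH"(2) us(2) by blast
next
  case (5 f xs y g)
  from "5.prems" have "computes f xs z" by (rule computes_elims(5))
  then show ?case by (rule "5.IH")
next
  case (6 f g n xs y z')
  from "6.prems" obtain u where "computes (PrimRec f g) (n # xs) u" "computes g (n # u # xs) z"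
    by (rule computes_elims(6))
  then show ?case using "6.IH" by blast
next
  case (7 f n xs)
  from "7.prems" have z: "computes f (z # xs) 0" "\<And>m. m < z \<Longrightarrow> \<exists>y. computes f (m # xs) (Suc y)"
    by (auto elim: computes_elims(7))
  have "\<not> z < n" using "7.IH"(2)[of z] z(1) by fastforce
  moreover have "\<not> n < z" using "7.IH"(1) z(2)[of n] by fastforce
  ultimately show ?case by simp
qed

lemma partial_computableI: "partial_computable (\<lambda>x. if \<exists>y. computes r [x] y then Some (THE y. computes r [x] y) else None)"
  unfolding partial_computable_def
proof (intro exI[of _ r] allI)
  fix x y
  have "(THE y. computes r [x] y) = y" if "computes r [x] y" for y
    by (rule the_equality) (use that computes_functional in auto)
  then show "(if \<exists>y. computes r [x] y then Some (THE y. computes r [x] y) else None) = Some y \<longleftrightarrow> computes r [x] y"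
    by auto
qed

lemma computes_Comp1: "computes g xs y \<Longrightarrow> computes f [y] z \<Longrightarrow> computes (Comp f [g]) xs z"
  by (rule computes.intros(4)[of _ _ "[y]"]) auto

lemma computes_Comp2:
  "computes g xs y \<Longrightarrow> computes h xs y' \<Longrightarrow> computes f [y, y'] z \<Longrightarrow> computes (Comp f [g, h]) xs z"
  by (rule computes.intros(4)[of _ _ "[y, y']"]) auto

lemma computes_Proj: "i < length xs \<Longrightarrow> xs ! i = y \<Longrightarrow> computes (Proj i) xs y"
  using computes.intros(3) by blast

text \<open>Primitive recursion runs over the first argument, so \<open>r_monus\<close> subtracts its first argument from its
  second.\<close>

definition r_add where "r_add = PrimRec (Proj 0) (Comp Succ [Proj 1])"
definition r_pred where "r_pred = PrimRec Zero (Proj 0)"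
definition r_monus where "r_monus = PrimRec (Proj 0) (Comp r_pred [Proj 1])"
definition r_mult where "r_mult = PrimRec Zero (Comp r_add [Proj 1, Proj 2])"
definition r_dist where "r_dist = Comp r_add [r_monus, Comp r_monus [Proj 1, Proj 0]]"
definition r_one where "r_one = Comp Succ [Zero]"

lemma computes_add: "computes r_add [m, n] (m + n)"
  unfolding r_add_def
  by (induction m) (auto intro!: computes.intros(5,6,2) computes_Comp1 computes_Proj)

lemma computes_pred: "computes r_pred [n] (n - 1)"
  unfolding r_pred_def
proof (induction n)
  case (Suc n)
  show ?case by (rule computes.intros(6)[OF Suc computes_Proj]) auto
qed (auto intro!: computes.intros(5,1))

lemma computes_monus: "computes r_monus [m, n] (n - m)"
  unfolding r_monus_def
proof (induction m)
  case (Suc m)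
  have "computes (Comp r_pred [Proj 1]) [m, n - m, n] (n - m - 1)"
    by (rule computes_Comp1[OF computes_Proj computes_pred]) auto
  then show ?case using computes.intros(6)[OF Suc] by simp
qed (auto intro!: computes.intros(5) computes_Proj)

lemma computes_mult: "computes r_mult [m, n] (m * n)"
  unfolding r_mult_def
proof (induction m)
  case (Suc m)
  have "computes (Comp r_add [Proj 1, Proj 2]) [m, m * n, n] (m * n + n)"
    by (rule computes_Comp2[OF computes_Proj computes_Proj computes_add]) auto
  then show ?case using computes.intros(6)[OF Suc] by (simp add: add.commute)
qed (auto intro!: computes.intros(5,1))

lemma computes_dist: "computes r_dist [m, n] ((n - m) + (m - n))"
  unfolding r_dist_def
  by (rule computes_Comp2[OF computes_monus computes_Comp2[OF computes_Proj computes_Proj computes_monus] computes_add])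
    auto

lemma computes_one: "computes r_one xs 1"
  unfolding r_one_def using computes_Comp1[OF computes.intros(1) computes.intros(2)] by simp

text \<open>The code of a negation from the code of the formula, that is \<open>\<lambda>n. prod_encode (3, n)\<close>.  By the
  triangular numbers in the pairing function, its value at \<open>0\<close> is \<open>9\<close>, and the increment from \<open>n\<close> to
  \<open>n + 1\<close> is \<open>n + 4\<close>.\<close>

definition r_neg where
  "r_neg = PrimRec (Comp r_add [Comp Succ [Comp Succ [Comp Succ [Comp Succ [r_one]]]], Comp Succ [Comp Succ [Comp Succ [r_one]]]])
     (Comp Succ [Comp Succ [Comp Succ [Comp Succ [Comp r_add [Proj 0, Proj 1]]]]])"

lemma computes_neg: "computes r_neg [n] (prod_encode (3, n))"
  unfolding r_neg_def
proof (induction n)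
  case 0
  have *: "Suc (Suc (Suc (Suc 1))) + Suc (Suc (Suc 1)) = prod_encode (3, 0)"
    by (simp add: prod_encode_def triangle_def)
  show ?case
    by (rule computes.intros(5), subst *[symmetric])
      (intro computes_Comp2[OF _ _ computes_add] computes_Comp1[OF _ computes.intros(2)] computes_one)
next
  case (Suc n)
  have *: "prod_encode (3, Suc n) = Suc (Suc (Suc (Suc (n + prod_encode (3, n)))))"
    using triangle_Suc[of "3 + n"] by (simp add: prod_encode_def)
  show ?case
    by (rule computes.intros(6)[OF Suc], subst *)
      (intro computes_Comp2[OF _ _ computes_add] computes_Comp1[OF _ computes.intros(2)] computes_Proj; simp)
qed

text \<open>With \<open>W\<close> enumerated by \<open>f\<close>, search for the least \<open>m\<close> such that \<open>f m\<close> is \<open>n\<close> or the code of its negation,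
  and answer according to which of the two it is.  On \<open>C\<close> the search ends, and only the right one
  of the two can be found.\<close>

lemma decidable_among_if_enumerable:
  assumes W: "comp_enumerable W"
    and pos: "\<And>n. n \<in> C \<Longrightarrow> n \<in> S \<longleftrightarrow> n \<in> W" and neg: "\<And>n. n \<in> C \<Longrightarrow> n \<notin> S \<longleftrightarrow> prod_encode (3, n) \<in> W"
  shows "decidable_among C S"
proof (cases "W = {}")
  case True
  then have "C = {}" using pos neg by auto
  moreover have "\<exists>f. partial_computable f" using partial_computableI by blast
  ultimately show ?thesis by (auto simp: decidable_among_def)
next
  case False
  then obtain f where "computable f" and W: "W = range f" using W by (auto simp: comp_enumerable_def)
  then obtain r where r: "\<And>x. computes r [x] (f x)"
    by (auto simp: computable_def partial_computable_def)
  \<comment> \<open>\<open>t\<close> vanishes at \<open>(m, n)\<close> iff \<open>f m\<close> is \<open>n\<close> or \<open>prod_encode (3, n)\<close>, since \<open>d\<close> is the distance\<close>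
  define t where "t = Comp r_mult [Comp r_dist [Comp r [Proj 0], Proj 1], Comp r_dist [Comp r [Proj 0], Comp r_neg [Proj 1]]]"
  define d where "d = (\<lambda>m n :: nat. (n - m) + (m - n))"
  have d0: "d m n = 0 \<longleftrightarrow> m = n" for m n by (auto simp: d_def)
  have t: "computes t [m, n] (d (f m) n * d (f m) (prod_encode (3, n)))" for m n
    unfolding t_def d_def
    by (rule computes_Comp2[OF computes_Comp2[OF computes_Comp1[OF computes_Proj r] computes_Proj computes_dist]
        computes_Comp2[OF computes_Comp1[OF computes_Proj r] computes_Comp1[OF computes_Proj computes_neg] computes_dist]
        computes_mult]) auto
  \<comment> \<open>the answer is \<open>1\<close> minus the distance of \<open>f m\<close> and \<open>n\<close>, cut off at \<open>0\<close>\<close>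
  define q where "q = Comp r_monus [Comp r_dist [Comp r [Mu t], Proj 0], r_one]"
  have q: "computes q [n] (if n \<in> S then 1 else 0)" if n: "n \<in> C" for n
  proof -
    define m where "m = (LEAST m. f m = n \<or> f m = prod_encode (3, n))"
    have "\<exists>m. f m = n \<or> f m = prod_encode (3, n)" using pos[OF n] neg[OF n] unfolding W by (metis rangeE)
    then have m: "f m = n \<or> f m = prod_encode (3, n)" unfolding m_def by (rule LeastI_ex)
    have less: "f k \<noteq> n \<and> f k \<noteq> prod_encode (3, n)" if "k < m" for k
      using not_less_Least[OF that[unfolded m_def]] by simp
    have "computes (Mu t) [n] m"
    proof (rule computes.intros(7))
      have "d (f m) n * d (f m) (prod_encode (3, n)) = 0" using m by (simp add: d0)
      then show "computes t [m, n] 0" using t[of m n] by (simp only:)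
      show "\<exists>y. computes t [k, n] (Suc y)" if "k < m" for k
      proof -
        have "d (f k) n * d (f k) (prod_encode (3, n)) \<noteq> 0" using less[OF that] d0 by simp
        then obtain y where "d (f k) n * d (f k) (prod_encode (3, n)) = Suc y" using not0_implies_Suc by blast
        then show ?thesis using t[of k n] by metis
      qed
    qed
    then have "computes q [n] (1 - d (f m) n)"
      unfolding q_def d_def
      by (intro computes_Comp2[OF computes_Comp2[OF computes_Comp1[OF _ r] computes_Proj computes_dist] computes_one computes_monus]) auto
    moreover have "f m = n \<longleftrightarrow> n \<in> S"
      using m pos[OF n] neg[OF n] unfolding W by (metis rangeI)
    ultimately show ?thesis using d0[of "f m" n] by (cases "n \<in> S") auto
  qed
  show ?thesis
    unfolding decidable_among_def
  proof (intro exI conjI ballI)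
    fix n assume "n \<in> C"
    then have "(THE y. computes q [n] y) = (if n \<in> S then 1 else 0)"
      using q computes_functional by (intro the_equality) auto
    then show "(if \<exists>y. computes q [n] y then Some (THE y. computes q [n] y) else None) = Some (if n \<in> S then 1 else 0)"
      using q[OF \<open>n \<in> C\<close>] by auto
  qed (rule partial_computableI)
qed

theorem theorem3p2:
  fixes L :: "nat sig" and Gp :: nat and rs :: "new_sym list"
    and M :: "('a :: infinite) struct" and T :: "'a fm set" and D :: "'a diagram"
  assumes "wf_sig L" and "Gp \<in> sorts L"
    and "\<forall>r\<in>set rs. wf_new_sym L r"
    and "is_struct (lang L [] M {}) M" and "countable (univ M)"
    and "omega_categorical (lang L [] M {}) (Th L M {})"
    and "admissible_theory L rs M T"
    and "D \<in> B_T L rs M T"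
    and distinguished: "\<forall>k s. fun_ty L k = Some ([], s) \<longrightarrow> fun_int M (Old k) [] \<in> set (Dom D)"
    and enumerable: "\<forall>D'\<in>B_T L rs M T. extends L rs M T D' D \<longrightarrow>
          comp_enumerable (code M ` diagram_theory L rs M T D')"
    and undecidable: "\<forall>N\<in>diagram_class L rs M T D.
          Xi_undecidable L rs M [c \<leftarrow> Dom D. sort_of M c = Gp] N"
  shows "\<not> (\<exists>D'. weak_amalgamation_base L rs M T D D')"
proof
  assume "\<exists>D'. weak_amalgamation_base L rs M T D D'"
  then obtain D' where wab: "weak_amalgamation_base L rs M T D D'" ..
  interpret expansion_theory L M rs T
    by unfold_locales (use assms(4-7) in \<open>auto simp: admissible_theory_def\<close>)
  define es where "es = [c \<leftarrow> Dom D. sort_of M c = Gp]"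
  have D': "D' \<in> B_T L rs M T" and ext: "extends L rs M T D' D"
    using wab by (auto simp: weak_amalgamation_base_def)
  have wf: "wf_diagram L rs M D" "wf_diagram L rs M D'" using D' assms(8) by (auto simp: B_T_def)
  obtain N where N: "N \<in> diagram_class L rs M T D'" using D' by (auto simp: B_T_def)
  have sub: "set (Dom D) \<subseteq> set (Dom D')" and "N \<in> diagram_class L rs M T D"
    using ext N extends_iff[OF wf] by auto
  let ?S = "sentences (lang L rs M (set (Dom D')))"
  have sent: "sentences (lang L rs M (set es)) \<subseteq> sentences (lang L rs M (set (Dom D)))"
    "sentences (lang L rs M (set (Dom D))) \<subseteq> ?S"
    by (rule sentences_mono, rule sublang_elem, force simp: es_def,
        rule sentences_mono, rule sublang_elem, rule sub)
  have "?S \<subseteq> sentences (lang L rs M (univ M))"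
    by (rule sentences_mono, rule sublang_elem) (use wf(2) in \<open>simp add: wf_diagram_def\<close>)
  then have S: "?S \<subseteq> {p. wf_fm (lang L rs M (univ M)) p}"
    by (auto simp: sentences_def)
  have "inj_on (code M) ?S"
    unfolding code_def by (rule inj_on_subset[OF code_inj[OF assms(5)] S])
  note code_image_iff = inj_on_image_mem_iff[OF this]
  have th: "diagram_theory L rs M T D' \<subseteq> ?S" by (auto simp: diagram_theory_def consequences_def)
  have cond: "conditions L rs M es \<subseteq> ?S" using sent unfolding conditions_def by blast
  have agree: "valid_in (naming N1) p \<longleftrightarrow> valid_in (naming N) p"
    if p: "p \<in> conditions L rs M es" and N1: "N1 \<in> diagram_class L rs M T D'" for p N1
  proof -
    have at: "valid_in (naming N1) q \<longleftrightarrow> valid_in (naming N) q"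
      if "q \<in> sentences (lang L rs M (set es))" "atomic q" for q
      using weak_amalgamation_atom[OF wf(1) wab N1 N _ that(2)] that(1) sent(1) by blast
    consider "p \<in> sentences (lang L rs M (set es))" "atomic p"
      | q where "p = Neg q" "q \<in> sentences (lang L rs M (set es))" "atomic q" "free_vars q = {}"
      using p unfolding conditions_def atomic_def sentences_def by auto
    then show ?thesis
    proof cases
      case 1
      then show ?thesis by (rule at)
    next
      case 2
      then show ?thesis using at[OF 2(2,3)] valid_in_iff[of q] valid_in_iff[of p] by auto
    qed
  qed
  have "decidable_among (code M ` conditions L rs M es) (code M ` Xi L rs M es N)"
  proof (rule decidable_among_if_enumerable)
    show "comp_enumerable (code M ` diagram_theory L rs M T D')" using enumerable D' ext by blast
    fix n assume "n \<in> code M ` conditions L rs M es"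
    then obtain p where p: "p \<in> conditions L rs M es" "n = code M p" by blast
    then have pS: "p \<in> ?S" "Neg p \<in> ?S" using cond by (auto simp: sentences_def)
    have "code M p \<in> code M ` Xi L rs M es N \<longleftrightarrow> p \<in> Xi L rs M es N"
      by (rule code_image_iff[OF pS(1)]) (use cond in \<open>auto simp: Xi_def\<close>)
    then have Xi: "code M p \<in> code M ` Xi L rs M es N \<longleftrightarrow> valid_in (naming N) p" using p(1) by (simp add: Xi_def)
    have in_th: "code M q \<in> code M ` diagram_theory L rs M T D' \<longleftrightarrow>
      (\<forall>N1\<in>diagram_class L rs M T D'. valid_in (naming N1) q)" if "q \<in> ?S" for q
      unfolding code_image_iff[OF that th] by (rule diagram_theory_iff[OF wf(2) that])
    have not: "valid_in N1 (Neg p) \<longleftrightarrow> \<not> valid_in N1 p" for N1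
      using pS(1) valid_in_iff[of p N1] valid_in_iff[of "Neg p" N1] by (auto simp: sentences_def)
    have all: "(\<forall>N1\<in>diagram_class L rs M T D'. valid_in (naming N1) p) \<longleftrightarrow> valid_in (naming N) p"
      "(\<forall>N1\<in>diagram_class L rs M T D'. valid_in (naming N1) (Neg p)) \<longleftrightarrow> \<not> valid_in (naming N) p"
      unfolding not using agree[OF p(1)] N by blast+
    show "n \<in> code M ` Xi L rs M es N \<longleftrightarrow> n \<in> code M ` diagram_theory L rs M T D'"
      unfolding p(2) Xi in_th[OF pS(1)] all(1) by (rule refl)
    have "prod_encode (3, code M p) = code M (Neg p)" by (simp add: code_def)
    then show "n \<notin> code M ` Xi L rs M es N \<longleftrightarrow> prod_encode (3, n) \<in> code M ` diagram_theory L rs M T D'"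
      using in_th[OF pS(2)] all(2) Xi unfolding p(2) by simp
  qed
  then show False
    using undecidable \<open>N \<in> diagram_class L rs M T D\<close> by (auto simp: Xi_undecidable_def es_def)
qed

end
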